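(* Let $R$ be a ring, $X$ a non-empty set, and $\mathbb S=R[X^{\pm1};\boldsymbol\alpha]$ a skew Laurent polynomial ring of bijective type. Let $\mathcal T$ be a submonoid of the free abelian group $G_X$ and let $A=R[\mathcal T;\boldsymbol\alpha]=\bigoplus_{\tau\in\mathcal T}R\tau$ (a subring of $\mathbb S$). Then $\mathcal T$ is a denominator set for $A$ (a left and right Ore set of regular elements), and the subgroup $G=\mathcal T\mathcal T^{-1}$ of $G_X$ is a free abelian group having a basis $X'$ such that the ring of fractions of $A$ with respect to $\mathcal T$ is the skew Laurent polynomial ring of bijective type $\mathbb S'=\bigoplus_{g\in G}Rg=R[X'^{\pm1};\boldsymbol\alpha]$, and $$\operatorname{udim}(A)=\operatorname{udim}(\mathbb S')=\operatorname{udim}(R[X';\boldsymbol\alpha]),\qquad \mathcal Z(A)=\mathcal Z(R)\mathcal T,$$ where $R[X';\boldsymbol\alpha]=\bigoplus_{\tau\in T(X')}R\tau$ with $T(X')$ the submonoid of $G$ generated by $X'$. Moreover, if $R$ has enough uniform left ideals, then so does $A$, and $\operatorname{udim}(A)=\operatorname{udim}(R)$.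
   Context: Skew Laurent polynomial ring of bijective type: $X$ is a set of commuting variables, $G_X$ is the free abelian group on $X$ (its elements are the terms $x_1^{k_1}\cdots x_n^{k_n}$, $k_i\in\mathbb Z$), and $\mathbb S=R[X^{\pm1};\boldsymbol\alpha]$ is the ring which is a free left $R$-module with basis $G_X$, where terms multiply as in $G_X$ and, for each $x\in X$, there is a ring automorphism $\alpha_x$ of $R$ with $xa=\alpha_x(a)x$ and $x^{-1}a=\alpha_x^{-1}(a)x^{-1}$ for all $a\in R$, the automorphisms $\alpha_x$ pairwise commuting as required for this to be well defined; for $g\in G_X$, $\alpha_g$ denotes the corresponding composite automorphism, so $ga=\alpha_g(a)g$. For a subset $Z\subseteq R$ and a set of terms $\mathcal T$, $Z\mathcal T$ denotes the set of elements $\sum a_i\tau_i$ with $a_i\in Z$, $\tau_i\in\mathcal T$. $\operatorname{udim}$ of a ring is its left uniform dimension (possibly infinite cardinal); $\mathcal Z(B)$ is the left singular ideal of a ring $B$ (elements whose left annihilator contains an essential left ideal). A ring has enough uniform left ideals if every non-zero left ideal contains a uniform left ideal. *)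

theory Defs
  imports "HOL-Algebra.Algebra"
begin


definition gadd :: "('x \<Rightarrow> int) \<Rightarrow> ('x \<Rightarrow> int) \<Rightarrow> ('x \<Rightarrow> int)" where
  "gadd g h = (\<lambda>v. g v + h v)"

definition gzero :: "'x \<Rightarrow> int" where
  "gzero = (\<lambda>v. 0)"

definition gneg :: "('x \<Rightarrow> int) \<Rightarrow> ('x \<Rightarrow> int)" where
  "gneg g = (\<lambda>v. - g v)"

definition free_ab :: "'x set \<Rightarrow> ('x \<Rightarrow> int) set" where
  "free_ab XS = {g. finite {v. g v \<noteq> 0} \<and> {v. g v \<noteq> 0} \<subseteq> XS}"

definition gvar :: "'x \<Rightarrow> ('x \<Rightarrow> int)" where
  "gvar x = (\<lambda>v. if v = x then 1 else 0)"

definition zcomb :: "(('x \<Rightarrow> int) \<Rightarrow> int) \<Rightarrow> ('x \<Rightarrow> int) set \<Rightarrow> ('x \<Rightarrow> int)" where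
  "zcomb c F = (\<lambda>v. \<Sum>y\<in>F. c y * y v)"

definition submonoid_G :: "'x set \<Rightarrow> ('x \<Rightarrow> int) set \<Rightarrow> bool" where
  "submonoid_G XS T \<longleftrightarrow> T \<subseteq> free_ab XS \<and> gzero \<in> T \<and> (\<forall>s\<in>T. \<forall>t\<in>T. gadd s t \<in> T)"

definition quot_group :: "('x \<Rightarrow> int) set \<Rightarrow> ('x \<Rightarrow> int) set" where
  "quot_group T = {gadd s (gneg t) | s t. s \<in> T \<and> t \<in> T}"

definition is_zbasis :: "('x \<Rightarrow> int) set \<Rightarrow> ('x \<Rightarrow> int) set \<Rightarrow> bool" where
  "is_zbasis B G \<longleftrightarrow> B \<subseteq> G
     \<and> (\<forall>g\<in>G. \<exists>F c. finite F \<and> F \<subseteq> B \<and> g = zcomb c F)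
     \<and> (\<forall>F c. finite F \<and> F \<subseteq> B \<and> zcomb c F = gzero \<longrightarrow> (\<forall>y\<in>F. c y = 0))"

definition gen_monoid :: "('x \<Rightarrow> int) set \<Rightarrow> ('x \<Rightarrow> int) set" where
  "gen_monoid B = {zcomb c F | c F. finite F \<and> F \<subseteq> B \<and> (\<forall>y. c y \<ge> 0)}"

text \<open>beta g is the automorphism alpha_g attached to the term g of G_X; the data
  (alpha_x)_{x in X} of pairwise commuting automorphisms is the same as a group
  homomorphism g \<mapsto> alpha_g from G_X to Aut(R), with alpha_x = beta (gvar x).\<close>
definition skew_data :: "('a, 'm) ring_scheme \<Rightarrow> 'x set \<Rightarrow> (('x \<Rightarrow> int) \<Rightarrow> 'a \<Rightarrow> 'a) \<Rightarrow> bool" where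
  "skew_data R XS \<beta> \<longleftrightarrow>
     (\<forall>g\<in>free_ab XS. \<beta> g \<in> ring_iso R R)
     \<and> (\<forall>a\<in>carrier R. \<beta> gzero a = a)
     \<and> (\<forall>g\<in>free_ab XS. \<forall>h\<in>free_ab XS. \<forall>a\<in>carrier R. \<beta> (gadd g h) a = \<beta> g (\<beta> h a))"

text \<open>The ring  R[Gamma; alpha] = (direct sum over g in Gamma of R g), a subring of
  R[X^{\<plusminus>1}; alpha] when Gamma is a submonoid of G_X.  Elements are finitely supported
  coefficient functions; (a g)(b h) = a alpha_g(b) (g h).\<close>
definition skew_ring :: "('a, 'm) ring_scheme \<Rightarrow> (('x \<Rightarrow> int) \<Rightarrow> 'a \<Rightarrow> 'a) \<Rightarrow> ('x \<Rightarrow> int) set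
      \<Rightarrow> (('x \<Rightarrow> int) \<Rightarrow> 'a) ring" where
  "skew_ring R \<beta> \<Gamma> = \<lparr>
     carrier = {f. (\<forall>g. f g \<in> carrier R) \<and> finite {g. f g \<noteq> \<zero>\<^bsub>R\<^esub>}
                   \<and> {g. f g \<noteq> \<zero>\<^bsub>R\<^esub>} \<subseteq> \<Gamma>},
     monoid.mult = (\<lambda>f h. \<lambda>k. finsum R (\<lambda>p. f (fst p) \<otimes>\<^bsub>R\<^esub> \<beta> (fst p) (h (snd p)))
                         {p. gadd (fst p) (snd p) = k \<and> f (fst p) \<noteq> \<zero>\<^bsub>R\<^esub> \<and> h (snd p) \<noteq> \<zero>\<^bsub>R\<^esub>}),
     monoid.one = (\<lambda>g. if g = gzero then \<one>\<^bsub>R\<^esub> else \<zero>\<^bsub>R\<^esub>),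
     ring.zero = (\<lambda>g. \<zero>\<^bsub>R\<^esub>),
     ring.add = (\<lambda>f h. \<lambda>g. f g \<oplus>\<^bsub>R\<^esub> h g) \<rparr>"

definition term_elem :: "('a, 'm) ring_scheme \<Rightarrow> ('x \<Rightarrow> int) \<Rightarrow> (('x \<Rightarrow> int) \<Rightarrow> 'a)" where
  "term_elem R t = (\<lambda>g. if g = t then \<one>\<^bsub>R\<^esub> else \<zero>\<^bsub>R\<^esub>)"

definition coeff_in :: "('a, 'm) ring_scheme \<Rightarrow> (('x \<Rightarrow> int) \<Rightarrow> 'a \<Rightarrow> 'a) \<Rightarrow> 'a set \<Rightarrow> ('x \<Rightarrow> int) set
      \<Rightarrow> (('x \<Rightarrow> int) \<Rightarrow> 'a) set" where
  "coeff_in R \<beta> Z T = {f \<in> carrier (skew_ring R \<beta> T). \<forall>g. f g \<in> Z}"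

definition left_ideal :: "'b set \<Rightarrow> ('b, 'n) ring_scheme \<Rightarrow> bool" where
  "left_ideal I B \<longleftrightarrow> additive_subgroup I B \<and> (\<forall>a\<in>carrier B. \<forall>x\<in>I. a \<otimes>\<^bsub>B\<^esub> x \<in> I)"

definition essential_left_ideal :: "'b set \<Rightarrow> ('b, 'n) ring_scheme \<Rightarrow> bool" where
  "essential_left_ideal L B \<longleftrightarrow> left_ideal L B \<and>
     (\<forall>I. left_ideal I B \<and> I \<noteq> {\<zero>\<^bsub>B\<^esub>} \<longrightarrow> L \<inter> I \<noteq> {\<zero>\<^bsub>B\<^esub>})"

definition singular_ideal :: "('b, 'n) ring_scheme \<Rightarrow> 'b set" where
  "singular_ideal B = {a \<in> carrier B. \<exists>L. essential_left_ideal L B \<and> (\<forall>l\<in>L. l \<otimes>\<^bsub>B\<^esub> a = \<zero>\<^bsub>B\<^esub>)}"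

definition uniform_left_ideal :: "'b set \<Rightarrow> ('b, 'n) ring_scheme \<Rightarrow> bool" where
  "uniform_left_ideal U B \<longleftrightarrow> left_ideal U B \<and> U \<noteq> {\<zero>\<^bsub>B\<^esub>} \<and>
     (\<forall>I J. left_ideal I B \<and> left_ideal J B \<and> I \<subseteq> U \<and> J \<subseteq> U \<and> I \<noteq> {\<zero>\<^bsub>B\<^esub>} \<and> J \<noteq> {\<zero>\<^bsub>B\<^esub>}
            \<longrightarrow> I \<inter> J \<noteq> {\<zero>\<^bsub>B\<^esub>})"

definition enough_uniform :: "('b, 'n) ring_scheme \<Rightarrow> bool" where
  "enough_uniform B \<longleftrightarrow> (\<forall>I. left_ideal I B \<and> I \<noteq> {\<zero>\<^bsub>B\<^esub>} \<longrightarrow> (\<exists>U. U \<subseteq> I \<and> uniform_left_ideal U B))"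

definition indep_family :: "('b, 'n) ring_scheme \<Rightarrow> 'b set set \<Rightarrow> bool" where
  "indep_family B \<F> \<longleftrightarrow> (\<forall>I\<in>\<F>. left_ideal I B \<and> I \<noteq> {\<zero>\<^bsub>B\<^esub>}) \<and>
     (\<forall>\<G> f. finite \<G> \<and> \<G> \<subseteq> \<F> \<and> (\<forall>I\<in>\<G>. f I \<in> I) \<and> finsum B f \<G> = \<zero>\<^bsub>B\<^esub>
            \<longrightarrow> (\<forall>I\<in>\<G>. f I = \<zero>\<^bsub>B\<^esub>))"

text \<open>udim B = sup { |F| : F independent family of non-zero left ideals of B } (a cardinal).
  udim_le B1 B2 expresses  udim B1 \<le> udim B2  for these suprema: every cardinal strictly
  below the size of an independent family of B1 is strictly below the size of some
  independent family of B2 (cardinals below |F| are represented by subsets of F).\<close>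
definition udim_le :: "('b, 'n) ring_scheme \<Rightarrow> ('c, 'k) ring_scheme \<Rightarrow> bool" where
  "udim_le B1 B2 \<longleftrightarrow> (\<forall>\<F>. indep_family B1 \<F> \<longrightarrow>
      (\<forall>C. C \<subseteq> \<F> \<and> (card_of C, card_of \<F>) \<in> ordLess \<longrightarrow> (\<exists>\<F>'. indep_family B2 \<F>' \<and> (card_of C, card_of \<F>') \<in> ordLess)))"

definition udim_eq :: "('b, 'n) ring_scheme \<Rightarrow> ('c, 'k) ring_scheme \<Rightarrow> bool" where
  "udim_eq B1 B2 \<longleftrightarrow> udim_le B1 B2 \<and> udim_le B2 B1"

definition regular_elem :: "('b, 'n) ring_scheme \<Rightarrow> 'b \<Rightarrow> bool" where
  "regular_elem B s \<longleftrightarrow> s \<in> carrier B \<and>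
     (\<forall>a\<in>carrier B. (a \<otimes>\<^bsub>B\<^esub> s = \<zero>\<^bsub>B\<^esub> \<longrightarrow> a = \<zero>\<^bsub>B\<^esub>) \<and> (s \<otimes>\<^bsub>B\<^esub> a = \<zero>\<^bsub>B\<^esub> \<longrightarrow> a = \<zero>\<^bsub>B\<^esub>))"

definition mult_closed :: "('b, 'n) ring_scheme \<Rightarrow> 'b set \<Rightarrow> bool" where
  "mult_closed B S \<longleftrightarrow> S \<subseteq> carrier B \<and> \<one>\<^bsub>B\<^esub> \<in> S \<and> (\<forall>s\<in>S. \<forall>t\<in>S. s \<otimes>\<^bsub>B\<^esub> t \<in> S)"

definition left_ore :: "('b, 'n) ring_scheme \<Rightarrow> 'b set \<Rightarrow> bool" where
  "left_ore B S \<longleftrightarrow> (\<forall>a\<in>carrier B. \<forall>s\<in>S. \<exists>a'\<in>carrier B. \<exists>s'\<in>S. s' \<otimes>\<^bsub>B\<^esub> a = a' \<otimes>\<^bsub>B\<^esub> s)"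

definition right_ore :: "('b, 'n) ring_scheme \<Rightarrow> 'b set \<Rightarrow> bool" where
  "right_ore B S \<longleftrightarrow> (\<forall>a\<in>carrier B. \<forall>s\<in>S. \<exists>a'\<in>carrier B. \<exists>s'\<in>S. a \<otimes>\<^bsub>B\<^esub> s' = s \<otimes>\<^bsub>B\<^esub> a')"

definition denominator_set :: "('b, 'n) ring_scheme \<Rightarrow> 'b set \<Rightarrow> bool" where
  "denominator_set B S \<longleftrightarrow> mult_closed B S \<and> left_ore B S \<and> right_ore B S \<and> (\<forall>s\<in>S. regular_elem B s)"

definition ring_of_fractions :: "('b, 'n) ring_scheme \<Rightarrow> ('b, 'k) ring_scheme \<Rightarrow> 'b set \<Rightarrow> bool" where
  "ring_of_fractions Q B S \<longleftrightarrow>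
     subring (carrier B) Q
     \<and> \<one>\<^bsub>B\<^esub> = \<one>\<^bsub>Q\<^esub> \<and> \<zero>\<^bsub>B\<^esub> = \<zero>\<^bsub>Q\<^esub>
     \<and> (\<forall>a\<in>carrier B. \<forall>b\<in>carrier B. a \<otimes>\<^bsub>B\<^esub> b = a \<otimes>\<^bsub>Q\<^esub> b \<and> a \<oplus>\<^bsub>B\<^esub> b = a \<oplus>\<^bsub>Q\<^esub> b)
     \<and> S \<subseteq> Units Q
     \<and> (\<forall>q\<in>carrier Q. \<exists>s\<in>S. \<exists>b\<in>carrier B. q = inv\<^bsub>Q\<^esub> s \<otimes>\<^bsub>Q\<^esub> b)
     \<and> (\<forall>q\<in>carrier Q. \<exists>s\<in>S. \<exists>b\<in>carrier B. q = b \<otimes>\<^bsub>Q\<^esub> inv\<^bsub>Q\<^esub> s)"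

end

theory Submission
  imports Defs "HOL-Library.Function_Algebras"
begin

text \<open>
  Multiplication by terms moves left ideals of \<open>A\<close> and of its ring of fractions back and forth, which
  gives the equalities of uniform dimensions; the basis \<open>X'\<close> comes from the usual well-ordering
  argument for subgroups of free abelian groups. The group of terms is totally ordered, so the singular
  ideal is found by looking at leading coefficients.

  The heart of the matter is that a uniform left ideal \<open>U\<close> of \<open>R\<close> generates a uniform left ideal
  \<open>A U\<close>. Take nonzero \<open>f, h \<in> A U\<close>; after passing to multiples, all nonzero coefficients of \<open>f\<close>
  (and of \<open>h\<close>) have the same annihilator, and then the modules \<open>R \<tau> f\<close> are independent. Let \<open>D\<close> be the
  union of the supports of \<open>f\<close> and \<open>h\<close>. Sumsets in an abelian group grow polynomially, so there is a
  finite set \<open>P\<close> of terms with \<open>|P D| < 2 |P|\<close>. The \<open>2 |P|\<close> elements \<open>\<tau> f\<close>, \<open>\<tau> h\<close> (\<open>\<tau> \<in> P\<close>) live in a direct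
  sum of \<open>|P D|\<close> uniform modules, so they are dependent, and the dependence is a common multiple of
  \<open>f\<close> and \<open>h\<close>. A maximal independent family of uniform left ideals of \<open>R\<close> thus extends to one of \<open>A\<close>
  with essential sum, and such a family bounds the size of every independent family.
\<close>

section \<open>Left ideals and dependence in products of uniform left ideals\<close>

text \<open>Two obstacles shape the central step. First, an element of \<open>A U\<close> has its
  coefficient at \<open>g\<close> in \<open>alpha_g(U)\<close>, and \<open>U\<close> need not be
  stable under the automorphisms, so \<open>f\<close> and \<open>h\<close> cannot be compared inside
  \<open>U\<close> itself. Each twisted copy is again uniform, however, and counting elements
  against uniform coordinates does not care which copies occur. Second, \<open>R\<close> may have
  zero divisors: a linear relation may consist of vanishing summands, or involve multiples of
  \<open>f\<close> alone. Nontriviality is therefore measured by a nonvanishing summand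
  \<open>b j v j\<close> rather than by a nonzero coefficient, and equal annihilators ensure that a
  relation among multiples of \<open>f\<close> alone has only zero summands, so that a nontrivial
  one must mix \<open>f\<close> and \<open>h\<close>. Uniform dimension is a possibly infinite
  supremum that need not be attained. Every comparison therefore sends each independent family to
  one at least as large, and for infinite index sets the bound comes from counting finite
  supports.\<close>

definition indep_on :: "('b, 'n) ring_scheme \<Rightarrow> 'i set \<Rightarrow> ('i \<Rightarrow> 'b set) \<Rightarrow> bool" where
  "indep_on B I V \<longleftrightarrow> (\<forall>i\<in>I. left_ideal (V i) B \<and> V i \<noteq> {\<zero>\<^bsub>B\<^esub>}) \<and>
     (\<forall>Q f. finite Q \<and> Q \<subseteq> I \<and> (\<forall>i\<in>Q. f i \<in> V i) \<and> finsum B f Q = \<zero>\<^bsub>B\<^esub>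
            \<longrightarrow> (\<forall>i\<in>Q. f i = \<zero>\<^bsub>B\<^esub>))"

text \<open>Indexing lets a family of left ideals of one ring label its extensions or contractions
  in another before these are known to be distinct.\<close>

lemma indep_family_iff_indep_on: "indep_family B F \<longleftrightarrow> indep_on B F (\<lambda>I. I)"
  unfolding indep_family_def indep_on_def by blast

lemma indep_onD:
  assumes "indep_on B I V" "finite Q" "Q \<subseteq> I" "\<And>i. i \<in> Q \<Longrightarrow> f i \<in> V i" "finsum B f Q = \<zero>\<^bsub>B\<^esub>" "i \<in> Q"
  shows "f i = \<zero>\<^bsub>B\<^esub>"
  using assms unfolding indep_on_def by blast

lemma indep_on_left_ideal: "indep_on B I V \<Longrightarrow> i \<in> I \<Longrightarrow> left_ideal (V i) B"
  and indep_on_nonzero: "indep_on B I V \<Longrightarrow> i \<in> I \<Longrightarrow> V i \<noteq> {\<zero>\<^bsub>B\<^esub>}"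
  unfolding indep_on_def by blast+

lemma uniform_left_idealD: "uniform_left_ideal U B \<Longrightarrow> left_ideal U B"
  by (simp add: uniform_left_ideal_def)

lemma essential_left_idealD: "essential_left_ideal U B \<Longrightarrow> left_ideal U B"
  by (simp add: essential_left_ideal_def)

context ring
begin

lemma left_ideal_subset: "left_ideal I R \<Longrightarrow> I \<subseteq> carrier R"
  unfolding left_ideal_def by (meson additive_subgroup.a_subset)

lemma left_ideal_carrier: "left_ideal I R \<Longrightarrow> x \<in> I \<Longrightarrow> x \<in> carrier R"
  using left_ideal_subset by blast

lemma left_ideal_zero: "left_ideal I R \<Longrightarrow> \<zero> \<in> I"
  unfolding left_ideal_def by (meson additive_subgroup.zero_closed)

lemma left_ideal_add: "left_ideal I R \<Longrightarrow> x \<in> I \<Longrightarrow> y \<in> I \<Longrightarrow> x \<oplus> y \<in> I"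
  unfolding left_ideal_def by (meson additive_subgroup.a_closed)

lemma left_ideal_mult: "left_ideal I R \<Longrightarrow> a \<in> carrier R \<Longrightarrow> x \<in> I \<Longrightarrow> a \<otimes> x \<in> I"
  unfolding left_ideal_def by blast

lemma left_ideal_minus: "left_ideal I R \<Longrightarrow> x \<in> I \<Longrightarrow> \<ominus> x \<in> I"
  using left_ideal_mult[of I "\<ominus> \<one>" x] left_ideal_carrier[of I x] l_minus[of \<one> x] by simp

lemma left_idealI:
  assumes "I \<subseteq> carrier R" "\<zero> \<in> I" "\<And>x y. x \<in> I \<Longrightarrow> y \<in> I \<Longrightarrow> x \<oplus> y \<in> I"
    "\<And>a x. a \<in> carrier R \<Longrightarrow> x \<in> I \<Longrightarrow> a \<otimes> x \<in> I"
  shows "left_ideal I R"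
proof -
  have m: "\<ominus> x \<in> I" if "x \<in> I" for x
    using assms(4)[of "\<ominus> \<one>" x] assms(1) that l_minus[of \<one> x] by force
  have "subgroup I (add_monoid R)"
    by (rule group.subgroupI[OF add.is_group])
       (use assms m in \<open>auto simp: a_inv_def[symmetric]\<close>)
  then show ?thesis
    unfolding left_ideal_def additive_subgroup_def using assms(4) by blast
qed

lemma left_ideal_finsum:
  assumes "left_ideal I R" "\<And>i. i \<in> Q \<Longrightarrow> f i \<in> I"
  shows "finsum R f Q \<in> I"
  using assms(2)
proof (induction Q rule: infinite_finite_induct)
  case (insert x F)
  then have "f \<in> F \<rightarrow> carrier R" "f x \<in> carrier R"
    using left_ideal_carrier[OF assms(1)] by auto
  then show ?case using insert left_ideal_add[OF assms(1)] by simp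
qed (use assms in \<open>auto simp: left_ideal_zero finsum_infinite\<close>)

lemma left_ideal_Int: "left_ideal I R \<Longrightarrow> left_ideal J R \<Longrightarrow> left_ideal (I \<inter> J) R"
  by (rule left_idealI) (auto intro: left_ideal_carrier left_ideal_zero left_ideal_add left_ideal_mult)

lemma left_ideal_carrier_self: "left_ideal (carrier R) R"
  by (rule left_idealI) auto

lemma left_ideal_principal:
  assumes "a \<in> carrier R"
  shows "left_ideal ((\<lambda>b. b \<otimes> a) ` carrier R) R"
proof (rule left_idealI)
  show "(\<lambda>b. b \<otimes> a) ` carrier R \<subseteq> carrier R" using assms by auto
  show "\<zero> \<in> (\<lambda>b. b \<otimes> a) ` carrier R"
    using assms by (intro image_eqI[of _ _ \<zero>]) auto
next
  fix x y assume "x \<in> (\<lambda>b. b \<otimes> a) ` carrier R" "y \<in> (\<lambda>b. b \<otimes> a) ` carrier R"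
  then obtain u v where "u \<in> carrier R" "v \<in> carrier R" "x = u \<otimes> a" "y = v \<otimes> a" by blast
  then show "x \<oplus> y \<in> (\<lambda>b. b \<otimes> a) ` carrier R"
    using assms by (intro image_eqI[of _ _ "u \<oplus> v"]) (auto simp: l_distr)
next
  fix c x assume "c \<in> carrier R" "x \<in> (\<lambda>b. b \<otimes> a) ` carrier R"
  then obtain u where "u \<in> carrier R" "x = u \<otimes> a" by blast
  then show "c \<otimes> x \<in> (\<lambda>b. b \<otimes> a) ` carrier R"
    using assms \<open>c \<in> carrier R\<close> by (intro image_eqI[of _ _ "c \<otimes> u"]) (auto simp: m_assoc)
qed

lemma nonzero_ex: "left_ideal I R \<Longrightarrow> I \<noteq> {\<zero>} \<Longrightarrow> \<exists>x\<in>I. x \<noteq> \<zero>"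
  using left_ideal_zero by blast

lemma principal_nonzero: "a \<in> carrier R \<Longrightarrow> a \<noteq> \<zero> \<Longrightarrow> (\<lambda>b. b \<otimes> a) ` carrier R \<noteq> {\<zero>}"
  by (metis image_eqI l_one one_closed singletonD)

lemma essential_left_idealI:
  assumes "left_ideal L R" "\<And>a. a \<in> carrier R \<Longrightarrow> a \<noteq> \<zero> \<Longrightarrow> \<exists>b\<in>carrier R. b \<otimes> a \<in> L \<and> b \<otimes> a \<noteq> \<zero>"
  shows "essential_left_ideal L R"
  unfolding essential_left_ideal_def
proof (intro conjI allI impI assms(1))
  fix I assume I: "left_ideal I R \<and> I \<noteq> {\<zero>}"
  then obtain a where a: "a \<in> I" "a \<noteq> \<zero>" using nonzero_ex by auto
  then obtain b where b: "b \<in> carrier R" "b \<otimes> a \<in> L" "b \<otimes> a \<noteq> \<zero>"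
    using assms(2)[of a] left_ideal_carrier[of I a] I by auto
  then have "b \<otimes> a \<in> L \<inter> I" using left_ideal_mult[of I b a] I a by simp
  then show "L \<inter> I \<noteq> {\<zero>}" using b(3) by auto
qed

lemma essential_left_ideal_multiple:
  assumes "essential_left_ideal L R" "a \<in> carrier R" "a \<noteq> \<zero>"
  shows "\<exists>b\<in>carrier R. b \<otimes> a \<in> L \<and> b \<otimes> a \<noteq> \<zero>"
proof -
  have "L \<inter> ((\<lambda>b. b \<otimes> a) ` carrier R) \<noteq> {\<zero>}"
    using assms(1) left_ideal_principal[OF assms(2)] principal_nonzero[OF assms(2,3)]
    unfolding essential_left_ideal_def by simp
  moreover have "\<zero> \<in> L \<inter> ((\<lambda>b. b \<otimes> a) ` carrier R)"
    using left_ideal_zero[OF left_ideal_principal[OF assms(2)]]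
      left_ideal_zero[OF essential_left_idealD[OF assms(1)]] by simp
  ultimately show ?thesis by blast
qed

lemma uniform_left_ideal_common_multiple:
  assumes "uniform_left_ideal U R" "a \<in> U" "a \<noteq> \<zero>" "b \<in> U" "b \<noteq> \<zero>"
  shows "\<exists>r\<in>carrier R. \<exists>s\<in>carrier R. r \<otimes> a = s \<otimes> b \<and> r \<otimes> a \<noteq> \<zero>"
proof -
  let ?I = "\<lambda>a. (\<lambda>b. b \<otimes> a) ` carrier R"
  have U: "left_ideal U R" using assms(1) by (rule uniform_left_idealD)
  have c: "a \<in> carrier R" "b \<in> carrier R" using left_ideal_carrier U assms by auto
  have "?I a \<subseteq> U" "?I b \<subseteq> U" using left_ideal_mult[OF U] assms by auto
  then have "?I a \<inter> ?I b \<noteq> {\<zero>}"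
    using assms(1) left_ideal_principal[OF c(1)] left_ideal_principal[OF c(2)]
      principal_nonzero[OF c(1) assms(3)] principal_nonzero[OF c(2) assms(5)]
    unfolding uniform_left_ideal_def by simp
  moreover have "\<zero> \<in> ?I a \<inter> ?I b"
    using left_ideal_zero[OF left_ideal_principal] c by simp
  ultimately obtain x where "x \<in> ?I a \<inter> ?I b" "x \<noteq> \<zero>" by blast
  then show ?thesis by auto
qed

lemma uniform_left_idealI:
  assumes "left_ideal U R" "U \<noteq> {\<zero>}"
    "\<And>a b. a \<in> U \<Longrightarrow> b \<in> U \<Longrightarrow> a \<noteq> \<zero> \<Longrightarrow> b \<noteq> \<zero> \<Longrightarrow>
       \<exists>r\<in>carrier R. \<exists>s\<in>carrier R. r \<otimes> a = s \<otimes> b \<and> r \<otimes> a \<noteq> \<zero>"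
  shows "uniform_left_ideal U R"
  unfolding uniform_left_ideal_def
proof (intro conjI allI impI assms(1,2), elim conjE)
  fix I J assume IJ: "left_ideal I R" "left_ideal J R" "I \<subseteq> U" "J \<subseteq> U" "I \<noteq> {\<zero>}" "J \<noteq> {\<zero>}"
  obtain a b where ab: "a \<in> I" "a \<noteq> \<zero>" "b \<in> J" "b \<noteq> \<zero>"
    using nonzero_ex[OF IJ(1,5)] nonzero_ex[OF IJ(2,6)] by auto
  then obtain r s where rs: "r \<in> carrier R" "s \<in> carrier R" "r \<otimes> a = s \<otimes> b" "r \<otimes> a \<noteq> \<zero>"
    using assms(3)[of a b] IJ(3,4) by (meson subsetD)
  then have "r \<otimes> a \<in> I" "r \<otimes> a \<in> J"
    using left_ideal_mult[OF IJ(1) rs(1) ab(1)] left_ideal_mult[OF IJ(2) rs(2) ab(3)] by auto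
  then show "I \<inter> J \<noteq> {\<zero>}" using rs(4) by auto
qed

section \<open>Linear algebra with coordinates in uniform or essential left ideals\<close>

lemma finsum_uminus:
  assumes "finite Q" "\<And>q. q \<in> Q \<Longrightarrow> f q \<in> carrier R"
  shows "\<ominus> (\<Oplus>q\<in>Q. f q) = (\<Oplus>q\<in>Q. \<ominus> f q)"
  using assms
proof (induction Q rule: finite_induct)
  case (insert x F)
  then have "f \<in> F \<rightarrow> carrier R" "(\<lambda>q. \<ominus> f q) \<in> F \<rightarrow> carrier R" by auto
  then show ?case using insert by (simp add: minus_add)
qed simp

lemma finsum_swap:
  assumes "finite A" "finite B" "\<And>a b. a \<in> A \<Longrightarrow> b \<in> B \<Longrightarrow> f a b \<in> carrier R"
  shows "(\<Oplus>a\<in>A. \<Oplus>b\<in>B. f a b) = (\<Oplus>b\<in>B. \<Oplus>a\<in>A. f a b)"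
  using assms(1,3)
proof (induction A rule: finite_induct)
  case (insert x F)
  have "(\<Oplus>b\<in>B. \<Oplus>a\<in>insert x F. f a b) = (\<Oplus>b\<in>B. f x b \<oplus> (\<Oplus>a\<in>F. f a b))"
    by (rule finsum_cong') (use insert in \<open>auto intro!: finsum_closed\<close>)
  also have "\<dots> = (\<Oplus>b\<in>B. f x b) \<oplus> (\<Oplus>b\<in>B. \<Oplus>a\<in>F. f a b)"
    by (rule finsum_addf) (use insert in \<open>auto intro!: finsum_closed\<close>)
  also have "(\<Oplus>b\<in>B. \<Oplus>a\<in>F. f a b) = (\<Oplus>a\<in>F. \<Oplus>b\<in>B. f a b)"
    using insert by simp
  also have "(\<Oplus>b\<in>B. f x b) \<oplus> \<dots> = (\<Oplus>a\<in>insert x F. \<Oplus>b\<in>B. f a b)"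
    by (rule finsum_insert[symmetric]) (use insert in \<open>auto intro!: finsum_closed\<close>)
  finally show ?case by simp
qed simp

text \<open>A nonzero multiple \<open>b v\<close> with the fewest nonzero coordinates works: any \<open>c\<close> killing one nonzero
  coordinate would otherwise produce a smaller nonzero multiple.\<close>

lemma ex_multiple_uniform_annihilator:
  assumes Q: "finite Q" and v: "\<And>q. q \<in> Q \<Longrightarrow> v q \<in> carrier R" and nz: "\<exists>q\<in>Q. v q \<noteq> \<zero>"
  shows "\<exists>b\<in>carrier R. (\<exists>q\<in>Q. b \<otimes> v q \<noteq> \<zero>) \<and>
    (\<forall>c\<in>carrier R. \<forall>q\<in>Q. b \<otimes> v q \<noteq> \<zero> \<longrightarrow> c \<otimes> (b \<otimes> v q) = \<zero> \<longrightarrow> (\<forall>q'\<in>Q. c \<otimes> (b \<otimes> v q') = \<zero>))"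
proof -
  let ?P = "\<lambda>b. b \<in> carrier R \<and> (\<exists>q\<in>Q. b \<otimes> v q \<noteq> \<zero>)"
  let ?N = "\<lambda>b. {q\<in>Q. b \<otimes> v q \<noteq> \<zero>}"
  have "?P \<one>" using nz v by auto
  then obtain b where b: "?P b" and min: "\<And>c. ?P c \<Longrightarrow> card (?N b) \<le> card (?N c)"
    using ex_has_least_nat[of ?P \<one> "\<lambda>b. card (?N b)"] by blast
  have "c \<otimes> (b \<otimes> v q') = \<zero>"
    if c: "c \<in> carrier R" and q: "q \<in> Q" "b \<otimes> v q \<noteq> \<zero>" "c \<otimes> (b \<otimes> v q) = \<zero>" and q': "q' \<in> Q" for c q q'
  proof (rule ccontr)
    assume n: "c \<otimes> (b \<otimes> v q') \<noteq> \<zero>"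
    have eq: "(c \<otimes> b) \<otimes> v p = c \<otimes> (b \<otimes> v p)" if "p \<in> Q" for p
      using m_assoc c b v that by blast
    have "?P (c \<otimes> b)" using c b n q' eq by auto
    moreover have "?N (c \<otimes> b) \<subset> ?N b"
    proof
      show "?N (c \<otimes> b) \<subseteq> ?N b" using eq c by auto
      have "q \<in> ?N b" "q \<notin> ?N (c \<otimes> b)" using q eq by auto
      then show "?N (c \<otimes> b) \<noteq> ?N b" by metis
    qed
    then have "card (?N (c \<otimes> b)) < card (?N b)"
      using Q by (intro psubset_card_mono) auto
    ultimately show False using min by fastforce
  qed
  then show ?thesis using b by blast
qed

text \<open>Among the multiples with some nonzero coordinate, one with the fewest coordinates
  outside their \<open>L q\<close> has none outside. A bad coordinate is nonzero, so essentiality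
  yields a \<open>c\<close> that moves it into \<open>L q\<close> without killing it, while the
  coordinates already in place stay there.\<close>

lemma ex_multiple_in_essential:
  assumes Q: "finite Q" and L: "\<And>q. q \<in> Q \<Longrightarrow> essential_left_ideal (L q) R"
    and v: "\<And>q. q \<in> Q \<Longrightarrow> v q \<in> carrier R" and nz: "\<exists>q\<in>Q. v q \<noteq> \<zero>"
  shows "\<exists>b\<in>carrier R. (\<forall>q\<in>Q. b \<otimes> v q \<in> L q) \<and> (\<exists>q\<in>Q. b \<otimes> v q \<noteq> \<zero>)"
proof -
  let ?P = "\<lambda>b. b \<in> carrier R \<and> (\<exists>q\<in>Q. b \<otimes> v q \<noteq> \<zero>)"
  let ?N = "\<lambda>b. {q\<in>Q. b \<otimes> v q \<notin> L q}"
  have "?P \<one>" using nz v by auto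
  then obtain b where b: "?P b" and min: "\<And>c. ?P c \<Longrightarrow> card (?N b) \<le> card (?N c)"
    using ex_has_least_nat[of ?P \<one> "\<lambda>b. card (?N b)"] by blast
  have L': "left_ideal (L q) R" if "q \<in> Q" for q using L[OF that] by (rule essential_left_idealD)
  have "b \<otimes> v q \<in> L q" if q: "q \<in> Q" for q
  proof (rule ccontr)
    assume n: "b \<otimes> v q \<notin> L q"
    then have "b \<otimes> v q \<noteq> \<zero>" using left_ideal_zero[OF L'[OF q]] by metis
    moreover have "b \<otimes> v q \<in> carrier R" using b v[OF q] by simp
    ultimately obtain c where c: "c \<in> carrier R" "c \<otimes> (b \<otimes> v q) \<in> L q" "c \<otimes> (b \<otimes> v q) \<noteq> \<zero>"
      using essential_left_ideal_multiple[OF L[OF q]] by blast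
    have eq: "(c \<otimes> b) \<otimes> v p = c \<otimes> (b \<otimes> v p)" if "p \<in> Q" for p
      using m_assoc c b v that by blast
    have "?P (c \<otimes> b)" using c b n q eq by auto
    moreover have "?N (c \<otimes> b) \<subset> ?N b"
    proof
      show "?N (c \<otimes> b) \<subseteq> ?N b" using eq c left_ideal_mult[OF L'] by auto
      have "q \<in> ?N b" "q \<notin> ?N (c \<otimes> b)" using q eq c n by auto
      then show "?N (c \<otimes> b) \<noteq> ?N b" by metis
    qed
    then have "card (?N (c \<otimes> b)) < card (?N b)"
      using Q by (intro psubset_card_mono) auto
    ultimately show False using min by fastforce
  qed
  then show ?thesis using b by blast
qed

text \<open>Gaussian elimination: the pivot row is first replaced by a multiple all of whose nonzero
  coordinates have the same annihilator, so that a combination killing the pivot coordinate kills the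
  whole pivot row.\<close>

lemma dependent_in_uniform:
  assumes "finite Q" "finite J" "card Q < card J" "\<And>q. q \<in> Q \<Longrightarrow> uniform_left_ideal (V q) R"
    "\<And>j q. j \<in> J \<Longrightarrow> q \<in> Q \<Longrightarrow> v j q \<in> V q" "\<And>j. j \<in> J \<Longrightarrow> \<exists>q\<in>Q. v j q \<noteq> \<zero>"
  shows "\<exists>b. (\<forall>j\<in>J. b j \<in> carrier R) \<and> (\<forall>q\<in>Q. (\<Oplus>j\<in>J. b j \<otimes> v j q) = \<zero>) \<and>
    (\<exists>j\<in>J. \<exists>q\<in>Q. b j \<otimes> v j q \<noteq> \<zero>)"
  using assms
proof (induction "card Q" arbitrary: Q J v)
  case 0
  then have "Q = {}" "J \<noteq> {}" by auto
  then show ?case using "0.prems"(6) by blast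
next
  case (Suc n)
  note finQ = Suc.prems(1) and finJ = Suc.prems(2) and V = Suc.prems(4) and vV = Suc.prems(5)
    and vnz = Suc.prems(6)
  have VI: "left_ideal (V q) R" if "q \<in> Q" for q using V[OF that] by (rule uniform_left_idealD)
  have vc: "v j q \<in> carrier R" if "j \<in> J" "q \<in> Q" for j q
    using left_ideal_carrier[OF VI vV] that by auto
  obtain j0 where j0: "j0 \<in> J" using Suc.prems(3) by fastforce
  obtain b0 where b0: "b0 \<in> carrier R" "\<exists>q\<in>Q. b0 \<otimes> v j0 q \<noteq> \<zero>"
    and good: "\<And>c q q'. c \<in> carrier R \<Longrightarrow> q \<in> Q \<Longrightarrow> b0 \<otimes> v j0 q \<noteq> \<zero> \<Longrightarrow>
       c \<otimes> (b0 \<otimes> v j0 q) = \<zero> \<Longrightarrow> q' \<in> Q \<Longrightarrow> c \<otimes> (b0 \<otimes> v j0 q') = \<zero>"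
    using ex_multiple_uniform_annihilator[of Q "v j0", OF finQ vc[OF j0] vnz[OF j0]] by blast
  define w where "w q = b0 \<otimes> v j0 q" for q
  have wV: "w q \<in> V q" if "q \<in> Q" for q
    unfolding w_def using left_ideal_mult[OF VI b0(1) vV] j0 that by blast
  have wc: "w q \<in> carrier R" if "q \<in> Q" for q using left_ideal_carrier[OF VI wV] that by blast
  obtain q0 where q0: "q0 \<in> Q" "w q0 \<noteq> \<zero>" using b0(2) unfolding w_def by blast
  let ?J = "J - {j0}" and ?Q = "Q - {q0}"
  \<comment> \<open>Row \<open>j\<close> is scaled until its entry in the pivot column
    \<open>q0\<close> is a multiple of the pivot entry: uniformity of \<open>V q0\<close> allows
    this, and \<open>s = 1\<close>, \<open>r = 0\<close> serve if the entry is already zero. The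
    last conjunct records that scaling does not annihilate the row.\<close>
  have "\<exists>s r. s \<in> carrier R \<and> r \<in> carrier R \<and> s \<otimes> v j q0 = r \<otimes> w q0 \<and> (\<exists>q\<in>Q. s \<otimes> v j q \<noteq> \<zero>)"
    if j: "j \<in> ?J" for j
  proof (cases "v j q0 = \<zero>")
    case True
    then show ?thesis using j vnz[of j] vc[of j] wc[OF q0(1)]
      by (intro exI[of _ \<one>] exI[of _ \<zero>]) auto
  next
    case False
    then show ?thesis
      using uniform_left_ideal_common_multiple[OF V[OF q0(1)] vV[OF _ q0(1)] False wV[OF q0(1)] q0(2)] j q0(1)
      by blast
  qed
  then obtain s r where s: "\<And>j. j \<in> ?J \<Longrightarrow> s j \<in> carrier R" and r: "\<And>j. j \<in> ?J \<Longrightarrow> r j \<in> carrier R"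
    and sr: "\<And>j. j \<in> ?J \<Longrightarrow> s j \<otimes> v j q0 = r j \<otimes> w q0"
    and snz: "\<And>j. j \<in> ?J \<Longrightarrow> \<exists>q\<in>Q. s j \<otimes> v j q \<noteq> \<zero>" by metis
  define v' where "v' j q = s j \<otimes> v j q \<ominus> r j \<otimes> w q" for j q
  have v'V: "v' j q \<in> V q" if "j \<in> ?J" "q \<in> Q" for j q
    unfolding v'_def a_minus_def using that VI[OF that(2)] s r
    by (intro left_ideal_add left_ideal_minus left_ideal_mult) (auto intro: vV wV)
  have v'0: "v' j q0 = \<zero>" if "j \<in> ?J" for j
    unfolding v'_def sr[OF that] using r[OF that] wc[OF q0(1)] by (simp add: r_right_minus_eq)
  have v'c: "v' j q \<in> carrier R" if "j \<in> ?J" "q \<in> Q" for j q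
    using left_ideal_carrier[OF VI v'V] that by auto
  \<comment> \<open>A relation among the reduced rows unfolds into one among the original rows: the
    pivot row receives minus all the multiples that were subtracted, and the factor
    \<open>b0\<close> appears because \<open>w\<close> is \<open>b0\<close> times that row.\<close>
  have comb: "(\<Oplus>j\<in>J. (if j = j0 then \<ominus> ((\<Oplus>i\<in>?J. b i \<otimes> r i) \<otimes> b0) else b j \<otimes> s j) \<otimes> v j q)
      = (\<Oplus>j\<in>?J. b j \<otimes> v' j q)" (is "finsum R ?f J = _")
    if b: "\<And>j. j \<in> ?J \<Longrightarrow> b j \<in> carrier R" and q: "q \<in> Q" for b q
  proof -
    let ?t = "\<Oplus>i\<in>?J. b i \<otimes> r i"
    have t: "?t \<in> carrier R" using b r by (intro finsum_closed) auto
    have J: "J = insert j0 ?J" using j0 by blast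
    have "finsum R ?f J = ?f j0 \<oplus> finsum R ?f ?J"
      by (subst J, subst finsum_insert)
         (use finJ b s t q vc j0 b0 in \<open>auto intro!: finsum_closed\<close>)
    also have "?f j0 = \<ominus> (?t \<otimes> w q)"
      using t b0 vc[OF j0 q] by (simp add: w_def l_minus m_assoc)
    also have "?t \<otimes> w q = (\<Oplus>i\<in>?J. b i \<otimes> r i \<otimes> w q)"
      using finJ wc[OF q] b r by (subst finsum_ldistr) auto
    also have "\<ominus> \<dots> = (\<Oplus>i\<in>?J. \<ominus> (b i \<otimes> r i \<otimes> w q))"
      by (rule finsum_uminus) (use finJ wc[OF q] b r in auto)
    also have "finsum R ?f ?J = (\<Oplus>j\<in>?J. b j \<otimes> (s j \<otimes> v j q))"
      by (rule finsum_cong') (use b s vc q in \<open>auto simp: m_assoc\<close>)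
    also have "(\<Oplus>i\<in>?J. \<ominus> (b i \<otimes> r i \<otimes> w q)) \<oplus> \<dots> = (\<Oplus>j\<in>?J. \<ominus> (b j \<otimes> r j \<otimes> w q) \<oplus> b j \<otimes> (s j \<otimes> v j q))"
      by (rule finsum_addf[symmetric]) (use b r s vc wc q in auto)
    also have "\<dots> = (\<Oplus>j\<in>?J. b j \<otimes> v' j q)"
      by (rule finsum_cong')
         (use b r s vc wc q v'c in \<open>auto simp: v'_def a_minus_def r_distr r_minus m_assoc a_comm\<close>)
    finally show ?thesis .
  qed
  show ?case
  \<comment> \<open>A reduced row that vanishes is already a relation between row \<open>j\<close>
    and the pivot row, nontrivial since \<open>s j\<close> does not kill row \<open>j\<close>. It is
    treated apart because the induction hypothesis asks for nonzero rows.\<close>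
  proof (cases "\<exists>j\<in>?J. \<forall>q\<in>Q. v' j q = \<zero>")
    case True
    then obtain j where j: "j \<in> ?J" "\<And>q. q \<in> Q \<Longrightarrow> v' j q = \<zero>" by blast
    let ?b = "\<lambda>i. if i = j then \<one> else \<zero>"
    let ?c = "\<lambda>i. if i = j0 then \<ominus> ((\<Oplus>i\<in>?J. ?b i \<otimes> r i) \<otimes> b0) else ?b i \<otimes> s i"
    have "(\<Oplus>i\<in>?J. ?b i \<otimes> r i) \<in> carrier R" using r by (intro finsum_closed) auto
    then have "\<forall>i\<in>J. ?c i \<in> carrier R" using s b0 by auto
    moreover have "\<forall>q\<in>Q. (\<Oplus>i\<in>J. ?c i \<otimes> v i q) = \<zero>"
    proof
      fix q assume q: "q \<in> Q"
      have "(\<Oplus>i\<in>J. ?c i \<otimes> v i q) = (\<Oplus>i\<in>?J. ?b i \<otimes> v' i q)"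
        by (rule comb) (use q in auto)
      also have "\<dots> = (\<Oplus>i\<in>?J. \<zero>)"
        by (rule finsum_cong') (use v'c q j in auto)
      finally show "(\<Oplus>i\<in>J. ?c i \<otimes> v i q) = \<zero>" by simp
    qed
    moreover have "\<exists>i\<in>J. \<exists>q\<in>Q. ?c i \<otimes> v i q \<noteq> \<zero>"
      using snz[OF j(1)] j(1) s[OF j(1)] by (intro bexI[of _ j]) auto
    ultimately show ?thesis by (intro exI[of _ ?c] conjI)
  next
    case False
    have 1: "n = card ?Q" using Suc.hyps(2) q0(1) finQ by simp
    have 2: "card ?Q < card ?J" using Suc.prems(3) Suc.hyps(2) q0(1) j0 finQ finJ by simp
    have "\<exists>b. (\<forall>j\<in>?J. b j \<in> carrier R) \<and> (\<forall>q\<in>?Q. (\<Oplus>j\<in>?J. b j \<otimes> v' j q) = \<zero>) \<and>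
        (\<exists>j\<in>?J. \<exists>q\<in>?Q. b j \<otimes> v' j q \<noteq> \<zero>)"
    proof (rule Suc.hyps(1)[OF 1 _ _ 2])
      fix j assume j: "j \<in> ?J"
      then obtain q where q: "q \<in> Q" "v' j q \<noteq> \<zero>" using False by blast
      then have "q \<noteq> q0" using v'0[OF j] by auto
      then show "\<exists>q\<in>?Q. v' j q \<noteq> \<zero>" using q by blast
    qed (use finQ finJ V v'V in auto)
    then obtain b where b: "\<And>j. j \<in> ?J \<Longrightarrow> b j \<in> carrier R"
      and b0': "\<And>q. q \<in> ?Q \<Longrightarrow> (\<Oplus>j\<in>?J. b j \<otimes> v' j q) = \<zero>"
      and bnz: "\<exists>j\<in>?J. \<exists>q\<in>?Q. b j \<otimes> v' j q \<noteq> \<zero>" by blast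
    let ?c = "\<lambda>i. if i = j0 then \<ominus> ((\<Oplus>i\<in>?J. b i \<otimes> r i) \<otimes> b0) else b i \<otimes> s i"
    have "(\<Oplus>i\<in>?J. b i \<otimes> r i) \<in> carrier R" using b r by (intro finsum_closed) auto
    then have "\<forall>i\<in>J. ?c i \<in> carrier R" using s b b0(1) by auto
    moreover have "\<forall>q\<in>Q. (\<Oplus>i\<in>J. ?c i \<otimes> v i q) = \<zero>"
    proof
      fix q assume q: "q \<in> Q"
      have "(\<Oplus>i\<in>J. ?c i \<otimes> v i q) = (\<Oplus>i\<in>?J. b i \<otimes> v' i q)"
        by (rule comb) (use q b in auto)
      also have "\<dots> = \<zero>"
      proof (cases "q = q0")
        case True
        have "(\<Oplus>i\<in>?J. b i \<otimes> v' i q) = (\<Oplus>i\<in>?J. \<zero>)"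
          by (rule finsum_cong') (use b v'0 True in auto)
        then show ?thesis by simp
      qed (use b0' q in auto)
      finally show "(\<Oplus>i\<in>J. ?c i \<otimes> v i q) = \<zero>" .
    qed
    \<comment> \<open>If every summand vanished, \<open>b j s j\<close> would kill row
      \<open>j\<close>, so \<open>b j r j\<close> would kill the pivot entry \<open>w q0\<close>. By
      the choice of the pivot row it would then kill all of \<open>w\<close>, and
      \<open>b j v' j\<close> would vanish, against the choice of \<open>b\<close>.\<close>
    moreover have "\<exists>i\<in>J. \<exists>q\<in>Q. ?c i \<otimes> v i q \<noteq> \<zero>"
    proof (rule ccontr)
      assume n: "\<not> (\<exists>i\<in>J. \<exists>q\<in>Q. ?c i \<otimes> v i q \<noteq> \<zero>)"
      obtain j p where j: "j \<in> ?J" and p: "p \<in> Q" "b j \<otimes> v' j p \<noteq> \<zero>" using bnz by blast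
      have z: "b j \<otimes> (s j \<otimes> v j q) = \<zero>" if q: "q \<in> Q" for q
      proof -
        have "?c j \<otimes> v j q = \<zero>" using n j q by blast
        then have "(b j \<otimes> s j) \<otimes> v j q = \<zero>" using j by simp
        then show ?thesis using m_assoc b s vc j q by simp
      qed
      have "b j \<otimes> r j \<otimes> w q0 = \<zero>"
        using z[OF q0(1)] sr[OF j] b r wc[OF q0(1)] j by (simp add: m_assoc)
      then have "b j \<otimes> r j \<otimes> w p = \<zero>"
        using good[of "b j \<otimes> r j" q0 p] b r j q0 p(1) unfolding w_def by auto
      then have "b j \<otimes> v' j p = \<zero>"
        using z[OF p(1)] b r s vc wc j p(1)
        by (simp add: v'_def a_minus_def r_distr r_minus m_assoc)
      then show False using p(2) by simp
    qed
    ultimately show ?thesis by (intro exI[of _ ?c] conjI)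
  qed
qed

end

section \<open>Essential sums of uniform left ideals\<close>

text \<open>An essential direct sum of uniform left ideals, phrased with elements so that the finite
  support of a multiple is available to the counting and lifting arguments.\<close>

definition uniform_cover :: "('b, 'n) ring_scheme \<Rightarrow> 'i set \<Rightarrow> ('i \<Rightarrow> 'b set) \<Rightarrow> bool" where
  "uniform_cover B I V \<longleftrightarrow> indep_on B I V \<and> (\<forall>i\<in>I. uniform_left_ideal (V i) B) \<and>
     (\<forall>a\<in>carrier B. a \<noteq> \<zero>\<^bsub>B\<^esub> \<longrightarrow> (\<exists>b\<in>carrier B. b \<otimes>\<^bsub>B\<^esub> a \<noteq> \<zero>\<^bsub>B\<^esub> \<and>
        (\<exists>Q f. finite Q \<and> Q \<subseteq> I \<and> (\<forall>i\<in>Q. f i \<in> V i) \<and> b \<otimes>\<^bsub>B\<^esub> a = finsum B f Q)))"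

context ring
begin

text \<open>If \<open>V i = V j\<close> for distinct indices, a nonzero \<open>x\<close> in
  \<open>V i\<close> and \<open>- x\<close> in \<open>V j\<close> would form a nontrivial relation.
  Passing from indices to the set of ideals thus preserves both independence and
  cardinality.\<close>

lemma indep_on_image:
  assumes "indep_on R I V"
  shows "inj_on V I" "indep_family R (V ` I)"
proof -
  show inj: "inj_on V I"
  proof (rule inj_onI, rule ccontr)
    fix i j assume ij: "i \<in> I" "j \<in> I" "V i = V j" "i \<noteq> j"
    note li = indep_on_left_ideal[OF assms ij(1)]
    obtain x where x: "x \<in> V i" "x \<noteq> \<zero>"
      using nonzero_ex[OF li indep_on_nonzero[OF assms ij(1)]] by blast
    have xc: "x \<in> carrier R" using left_ideal_carrier[OF li x(1)] .
    let ?f = "\<lambda>k. if k = i then x else \<ominus> x"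
    have f: "?f k \<in> V k" if "k \<in> {i, j}" for k
      using that x(1) ij(3) left_ideal_minus[OF li x(1)] by auto
    have "finsum R ?f {i, j} = x \<oplus> \<ominus> x"
      using ij(4) xc by (subst finsum_insert) auto
    then have "finsum R ?f {i, j} = \<zero>" using xc by (simp add: r_neg)
    then have "?f i = \<zero>"
      using indep_onD[OF assms, of "{i, j}" ?f i] f ij(1,2) by auto
    then show False using x(2) by simp
  qed
  show "indep_family R (V ` I)"
    unfolding indep_family_def
  proof (intro conjI allI impI, goal_cases)
    case 1
    then show ?case using assms by (auto simp: indep_on_def)
  next
    case (2 G f)
    show ?case
    proof
      fix U
      assume U: "U \<in> G"
      have G: "finite G" "G \<subseteq> V ` I" "\<forall>I\<in>G. f I \<in> I" "finsum R f G = \<zero>" using 2 by auto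
      obtain Q where Q: "Q \<subseteq> I" "finite Q" "G = V ` Q"
        using finite_subset_image[OF G(1,2)] by blast
      have c: "f \<in> V ` Q \<rightarrow> carrier R"
        using G(3) Q left_ideal_carrier[OF indep_on_left_ideal[OF assms]] by blast
      have "finsum R (\<lambda>i. f (V i)) Q = \<zero>"
        using finsum_reindex[OF c inj_on_subset[OF inj Q(1)]] G(4) Q(3) by simp
      moreover obtain i where "i \<in> Q" "U = V i" using U Q by blast
      ultimately show "f U = \<zero>"
        using indep_onD[OF assms Q(2,1), of "\<lambda>i. f (V i)" i] G(3) Q(3) by simp
    qed
  qed
qed

end

text \<open>Since \<open>udim_le\<close> compares suprema through the cardinals strictly below a
  family, it suffices to produce for each independent family one that is at least as large. Index
  set and ideals may depend on the given family.\<close>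

lemma udim_leI:
  fixes I :: "'b set set \<Rightarrow> 'i set"
  assumes "ring B2"
    and "\<And>F. indep_family B1 F \<Longrightarrow> indep_on B2 (I F) (V F) \<and> (card_of F, card_of (I F)) \<in> ordLeq"
  shows "udim_le B1 B2"
  unfolding udim_le_def
proof (intro allI impI, elim conjE)
  fix F C assume F: "indep_family B1 F" and "C \<subseteq> F" and C: "(card_of C, card_of F) \<in> ordLess"
  have iV: "indep_on B2 (I F) (V F)" and le: "(card_of F, card_of (I F)) \<in> ordLeq"
    using assms(2)[OF F] by auto
  note im = ring.indep_on_image[OF assms(1) iV]
  have "(card_of (I F), card_of (V F ` I F)) \<in> ordLeq"
    using im(1) card_of_ordLeq by blast
  then have "(card_of C, card_of (V F ` I F)) \<in> ordLess"
    using C le by (meson ordLess_ordLeq_trans)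
  then show "\<exists>F'. indep_family B2 F' \<and> (card_of C, card_of F') \<in> ordLess"
    using im(2) by blast
qed

context ring
begin

text \<open>Each member of \<open>F\<close> contains a nonzero element with finite support in
  \<open>I\<close>, and supports are counted. A finite \<open>I\<close> is itself a common support;
  an infinite \<open>I\<close> has only as many finite subsets as elements, and each of them serves
  finitely many members of \<open>F\<close>.\<close>

lemma uniform_cover_card_bound:
  assumes cov: "uniform_cover R I V" and F: "indep_family R F"
  shows "(card_of F, card_of I) \<in> ordLeq"
proof -
  have ind: "indep_on R I V" and unif: "\<And>i. i \<in> I \<Longrightarrow> uniform_left_ideal (V i) R"
    using cov unfolding uniform_cover_def by auto
  note F' = F[unfolded indep_family_iff_indep_on]
  have "\<exists>w Q f. w \<in> J \<and> w \<noteq> \<zero> \<and> finite Q \<and> Q \<subseteq> I \<and> (\<forall>i\<in>Q. f i \<in> V i) \<and> w = finsum R f Q" if J: "J \<in> F" for J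
  proof -
    have li: "left_ideal J R" using indep_on_left_ideal[OF F' J] .
    then obtain a where a: "a \<in> J" "a \<noteq> \<zero>" using nonzero_ex indep_on_nonzero[OF F' J] by blast
    then have "a \<in> carrier R" using left_ideal_carrier[OF li] by blast
    then obtain b Q f where b: "b \<in> carrier R" "b \<otimes> a \<noteq> \<zero>" "finite Q" "Q \<subseteq> I" "\<forall>i\<in>Q. f i \<in> V i" "b \<otimes> a = finsum R f Q"
      using cov a(2) unfolding uniform_cover_def by blast
    have "b \<otimes> a \<in> J" using left_ideal_mult[OF li b(1) a(1)] .
    then show ?thesis using b(2-6) by (intro exI[of _ "b \<otimes> a"] exI[of _ Q] exI[of _ f]) simp
  qed
  then have "\<exists>t. \<forall>J\<in>F. fst (t J) \<in> J \<and> fst (t J) \<noteq> \<zero> \<and> finite (fst (snd (t J))) \<and> fst (snd (t J)) \<subseteq> I \<and>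
      (\<forall>i\<in>fst (snd (t J)). snd (snd (t J)) i \<in> V i) \<and> fst (t J) = finsum R (snd (snd (t J))) (fst (snd (t J)))"
    by (intro bchoice) auto
  then obtain t where t: "\<forall>J\<in>F. fst (t J) \<in> J \<and> fst (t J) \<noteq> \<zero> \<and> finite (fst (snd (t J))) \<and> fst (snd (t J)) \<subseteq> I \<and>
      (\<forall>i\<in>fst (snd (t J)). snd (snd (t J)) i \<in> V i) \<and> fst (t J) = finsum R (snd (snd (t J))) (fst (snd (t J)))"
    by blast
  define w Q f where "w J = fst (t J)" and "Q J = fst (snd (t J))" and "f J = snd (snd (t J))" for J
  have w: "\<And>J. J \<in> F \<Longrightarrow> w J \<in> J" "\<And>J. J \<in> F \<Longrightarrow> w J \<noteq> \<zero>"
    and Q: "\<And>J. J \<in> F \<Longrightarrow> finite (Q J)" "\<And>J. J \<in> F \<Longrightarrow> Q J \<subseteq> I"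
    and f: "\<And>J i. J \<in> F \<Longrightarrow> i \<in> Q J \<Longrightarrow> f J i \<in> V i" "\<And>J. J \<in> F \<Longrightarrow> w J = finsum R (f J) (Q J)"
    using t unfolding w_def Q_def f_def by auto
  \<comment> \<open>If more than \<open>|P|\<close> members had their supports inside
    \<open>P\<close>, their coordinate rows over \<open>P\<close> would be dependent by
    \<open>dependent_in_uniform\<close>.\<close>
  have bound: "card G \<le> card P"
    if G: "finite G" "G \<subseteq> F" and P: "finite P" "P \<subseteq> I" and GP: "\<And>J. J \<in> G \<Longrightarrow> Q J \<subseteq> P" for G P
  proof (rule ccontr)
    assume "\<not> card G \<le> card P"
    then have lt: "card P < card G" by simp
    define v where "v J i = (if i \<in> Q J then f J i else \<zero>)" for J i
    have VI: "left_ideal (V i) R" if "i \<in> P" for i using indep_on_left_ideal[OF ind] P that by blast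
    have fc: "f J i \<in> carrier R" if "J \<in> G" "i \<in> Q J" for J i
      using f(1)[of J i] GP[of J] that G(2) left_ideal_carrier[OF VI, of i "f J i"] by blast
    have vV: "v J i \<in> V i" if "J \<in> G" "i \<in> P" for J i
      using that f G VI left_ideal_zero[OF VI] unfolding v_def by auto
    have vc: "v J i \<in> carrier R" if "J \<in> G" "i \<in> P" for J i
      using left_ideal_carrier[OF VI vV] that by blast
    have wv: "w J = (\<Oplus>i\<in>P. v J i)" if J: "J \<in> G" for J
    proof -
      have "finsum R (v J) P = finsum R (v J) (Q J)"
        using GP[OF J] P(1) vc[OF J] finite_subset[OF GP[OF J] P(1)] fc[OF J]
        by (intro add.finprod_mono_neutral_cong) (auto simp: v_def split: if_splits)
      also have "\<dots> = finsum R (f J) (Q J)"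
        by (rule finsum_cong') (use J fc in \<open>auto simp: v_def\<close>)
      finally show ?thesis using f(2) J G by auto
    qed
    have nz: "\<exists>i\<in>P. v J i \<noteq> \<zero>" if J: "J \<in> G" for J
    proof (rule ccontr)
      assume "\<not> ?thesis"
      then have "w J = (\<Oplus>i\<in>P. \<zero>)" unfolding wv[OF J] by (intro finsum_cong') auto
      then show False using w(2) J G by auto
    qed
    have "\<exists>b. (\<forall>J\<in>G. b J \<in> carrier R) \<and> (\<forall>i\<in>P. (\<Oplus>J\<in>G. b J \<otimes> v J i) = \<zero>) \<and>
      (\<exists>J\<in>G. \<exists>i\<in>P. b J \<otimes> v J i \<noteq> \<zero>)"
      by (rule dependent_in_uniform[OF P(1) G(1) lt]) (use unif P vV nz in auto)
    then obtain b where b: "\<And>J. J \<in> G \<Longrightarrow> b J \<in> carrier R"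
      and bz: "\<And>i. i \<in> P \<Longrightarrow> (\<Oplus>J\<in>G. b J \<otimes> v J i) = \<zero>"
      and bnz: "\<exists>J\<in>G. \<exists>i\<in>P. b J \<otimes> v J i \<noteq> \<zero>" by blast
    have bw: "b J \<otimes> w J = (\<Oplus>i\<in>P. b J \<otimes> v J i)" if J: "J \<in> G" for J
      unfolding wv[OF J] using P(1) b[OF J] vc[OF J] by (intro finsum_rdistr) auto
    have "(\<Oplus>J\<in>G. b J \<otimes> w J) = (\<Oplus>J\<in>G. \<Oplus>i\<in>P. b J \<otimes> v J i)"
      by (rule finsum_cong') (use bw b vc in \<open>auto intro!: finsum_closed\<close>)
    also have "\<dots> = (\<Oplus>i\<in>P. \<Oplus>J\<in>G. b J \<otimes> v J i)"
      by (rule finsum_swap) (use G(1) P(1) b vc in auto)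
    also have "\<dots> = (\<Oplus>i\<in>P. \<zero>)" by (rule finsum_cong') (use bz in auto)
    finally have sz: "(\<Oplus>J\<in>G. b J \<otimes> w J) = \<zero>" by simp
    \<comment> \<open>Both independences enter: that of \<open>F\<close> kills each
      \<open>b J w J\<close>, then that of \<open>V\<close> kills each coordinate
      \<open>b J v J i\<close>, against the nonvanishing summand.\<close>
    have "b J \<otimes> v J i = \<zero>" if J: "J \<in> G" and i: "i \<in> P" for J i
    proof -
      have "b J \<otimes> w J = \<zero>"
        by (rule indep_onD[OF F' G _ sz J])
           (use left_ideal_mult[OF indep_on_left_ideal[OF F']] b w(1) G(2) in blast)
      then have "(\<Oplus>i\<in>P. b J \<otimes> v J i) = \<zero>" using bw[OF J] by simp
      then show ?thesis
        by (rule indep_onD[OF ind P, rotated]) (use i left_ideal_mult[OF VI b[OF J] vV[OF J]] in auto)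
    qed
    then show False using bnz by blast
  qed
  show ?thesis
  proof (cases "finite I")
    case True
    have "finite F \<and> card F \<le> card I"
      by (rule finite_if_finite_subsets_card_bdd) (use bound[OF _ _ True] Q(2) in blast)
    then show ?thesis using True by (simp add: finite_card_of_iff_card2)
  next
    case False
    \<comment> \<open>\<open>F\<close> is the union, over the finite subsets \<open>P\<close> of
      \<open>I\<close>, of the members with support exactly \<open>P\<close>; by
      \<open>bound\<close> each such fibre has at most \<open>|P|\<close> members.\<close>
    let ?fib = "\<lambda>P. {J \<in> F. Q J = P}"
    have "(card_of (\<Union>P\<in>Fpow I. ?fib P), card_of I) \<in> ordLeq"
    proof (rule card_of_UNION_ordLeq_infinite[OF False])
      show "(card_of (Fpow I), card_of I) \<in> ordLeq"
        using card_of_Fpow_infinite[OF False] ordIso_iff_ordLeq by blast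
      show "\<forall>P\<in>Fpow I. (card_of (?fib P), card_of I) \<in> ordLeq"
      proof
        fix P assume P: "P \<in> Fpow I"
        have "finite (?fib P) \<and> card (?fib P) \<le> card P"
          by (rule finite_if_finite_subsets_card_bdd)
             (use bound[of _ P] P in \<open>auto simp: Fpow_def subset_iff\<close>)
        then show "(card_of (?fib P), card_of I) \<in> ordLeq"
          using False by (intro ordLess_imp_ordLeq finite_ordLess_infinite2) auto
      qed
    qed
    moreover have "F \<subseteq> (\<Union>P\<in>Fpow I. ?fib P)" using Q by (auto simp: Fpow_def)
    ultimately show ?thesis using card_of_mono1 ordLeq_transitive by blast
  qed
qed

text \<open>\<open>K\<close> contains a nonzero element of the direct sum, and after scaling its
  nonzero coordinates share one annihilator. It then generates a left ideal isomorphic to the one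
  generated by a single coordinate, which lies in a uniform \<open>V q\<close>.\<close>

lemma uniform_cover_enough_uniform:
  assumes cov: "uniform_cover R I V"
  shows "enough_uniform R"
  unfolding enough_uniform_def
proof (intro allI impI, elim conjE)
  fix K assume K: "left_ideal K R" "K \<noteq> {\<zero>}"
  have ind: "indep_on R I V" and unif: "\<And>i. i \<in> I \<Longrightarrow> uniform_left_ideal (V i) R"
    using cov unfolding uniform_cover_def by auto
  obtain a where a: "a \<in> K" "a \<noteq> \<zero>" using nonzero_ex[OF K] by blast
  then have "a \<in> carrier R" using left_ideal_carrier[OF K(1)] by blast
  then obtain b Q f where b: "b \<in> carrier R" "b \<otimes> a \<noteq> \<zero>" and Q: "finite Q" "Q \<subseteq> I"
    and f': "\<forall>i\<in>Q. f i \<in> V i" and eq: "b \<otimes> a = finsum R f Q"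
    using cov a(2) unfolding uniform_cover_def by blast
  note f = bspec[OF f']
  have VI: "left_ideal (V i) R" if "i \<in> Q" for i using indep_on_left_ideal[OF ind] Q that by blast
  have fc: "f i \<in> carrier R" if "i \<in> Q" for i using left_ideal_carrier[OF VI f] that by blast
  have "\<exists>i\<in>Q. f i \<noteq> \<zero>"
  proof (rule ccontr)
    assume "\<not> ?thesis"
    then have "b \<otimes> a = (\<Oplus>i\<in>Q. \<zero>)" unfolding eq by (intro finsum_cong') auto
    then show False using b by simp
  qed
  then obtain c where c: "c \<in> carrier R" "\<exists>q\<in>Q. c \<otimes> f q \<noteq> \<zero>"
    and good: "\<forall>d\<in>carrier R. \<forall>q\<in>Q. c \<otimes> f q \<noteq> \<zero> \<longrightarrow> d \<otimes> (c \<otimes> f q) = \<zero> \<longrightarrow> (\<forall>q'\<in>Q. d \<otimes> (c \<otimes> f q') = \<zero>)"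
    using ex_multiple_uniform_annihilator[of Q f, OF Q(1) fc] by metis
  obtain q where q: "q \<in> Q" "c \<otimes> f q \<noteq> \<zero>" using c(2) by blast
  define y where "y = c \<otimes> (b \<otimes> a)"
  define z where "z = c \<otimes> f q"
  have yK: "y \<in> K" unfolding y_def using left_ideal_mult[OF K(1)] b c a by blast
  then have yc: "y \<in> carrier R" using left_ideal_carrier[OF K(1)] by blast
  have zV: "z \<in> V q" unfolding z_def using left_ideal_mult[OF VI c(1) f] q by blast
  then have zc: "z \<in> carrier R" using left_ideal_carrier[OF VI] q by blast
  have dy: "d \<otimes> y = (\<Oplus>i\<in>Q. d \<otimes> (c \<otimes> f i))" if "d \<in> carrier R" for d
    unfolding y_def eq using Q(1) c fc that by (simp add: finsum_rdistr Pi_def)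
  \<comment> \<open>Equal annihilators make \<open>d y\<close> correspond bijectively to
    \<open>d z\<close>, so a common multiple found inside \<open>V q\<close> lifts to one inside
    \<open>R y\<close>.\<close>
  have iff: "d \<otimes> y = \<zero> \<longleftrightarrow> d \<otimes> z = \<zero>" if d: "d \<in> carrier R" for d
  proof
    assume "d \<otimes> y = \<zero>"
    then have "(\<Oplus>i\<in>Q. d \<otimes> (c \<otimes> f i)) = \<zero>" using dy[OF d] by simp
    then show "d \<otimes> z = \<zero>" unfolding z_def
      by (rule indep_onD[OF ind Q, rotated])
         (use q left_ideal_mult[OF VI] c d f in auto)
  next
    assume "d \<otimes> z = \<zero>"
    then have "(\<Oplus>i\<in>Q. d \<otimes> (c \<otimes> f i)) = (\<Oplus>i\<in>Q. \<zero>)"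
      using good d q unfolding z_def by (intro finsum_cong') auto
    then show "d \<otimes> y = \<zero>" using dy[OF d] by simp
  qed
  let ?U = "(\<lambda>d. d \<otimes> y) ` carrier R"
  have ynz: "y \<noteq> \<zero>" using iff[of \<one>] q(2) yc zc unfolding z_def[symmetric] by auto
  have "uniform_left_ideal ?U R"
  proof (rule uniform_left_idealI)
    fix u v assume uv: "u \<in> ?U" "v \<in> ?U" "u \<noteq> \<zero>" "v \<noteq> \<zero>"
    then obtain d e where d: "d \<in> carrier R" "u = d \<otimes> y" and e: "e \<in> carrier R" "v = e \<otimes> y" by blast
    have "d \<otimes> z \<noteq> \<zero>" "e \<otimes> z \<noteq> \<zero>" "d \<otimes> z \<in> V q" "e \<otimes> z \<in> V q"
      using iff d e uv left_ideal_mult[OF VI[OF q(1)] _ zV] by auto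
    then obtain r s where rs: "r \<in> carrier R" "s \<in> carrier R" "r \<otimes> (d \<otimes> z) = s \<otimes> (e \<otimes> z)" "r \<otimes> (d \<otimes> z) \<noteq> \<zero>"
      using uniform_left_ideal_common_multiple[OF unif, of q "d \<otimes> z" "e \<otimes> z"] q Q by blast
    have "(r \<otimes> d \<ominus> s \<otimes> e) \<otimes> z = \<zero>"
      using rs d e zc by (simp add: a_minus_def l_distr l_minus m_assoc r_neg)
    then have "(r \<otimes> d \<ominus> s \<otimes> e) \<otimes> y = \<zero>" using iff rs d e by simp
    then have "r \<otimes> u \<ominus> s \<otimes> v = \<zero>"
      using rs d e yc by (simp add: a_minus_def l_distr l_minus m_assoc)
    then have "r \<otimes> u = s \<otimes> v" using rs d e yc by simp
    moreover have "(r \<otimes> d) \<otimes> y \<noteq> \<zero>" using iff[of "r \<otimes> d"] rs d zc by (simp add: m_assoc)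
    then have "r \<otimes> u \<noteq> \<zero>" using rs d yc by (simp add: m_assoc)
    ultimately show "\<exists>r\<in>carrier R. \<exists>s\<in>carrier R. r \<otimes> u = s \<otimes> v \<and> r \<otimes> u \<noteq> \<zero>"
      using rs by blast
  qed (use yc ynz left_ideal_principal principal_nonzero in auto)
  moreover have "?U \<subseteq> K" using left_ideal_mult[OF K(1) _ yK] by blast
  ultimately show "\<exists>U\<subseteq>K. uniform_left_ideal U R" by blast
qed

text \<open>Zorn's lemma gives a maximal independent family of uniform left ideals. If some nonzero
  \<open>a\<close> had no nonzero multiple in its sum, a uniform left ideal inside
  \<open>R a\<close> would meet that sum only in zero and could be added to the family.\<close>

lemma ex_uniform_cover:
  assumes "enough_uniform R"
  shows "\<exists>M. uniform_cover R M (\<lambda>U. U)"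
proof -
  define A where "A = {F. indep_family R F \<and> (\<forall>U\<in>F. uniform_left_ideal U R)}"
  have "{} \<in> A" by (auto simp: A_def indep_family_def)
  then have "A \<noteq> {}" by blast
  have chain: "\<Union>C \<in> A" if C: "C \<noteq> {}" "subset.chain A C" for C
  proof -
    have CA: "C \<subseteq> A" using C(2) by (simp add: subset.chain_def)
    have "f U = \<zero>" if Q: "finite Q" "Q \<subseteq> \<Union>C" "\<forall>I\<in>Q. f I \<in> I" "finsum R f Q = \<zero>" "U \<in> Q" for Q f U
    proof -
      obtain F where "F \<in> C" "Q \<subseteq> F"
        using finite_subset_Union_chain[OF Q(1,2) C(1) C(2)] by blast
      then show ?thesis using CA Q unfolding A_def indep_family_def by blast
    qed
    moreover have "\<forall>U\<in>\<Union>C. left_ideal U R \<and> U \<noteq> {\<zero>} \<and> uniform_left_ideal U R"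
      using CA unfolding A_def indep_family_def by blast
    ultimately show ?thesis unfolding A_def indep_family_def by blast
  qed
  have "\<exists>M\<in>A. \<forall>N\<in>A. M \<subseteq> N \<longrightarrow> N = M"
    using \<open>A \<noteq> {}\<close> chain by (rule subset_Zorn_nonempty)
  then obtain M where M: "M \<in> A" and max: "\<And>N. N \<in> A \<Longrightarrow> M \<subseteq> N \<Longrightarrow> N = M"
    by blast
  have ind: "indep_on R M (\<lambda>U. U)" using M unfolding A_def indep_family_iff_indep_on by blast
  have "\<exists>b\<in>carrier R. b \<otimes> a \<noteq> \<zero> \<and> (\<exists>Q f. finite Q \<and> Q \<subseteq> M \<and> (\<forall>i\<in>Q. f i \<in> i) \<and> b \<otimes> a = finsum R f Q)"
    if a: "a \<in> carrier R" "a \<noteq> \<zero>" for a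
  proof (rule ccontr)
    assume n: "\<not> ?thesis"
    obtain U where U: "U \<subseteq> (\<lambda>b. b \<otimes> a) ` carrier R" "uniform_left_ideal U R"
      using assms left_ideal_principal[OF a(1)] principal_nonzero[OF a] unfolding enough_uniform_def by blast
    have UI: "left_ideal U R" "U \<noteq> {\<zero>}" using U(2) by (auto simp: uniform_left_ideal_def)
    \<comment> \<open>\<open>U\<close> meets the sum of \<open>M\<close> trivially. This shows both
      that \<open>U\<close> is a new member and that no relation can involve it.\<close>
    have n': "x = \<zero>" if x: "x \<in> U" "finite Q" "Q \<subseteq> M" "\<And>i. i \<in> Q \<Longrightarrow> f i \<in> i" "x = finsum R f Q" for x Q f
    proof (rule ccontr)
      assume "x \<noteq> \<zero>"
      moreover obtain b where b: "b \<in> carrier R" "x = b \<otimes> a" using x(1) U(1) by blast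
      ultimately have "b \<otimes> a \<noteq> \<zero>" "b \<otimes> a = finsum R f Q" using x(5) by simp_all
      then show False using n b(1) x(2-4) by blast
    qed
    have "U \<notin> M"
    proof
      assume "U \<in> M"
      then have "x = \<zero>" if "x \<in> U" for x
        using n'[of x "{U}" "\<lambda>_. x"] that left_ideal_carrier[OF UI(1)] by simp
      then show False using nonzero_ex[OF UI] by blast
    qed
    have z: "f V = \<zero>" if Q: "finite Q" "Q \<subseteq> insert U M" and f: "\<forall>I\<in>Q. f I \<in> I" and s: "finsum R f Q = \<zero>" and V: "V \<in> Q"
      for Q f V
    proof (cases "U \<in> Q")
      case False
      then have "Q \<subseteq> M" using Q(2) by blast
      then show ?thesis using indep_onD[OF ind Q(1) _ _ s V] f by blast
    next
      case True
      let ?Q = "Q - {U}"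
      have QM: "?Q \<subseteq> M" using Q(2) by blast
      have fc: "f I \<in> carrier R" if "I \<in> Q" for I
        using f that Q(2) left_ideal_carrier[OF UI(1)] left_ideal_carrier[OF indep_on_left_ideal[OF ind]]
        by blast
      have "Q = insert U ?Q" using True by blast
      then have "finsum R f Q = f U \<oplus> finsum R f ?Q"
        by (metis Diff_iff Pi_I Q(1) True fc finite_Diff finsum_insert insertCI)
      then have "f U = \<ominus> finsum R f ?Q"
        using s fc True by (metis DiffD1 Pi_I finsum_closed minus_equality)
      also have "\<dots> = (\<Oplus>I\<in>?Q. \<ominus> f I)" by (rule finsum_uminus) (use Q fc in auto)
      finally have eq: "f U = (\<Oplus>I\<in>?Q. \<ominus> f I)" .
      have "f U = \<zero>"
        by (rule n'[OF _ _ QM _ eq])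
           (use f True Q(1) QM left_ideal_minus[OF indep_on_left_ideal[OF ind]] in auto)
      moreover have "finsum R f ?Q = \<zero>"
        using \<open>finsum R f Q = f U \<oplus> finsum R f ?Q\<close> s \<open>f U = \<zero>\<close> fc
        by (metis DiffD1 Pi_I finsum_closed l_zero)
      then have "f I = \<zero>" if "I \<in> ?Q" for I
        using indep_onD[OF ind _ QM, of f I] that f Q(1) by blast
      ultimately show ?thesis using V by blast
    qed
    have "indep_family R (insert U M)"
      unfolding indep_family_def
    proof (intro conjI allI impI ballI)
      fix V assume "V \<in> insert U M"
      then show "left_ideal V R" "V \<noteq> {\<zero>}"
        using UI indep_on_left_ideal[OF ind] indep_on_nonzero[OF ind] by auto
    qed (elim conjE, rule z)
    then have "insert U M \<in> A" using M U(2) by (simp add: A_def)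
    then show False using max[of "insert U M"] \<open>U \<notin> M\<close> by blast
  qed
  then have "uniform_cover R M (\<lambda>U. U)" using M ind by (simp add: A_def uniform_cover_def)
  then show ?thesis by blast
qed

end

section \<open>Skew group and monoid rings\<close>

lemma gadd_eq [simp]: "gadd g h = g + h"
  and gneg_eq [simp]: "gneg g = - g"
  and gzero_eq [simp]: "gzero = 0"
  by (auto simp: gadd_def gneg_def gzero_def fun_eq_iff)

lemma zero_in_free_ab [simp]: "0 \<in> free_ab XS"
  by (simp add: free_ab_def)

lemma free_ab_iff: "g \<in> free_ab XS \<longleftrightarrow> finite {v. g v \<noteq> 0} \<and> (\<forall>v. v \<notin> XS \<longrightarrow> g v = 0)"
  by (auto simp: free_ab_def)

lemma free_ab_add [simp]: "g \<in> free_ab XS \<Longrightarrow> h \<in> free_ab XS \<Longrightarrow> g + h \<in> free_ab XS"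
proof -
  assume "g \<in> free_ab XS" "h \<in> free_ab XS"
  moreover have "{v. (g + h) v \<noteq> 0} \<subseteq> {v. g v \<noteq> 0} \<union> {v. h v \<noteq> 0}" by auto
  then have "finite {v. g v \<noteq> 0} \<Longrightarrow> finite {v. h v \<noteq> 0} \<Longrightarrow> finite {v. (g + h) v \<noteq> 0}"
    using finite_subset by blast
  ultimately show ?thesis unfolding free_ab_iff by simp
qed

lemma free_ab_uminus [simp]: "g \<in> free_ab XS \<Longrightarrow> - g \<in> free_ab XS"
  unfolding free_ab_iff by auto

lemma free_ab_diff [simp]: "g \<in> free_ab XS \<Longrightarrow> h \<in> free_ab XS \<Longrightarrow> g - h \<in> free_ab XS"
  using free_ab_add[of g XS "- h"] by simp

lemma submonoid_free_ab: "submonoid_G XS (free_ab XS)"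
  by (simp add: submonoid_G_def)

lemma submonoid_subset: "submonoid_G XS \<Gamma> \<Longrightarrow> \<Gamma> \<subseteq> free_ab XS"
  and submonoid_zero: "submonoid_G XS \<Gamma> \<Longrightarrow> 0 \<in> \<Gamma>"
  and submonoid_add: "submonoid_G XS \<Gamma> \<Longrightarrow> g \<in> \<Gamma> \<Longrightarrow> h \<in> \<Gamma> \<Longrightarrow> g + h \<in> \<Gamma>"
  by (auto simp: submonoid_G_def)

locale skew = ring R for R :: "('a, 'm) ring_scheme" (structure) +
  fixes XS :: "'x set" and \<beta> :: "('x \<Rightarrow> int) \<Rightarrow> 'a \<Rightarrow> 'a"
  assumes sd: "skew_data R XS \<beta>"
begin

abbreviation "G \<equiv> free_ab XS"

lemma \<beta>_iso: "g \<in> G \<Longrightarrow> \<beta> g \<in> ring_iso R R"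
  using sd by (simp add: skew_data_def)

lemma \<beta>_closed [simp]: "g \<in> G \<Longrightarrow> a \<in> carrier R \<Longrightarrow> \<beta> g a \<in> carrier R"
  using \<beta>_iso by (auto simp: ring_iso_def ring_hom_def)

lemma \<beta>_mult: "g \<in> G \<Longrightarrow> a \<in> carrier R \<Longrightarrow> b \<in> carrier R \<Longrightarrow> \<beta> g (a \<otimes> b) = \<beta> g a \<otimes> \<beta> g b"
  using \<beta>_iso by (auto simp: ring_iso_def ring_hom_def)

lemma \<beta>_add: "g \<in> G \<Longrightarrow> a \<in> carrier R \<Longrightarrow> b \<in> carrier R \<Longrightarrow> \<beta> g (a \<oplus> b) = \<beta> g a \<oplus> \<beta> g b"
  using \<beta>_iso by (auto simp: ring_iso_def ring_hom_def)

lemma \<beta>_one [simp]: "g \<in> G \<Longrightarrow> \<beta> g \<one> = \<one>"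
  using \<beta>_iso by (auto simp: ring_iso_def ring_hom_def)

lemma \<beta>_zero [simp]: "g \<in> G \<Longrightarrow> \<beta> g \<zero> = \<zero>"
  using \<beta>_add[of g \<zero> \<zero>] \<beta>_closed[of g \<zero>] add.r_cancel_one'[of "\<beta> g \<zero>" "\<beta> g \<zero>"] by simp

lemma \<beta>_comp: "g \<in> G \<Longrightarrow> h \<in> G \<Longrightarrow> a \<in> carrier R \<Longrightarrow> \<beta> g (\<beta> h a) = \<beta> (g + h) a"
  using sd by (simp add: skew_data_def)

lemma \<beta>_id [simp]: "a \<in> carrier R \<Longrightarrow> \<beta> 0 a = a"
  using sd by (simp add: skew_data_def)

lemma \<beta>_neg_cancel [simp]: "g \<in> G \<Longrightarrow> a \<in> carrier R \<Longrightarrow> \<beta> (- g) (\<beta> g a) = a"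
  by (simp add: \<beta>_comp)

lemma \<beta>_cancel_neg [simp]: "g \<in> G \<Longrightarrow> a \<in> carrier R \<Longrightarrow> \<beta> g (\<beta> (- g) a) = a"
  by (simp add: \<beta>_comp)

lemma \<beta>_eq_zero_iff [simp]: "g \<in> G \<Longrightarrow> a \<in> carrier R \<Longrightarrow> \<beta> g a = \<zero> \<longleftrightarrow> a = \<zero>"
  using \<beta>_neg_cancel[of g a] \<beta>_zero[of "- g"] by (cases "\<beta> g a = \<zero>") auto

lemma \<beta>_finsum:
  assumes "g \<in> G" "\<And>i. i \<in> Q \<Longrightarrow> f i \<in> carrier R"
  shows "\<beta> g (\<Oplus>i\<in>Q. f i) = (\<Oplus>i\<in>Q. \<beta> g (f i))"
  using assms(2)
proof (induction Q rule: infinite_finite_induct)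
  case (insert x F)
  then have "f \<in> F \<rightarrow> carrier R" "(\<lambda>i. \<beta> g (f i)) \<in> F \<rightarrow> carrier R" using assms(1) by auto
  then show ?case using insert assms(1) by (simp add: \<beta>_add)
qed (use assms(1) in \<open>auto simp: finsum_infinite\<close>)

abbreviation S :: "('x \<Rightarrow> int) set \<Rightarrow> (('x \<Rightarrow> int) \<Rightarrow> 'a) ring" where
  "S \<Gamma> \<equiv> skew_ring R \<beta> \<Gamma>"

text \<open>The product in \<open>skew_ring\<close> does not refer to the set of terms, so one
  operation serves all rings \<open>S \<Gamma>\<close>; the empty set stands here for any choice of
  \<open>\<Gamma>\<close>.\<close>

definition sm :: "(('x \<Rightarrow> int) \<Rightarrow> 'a) \<Rightarrow> (('x \<Rightarrow> int) \<Rightarrow> 'a) \<Rightarrow> ('x \<Rightarrow> int) \<Rightarrow> 'a" (infixl "\<star>" 70) where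
  "f \<star> h = f \<otimes>\<^bsub>S {}\<^esub> h"

lemma skew_mult [simp]: "f \<otimes>\<^bsub>S \<Gamma>\<^esub> h = f \<star> h"
  by (simp add: sm_def skew_ring_def)

lemma skew_zero [simp]: "\<zero>\<^bsub>S \<Gamma>\<^esub> = (\<lambda>g. \<zero>)"
  by (simp add: skew_ring_def)

lemma skew_add [simp]: "f \<oplus>\<^bsub>S \<Gamma>\<^esub> h = (\<lambda>g. f g \<oplus> h g)"
  by (simp add: skew_ring_def)

lemma skew_carrier_iff: "f \<in> carrier (S \<Gamma>) \<longleftrightarrow>
    (\<forall>g. f g \<in> carrier R) \<and> finite {g. f g \<noteq> \<zero>} \<and> {g. f g \<noteq> \<zero>} \<subseteq> \<Gamma>"
  by (simp add: skew_ring_def)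

lemma coeff_closed: "f \<in> carrier (S \<Gamma>) \<Longrightarrow> f g \<in> carrier R"
  and supp_finite: "f \<in> carrier (S \<Gamma>) \<Longrightarrow> finite {g. f g \<noteq> \<zero>}"
  and supp_subset: "f \<in> carrier (S \<Gamma>) \<Longrightarrow> {g. f g \<noteq> \<zero>} \<subseteq> \<Gamma>"
  and supp_in: "f \<in> carrier (S \<Gamma>) \<Longrightarrow> f g \<noteq> \<zero> \<Longrightarrow> g \<in> \<Gamma>"
  by (auto simp: skew_carrier_iff)

lemma skew_carrier_mono: "\<Gamma> \<subseteq> \<Delta> \<Longrightarrow> f \<in> carrier (S \<Gamma>) \<Longrightarrow> f \<in> carrier (S \<Delta>)"
  by (auto simp: skew_carrier_iff)

text \<open>The defining sum runs over pairs from the two supports; fixing the first entry leaves a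
  single sum. Any finite \<open>F\<close> around the support of \<open>f\<close> is allowed, so that
  several elements can be summed over one index set.\<close>

lemma sm_eq:
  assumes f: "f \<in> carrier (S G)" and h: "h \<in> carrier (S G)" and F: "finite F" "{g. f g \<noteq> \<zero>} \<subseteq> F" "F \<subseteq> G"
  shows "(f \<star> h) k = (\<Oplus>g\<in>F. f g \<otimes> \<beta> g (h (k - g)))"
proof -
  note [simp] = supp_finite[OF f] coeff_closed[OF f] supp_finite[OF h] coeff_closed[OF h]
  let ?P = "{p. fst p + snd p = k \<and> f (fst p) \<noteq> \<zero> \<and> h (snd p) \<noteq> \<zero>}"
  let ?D = "{g \<in> F. f g \<noteq> \<zero> \<and> h (k - g) \<noteq> \<zero>}"
  let ?t = "\<lambda>p. f (fst p) \<otimes> \<beta> (fst p) (h (snd p))"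
  have P: "?P = (\<lambda>g. (g, k - g)) ` ?D"
  proof
    show "?P \<subseteq> (\<lambda>g. (g, k - g)) ` ?D"
    proof
      fix p assume p: "p \<in> ?P"
      then have "snd p = k - fst p" by (auto simp: algebra_simps)
      then have "p = (fst p, k - fst p)" "fst p \<in> ?D" using p F(2) by (auto simp: prod_eq_iff simp del: F)
      then show "p \<in> (\<lambda>g. (g, k - g)) ` ?D" by (rule image_eqI)
    qed
  qed auto
  have c: "f g \<otimes> \<beta> g (h (k - g)) \<in> carrier R" if "g \<in> F" for g
    using that F(3) f h by auto
  have "(f \<star> h) k = finsum R ?t ?P"
    by (simp only: sm_def skew_ring_def monoid.select_convs gadd_eq)
  also have "\<dots> = finsum R (\<lambda>g. ?t (g, k - g)) ?D"
    unfolding P by (rule finsum_reindex) (use c in \<open>auto simp: inj_on_def\<close>)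
  also have "\<dots> = (\<Oplus>g\<in>F. f g \<otimes> \<beta> g (h (k - g)))"
  proof (rule add.finprod_mono_neutral_cong_left[OF F(1)])
    fix i assume i: "i \<in> F - ?D"
    then have "f i = \<zero> \<or> h (k - i) = \<zero>" "i \<in> G" using F(3) by auto
    then show "f i \<otimes> \<beta> i (h (k - i)) = \<zero>" by auto
  qed (use c in auto)
  finally show ?thesis .
qed

lemma sm_supp:
  assumes f: "f \<in> carrier (S G)" and h: "h \<in> carrier (S G)" and k: "(f \<star> h) k \<noteq> \<zero>"
  shows "\<exists>g. f g \<noteq> \<zero> \<and> h (k - g) \<noteq> \<zero>"
proof (rule ccontr)
  assume n: "\<not> ?thesis"
  note [simp] = supp_finite[OF f] coeff_closed[OF f]
  have s: "{g. f g \<noteq> \<zero>} \<subseteq> G" using supp_subset[OF f] .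
  have "(f \<star> h) k = (\<Oplus>g\<in>{g. f g \<noteq> \<zero>}. f g \<otimes> \<beta> g (h (k - g)))"
    by (rule sm_eq) (use f h s in auto)
  also have "\<dots> = (\<Oplus>g\<in>{g. f g \<noteq> \<zero>}. \<zero>)"
    by (rule finsum_cong') (use n f supp_in[OF f] in auto)
  finally show False using k by simp
qed

lemma sm_coeff_closed: "f \<in> carrier (S G) \<Longrightarrow> h \<in> carrier (S G) \<Longrightarrow> (f \<star> h) k \<in> carrier R"
proof -
  assume f: "f \<in> carrier (S G)" and h: "h \<in> carrier (S G)"
  have "(f \<star> h) k = (\<Oplus>g\<in>{g. f g \<noteq> \<zero>}. f g \<otimes> \<beta> g (h (k - g)))"
    by (rule sm_eq) (use f h supp_subset[OF f] supp_finite[OF f] in auto)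
  moreover have "\<dots> \<in> carrier R"
    by (rule finsum_closed) (use supp_in[OF f] coeff_closed[OF f] coeff_closed[OF h] in auto)
  ultimately show ?thesis by simp
qed

lemma sm_closed:
  assumes \<Gamma>: "submonoid_G XS \<Gamma>" and f: "f \<in> carrier (S \<Gamma>)" and h: "h \<in> carrier (S \<Gamma>)"
  shows "f \<star> h \<in> carrier (S \<Gamma>)"
proof -
  have fG: "f \<in> carrier (S G)" and hG: "h \<in> carrier (S G)"
    using f h skew_carrier_mono[OF submonoid_subset[OF \<Gamma>]] by auto
  have sub: "{k. (f \<star> h) k \<noteq> \<zero>} \<subseteq> (\<lambda>(a, b). a + b) ` ({g. f g \<noteq> \<zero>} \<times> {g. h g \<noteq> \<zero>})"
  proof
    fix k assume "k \<in> {k. (f \<star> h) k \<noteq> \<zero>}"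
    then obtain g where "f g \<noteq> \<zero>" "h (k - g) \<noteq> \<zero>" using sm_supp[OF fG hG] by blast
    then show "k \<in> (\<lambda>(a, b). a + b) ` ({g. f g \<noteq> \<zero>} \<times> {g. h g \<noteq> \<zero>})"
      by (intro image_eqI[of _ _ "(g, k - g)"]) auto
  qed
  have fin: "finite {k. (f \<star> h) k \<noteq> \<zero>}"
    using finite_subset[OF sub] supp_finite[OF f] supp_finite[OF h] by simp
  have "{k. (f \<star> h) k \<noteq> \<zero>} \<subseteq> \<Gamma>"
    using sub supp_in[OF f] supp_in[OF h] submonoid_add[OF \<Gamma>] by fastforce
  then show ?thesis using fin sm_coeff_closed[OF fG hG] by (simp add: skew_carrier_iff)
qed

text \<open>Both sides are double sums over a term \<open>a\<close> of \<open>f\<close> and a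
  partial product \<open>p = a + b\<close>. The summands agree because each \<open>\<beta> a\<close>
  is multiplicative and \<open>\<beta> (a + b)\<close> is the composite of \<open>\<beta> a\<close>
  and \<open>\<beta> b\<close>.\<close>

lemma sm_assoc:
  assumes f: "f \<in> carrier (S G)" and h: "h \<in> carrier (S G)" and l: "l \<in> carrier (S G)"
  shows "(f \<star> h) \<star> l = f \<star> (h \<star> l)"
proof
  fix k
  note [simp] = supp_finite[OF f] coeff_closed[OF f] supp_finite[OF h] coeff_closed[OF h] supp_finite[OF l] coeff_closed[OF l]
  let ?F = "{g. f g \<noteq> \<zero>}" and ?H = "{g. h g \<noteq> \<zero>}"
  let ?P = "(\<lambda>(a, b). a + b) ` (?F \<times> ?H)"
  have F: "finite ?F" "?F \<subseteq> G" and H: "finite ?H" "?H \<subseteq> G"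
    using f h supp_in[OF f] supp_in[OF h] by auto
  have P: "finite ?P" "?P \<subseteq> G"
    using F H supp_in[OF f] supp_in[OF h] by auto
  have fh: "f \<star> h \<in> carrier (S G)" and hl: "h \<star> l \<in> carrier (S G)"
    using sm_closed[OF submonoid_free_ab] f h l by auto
  note [simp] = coeff_closed[OF fh] coeff_closed[OF hl]
  have sub: "{k. (f \<star> h) k \<noteq> \<zero>} \<subseteq> ?P"
  proof
    fix k assume "k \<in> {k. (f \<star> h) k \<noteq> \<zero>}"
    then obtain g where "f g \<noteq> \<zero>" "h (k - g) \<noteq> \<zero>" using sm_supp[OF f h] by blast
    then show "k \<in> ?P" by (intro image_eqI[of _ _ "(g, k - g)"]) auto
  qed
  let ?t = "\<lambda>a p. f a \<otimes> \<beta> a (h (p - a)) \<otimes> \<beta> p (l (k - p))"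
  have tc: "?t a p \<in> carrier R" if "a \<in> ?F" "p \<in> ?P" for a p
    using subsetD[OF F(2) that(1)] subsetD[OF P(2) that(2)] f h l by simp
  have "((f \<star> h) \<star> l) k = (\<Oplus>p\<in>?P. (f \<star> h) p \<otimes> \<beta> p (l (k - p)))"
    by (rule sm_eq[OF fh l P(1) sub P(2)])
  also have "\<dots> = (\<Oplus>p\<in>?P. \<Oplus>a\<in>?F. ?t a p)"
  proof (rule finsum_cong'[OF refl])
    show "(\<lambda>p. \<Oplus>a\<in>?F. ?t a p) \<in> ?P \<rightarrow> carrier R" using tc by (blast intro: finsum_closed)
    fix p assume p: "p \<in> ?P"
    then have pG: "p \<in> G" using P by blast
    have "(f \<star> h) p = (\<Oplus>a\<in>?F. f a \<otimes> \<beta> a (h (p - a)))"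
      by (rule sm_eq[OF f h F(1) _ F(2)]) simp
    then show "(f \<star> h) p \<otimes> \<beta> p (l (k - p)) = (\<Oplus>a\<in>?F. ?t a p)"
      using pG F f h l by (subst finsum_ldistr[symmetric]) (auto dest: supp_in)
  qed
  also have "\<dots> = (\<Oplus>a\<in>?F. \<Oplus>p\<in>?P. ?t a p)"
    by (rule finsum_swap) (use F P tc in auto)
  also have "\<dots> = (\<Oplus>a\<in>?F. f a \<otimes> \<beta> a ((h \<star> l) (k - a)))"
  proof (rule finsum_cong'[OF refl])
    show "(\<lambda>a. f a \<otimes> \<beta> a ((h \<star> l) (k - a))) \<in> ?F \<rightarrow> carrier R"
      using supp_in[OF f] f hl by auto
    fix a assume a: "a \<in> ?F"
    then have aG: "a \<in> G" using F by blast
    have bG: "b \<in> G" if "b \<in> ?H" for b using H that by blast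
    have sub: "(\<lambda>b. a + b) ` ?H \<subseteq> ?P" using a by auto
    \<comment> \<open>For this \<open>a\<close> only the sums \<open>a + b\<close> with
      \<open>b\<close> in the support of \<open>h\<close> contribute; the other members of
      \<open>?P\<close> come from other terms of \<open>f\<close>.\<close>
    have "(\<Oplus>p\<in>?P. ?t a p) = (\<Oplus>p\<in>(\<lambda>b. a + b) ` ?H. ?t a p)"
    proof (rule add.finprod_mono_neutral_cong_right[OF P(1) sub])
      fix i assume i: "i \<in> ?P - (\<lambda>b. a + b) ` ?H"
      have "h (i - a) = \<zero>"
      proof (rule ccontr)
        assume "h (i - a) \<noteq> \<zero>"
        then have "i \<in> (\<lambda>b. a + b) ` ?H" by (intro image_eqI[of _ _ "i - a"]) auto
        then show False using i by blast
      qed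
      moreover have "i \<in> G" using i P by blast
      ultimately show "?t a i = \<zero>" using aG f l by simp
    qed (use tc a in auto)
    also have "\<dots> = (\<Oplus>b\<in>?H. ?t a (a + b))"
      by (rule finsum_reindex) (use tc a sub in \<open>auto simp: inj_on_def\<close>)
    also have "\<dots> = (\<Oplus>b\<in>?H. f a \<otimes> \<beta> a (h b \<otimes> \<beta> b (l (k - a - b))))"
      by (rule finsum_cong'[OF refl])
         (use f h l aG bG in \<open>auto simp: \<beta>_mult \<beta>_comp m_assoc diff_diff_eq\<close>)
    also have "\<dots> = f a \<otimes> (\<Oplus>b\<in>?H. \<beta> a (h b \<otimes> \<beta> b (l (k - a - b))))"
      by (rule finsum_rdistr[symmetric]) (use H f h l aG bG in auto)
    also have "(\<Oplus>b\<in>?H. \<beta> a (h b \<otimes> \<beta> b (l (k - a - b)))) = \<beta> a (\<Oplus>b\<in>?H. h b \<otimes> \<beta> b (l (k - a - b)))"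
      by (rule \<beta>_finsum[symmetric]) (use f h l aG bG in auto)
    also have "(\<Oplus>b\<in>?H. h b \<otimes> \<beta> b (l (k - a - b))) = (h \<star> l) (k - a)"
      by (rule sm_eq[symmetric]) (use h l H in auto)
    finally show "(\<Oplus>p\<in>?P. ?t a p) = f a \<otimes> \<beta> a ((h \<star> l) (k - a))" .
  qed
  also have "\<dots> = (f \<star> (h \<star> l)) k"
    by (rule sm_eq[symmetric]) (use f hl F in auto)
  finally show "((f \<star> h) \<star> l) k = (f \<star> (h \<star> l)) k" .
qed

lemma skew_add_closed:
  assumes "f \<in> carrier (S \<Gamma>)" "h \<in> carrier (S \<Gamma>)"
  shows "(\<lambda>g. f g \<oplus> h g) \<in> carrier (S \<Gamma>)"
proof -
  note [simp] = supp_finite[OF assms(1)] coeff_closed[OF assms(1)] coeff_closed[OF assms(2)]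
  have "{g. f g \<oplus> h g \<noteq> \<zero>} \<subseteq> {g. f g \<noteq> \<zero>} \<union> {g. h g \<noteq> \<zero>}" by auto
  then show ?thesis using assms unfolding skew_carrier_iff
    by (auto intro: finite_subset)
qed

lemma sm_distrib_right:
  assumes f: "f \<in> carrier (S G)" and h: "h \<in> carrier (S G)" and l: "l \<in> carrier (S G)"
  shows "(\<lambda>g. f g \<oplus> h g) \<star> l = (\<lambda>g. (f \<star> l) g \<oplus> (h \<star> l) g)"
proof
  fix k
  note [simp] = supp_finite[OF f] coeff_closed[OF f] supp_finite[OF h] coeff_closed[OF h] supp_finite[OF l] coeff_closed[OF l]
  let ?F = "{g. f g \<noteq> \<zero>} \<union> {g. h g \<noteq> \<zero>}"
  have F: "finite ?F" "?F \<subseteq> G" using f h supp_in[OF f] supp_in[OF h] by auto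
  have "((\<lambda>g. f g \<oplus> h g) \<star> l) k = (\<Oplus>g\<in>?F. (f g \<oplus> h g) \<otimes> \<beta> g (l (k - g)))"
    by (rule sm_eq) (use F f h l skew_add_closed in auto)
  also have "\<dots> = (\<Oplus>g\<in>?F. f g \<otimes> \<beta> g (l (k - g)) \<oplus> h g \<otimes> \<beta> g (l (k - g)))"
    by (rule finsum_cong') (use supp_in[OF f] supp_in[OF h] f h l in \<open>auto simp: l_distr\<close>)
  also have "\<dots> = (\<Oplus>g\<in>?F. f g \<otimes> \<beta> g (l (k - g))) \<oplus> (\<Oplus>g\<in>?F. h g \<otimes> \<beta> g (l (k - g)))"
    by (rule finsum_addf) (use supp_in[OF f] supp_in[OF h] f h l in auto)
  also have "(\<Oplus>g\<in>?F. f g \<otimes> \<beta> g (l (k - g))) = (f \<star> l) k"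
    by (rule sm_eq[symmetric]) (use F f l in auto)
  also have "(\<Oplus>g\<in>?F. h g \<otimes> \<beta> g (l (k - g))) = (h \<star> l) k"
    by (rule sm_eq[symmetric]) (use F h l in auto)
  finally show "((\<lambda>g. f g \<oplus> h g) \<star> l) k = (f \<star> l) k \<oplus> (h \<star> l) k" .
qed

lemma sm_distrib_left:
  assumes f: "f \<in> carrier (S G)" and h: "h \<in> carrier (S G)" and l: "l \<in> carrier (S G)"
  shows "l \<star> (\<lambda>g. f g \<oplus> h g) = (\<lambda>g. (l \<star> f) g \<oplus> (l \<star> h) g)"
proof
  fix k
  note [simp] = supp_finite[OF f] coeff_closed[OF f] supp_finite[OF h] coeff_closed[OF h] supp_finite[OF l] coeff_closed[OF l]
  let ?F = "{g. l g \<noteq> \<zero>}"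
  have F: "finite ?F" "?F \<subseteq> G" using l supp_in[OF l] by auto
  have gG: "g \<in> G" if "l g \<noteq> \<zero>" for g using that supp_in[OF l] by blast
  have "(l \<star> (\<lambda>g. f g \<oplus> h g)) k = (\<Oplus>g\<in>?F. l g \<otimes> \<beta> g (f (k - g) \<oplus> h (k - g)))"
    by (rule sm_eq) (use F f h l skew_add_closed in auto)
  also have "\<dots> = (\<Oplus>g\<in>?F. l g \<otimes> \<beta> g (f (k - g)) \<oplus> l g \<otimes> \<beta> g (h (k - g)))"
    by (rule finsum_cong') (use gG f h l in \<open>auto simp: \<beta>_add r_distr\<close>)
  also have "\<dots> = (\<Oplus>g\<in>?F. l g \<otimes> \<beta> g (f (k - g))) \<oplus> (\<Oplus>g\<in>?F. l g \<otimes> \<beta> g (h (k - g)))"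
    by (rule finsum_addf) (use gG f h l in auto)
  also have "(\<Oplus>g\<in>?F. l g \<otimes> \<beta> g (f (k - g))) = (l \<star> f) k"
    by (rule sm_eq[symmetric]) (use F f l in auto)
  also have "(\<Oplus>g\<in>?F. l g \<otimes> \<beta> g (h (k - g))) = (l \<star> h) k"
    by (rule sm_eq[symmetric]) (use F h l in auto)
  finally show "(l \<star> (\<lambda>g. f g \<oplus> h g)) k = (l \<star> f) k \<oplus> (l \<star> h) k" .
qed

definition mon :: "'a \<Rightarrow> ('x \<Rightarrow> int) \<Rightarrow> ('x \<Rightarrow> int) \<Rightarrow> 'a" where
  "mon a g = (\<lambda>k. if k = g then a else \<zero>)"

lemma mon_apply [simp]: "mon a g g = a" "k \<noteq> g \<Longrightarrow> mon a g k = \<zero>"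
  by (auto simp: mon_def)

lemma mon_nonzero: "mon a g k \<noteq> \<zero> \<Longrightarrow> k = g"
  by (auto simp: mon_def split: if_splits)

lemma term_elem_eq: "term_elem R t = mon \<one> t"
  by (simp add: term_elem_def mon_def)

lemma skew_one [simp]: "\<one>\<^bsub>S \<Gamma>\<^esub> = mon \<one> 0"
  by (simp only: skew_ring_def mon_def monoid.select_convs gzero_eq)

lemma mon_closed [simp]: "a \<in> carrier R \<Longrightarrow> g \<in> \<Gamma> \<Longrightarrow> mon a g \<in> carrier (S \<Gamma>)"
  by (auto simp: skew_carrier_iff mon_def)

lemma mon_sm:
  assumes "a \<in> carrier R" "g \<in> G" "f \<in> carrier (S G)"
  shows "(mon a g \<star> f) k = a \<otimes> \<beta> g (f (k - g))"
proof -
  note [simp] = coeff_closed[OF assms(3)]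
  have "(mon a g \<star> f) k = (\<Oplus>i\<in>{g}. mon a g i \<otimes> \<beta> i (f (k - i)))"
    by (rule sm_eq) (use assms in \<open>auto dest: mon_nonzero\<close>)
  then show ?thesis using assms by simp
qed

lemma sm_mon:
  assumes "f \<in> carrier (S G)" "b \<in> carrier R" "t \<in> G" "k - t \<in> G"
  shows "(f \<star> mon b t) k = f (k - t) \<otimes> \<beta> (k - t) b"
proof -
  note [simp] = supp_finite[OF assms(1)] coeff_closed[OF assms(1)]
  let ?F = "insert (k - t) {g. f g \<noteq> \<zero>}"
  have F: "finite ?F" "?F \<subseteq> G" using assms supp_in[OF assms(1)] by auto
  have "(f \<star> mon b t) k = (\<Oplus>g\<in>?F. f g \<otimes> \<beta> g (mon b t (k - g)))"
    by (rule sm_eq) (use assms F in auto)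
  also have "\<dots> = (\<Oplus>g\<in>?F. if k - t = g then f g \<otimes> \<beta> g b else \<zero>)"
    by (rule finsum_cong') (use assms supp_in[OF assms(1)] in \<open>auto simp: mon_def\<close>)
  also have "\<dots> = f (k - t) \<otimes> \<beta> (k - t) b"
    by (rule add.finprod_singleton) (use assms F supp_in[OF assms(1)] in auto)
  finally show ?thesis .
qed

text \<open>With coefficient \<open>\<one>\<close> the twist disappears, so the formula can be
  stated for every \<open>k\<close>. The case split is there because \<open>\<beta>\<close> is
  controlled only on \<open>G\<close>; if \<open>k - t\<close> lies outside \<open>G\<close>, both
  sides are zero.\<close>

lemma sm_term:
  assumes "f \<in> carrier (S G)" "t \<in> G"
  shows "(f \<star> mon \<one> t) k = f (k - t)"
proof (cases "k - t \<in> G")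
  case True
  then show ?thesis using sm_mon[of f \<one> t k] assms coeff_closed[OF assms(1)] by simp
next
  case False
  then have "f (k - t) = \<zero>" using supp_subset[OF assms(1)] by blast
  moreover have "(f \<star> mon \<one> t) k = \<zero>"
  proof (rule ccontr)
    assume "(f \<star> mon \<one> t) k \<noteq> \<zero>"
    then obtain g where "f g \<noteq> \<zero>" "mon \<one> t (k - g) \<noteq> \<zero>"
      using sm_supp[OF assms(1) mon_closed[OF one_closed assms(2)]] by blast
    then have "k - g = t" "g \<in> G" using supp_in[OF assms(1)] mon_nonzero by blast+
    then have "k - t = g" by auto
    then show False using False \<open>g \<in> G\<close> by simp
  qed
  ultimately show ?thesis by simp
qed

lemma mon_sm_mon:
  assumes "a \<in> carrier R" "g \<in> G" "b \<in> carrier R" "h \<in> G"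
  shows "mon a g \<star> mon b h = mon (a \<otimes> \<beta> g b) (g + h)"
proof
  fix k
  have "k - g = h \<longleftrightarrow> k = g + h" by (auto simp: algebra_simps)
  then show "(mon a g \<star> mon b h) k = mon (a \<otimes> \<beta> g b) (g + h) k"
    using mon_sm[OF assms(1,2) mon_closed[OF assms(3,4)], of k] assms by (cases "k = g + h") auto
qed

lemma skew_is_ring:
  assumes \<Gamma>: "submonoid_G XS \<Gamma>"
  shows "ring (S \<Gamma>)"
proof -
  note up = skew_carrier_mono[OF submonoid_subset[OF \<Gamma>]]
  show ?thesis
  proof (rule ringI)
    show "abelian_group (S \<Gamma>)"
    proof (rule abelian_groupI)
      fix f assume f: "f \<in> carrier (S \<Gamma>)"
      then have "(\<lambda>g. \<ominus> f g) \<in> carrier (S \<Gamma>)"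
        unfolding skew_carrier_iff by (auto elim: rev_finite_subset)
      moreover have "(\<lambda>g. \<ominus> f g) \<oplus>\<^bsub>S \<Gamma>\<^esub> f = \<zero>\<^bsub>S \<Gamma>\<^esub>" using coeff_closed[OF f] by (simp add: l_neg)
      ultimately show "\<exists>h\<in>carrier (S \<Gamma>). h \<oplus>\<^bsub>S \<Gamma>\<^esub> f = \<zero>\<^bsub>S \<Gamma>\<^esub>" by blast
    next
      fix f h assume "f \<in> carrier (S \<Gamma>)" "h \<in> carrier (S \<Gamma>)"
      then show "f \<oplus>\<^bsub>S \<Gamma>\<^esub> h \<in> carrier (S \<Gamma>)" by (simp add: skew_add_closed)
    next
      fix f h assume "f \<in> carrier (S \<Gamma>)" "h \<in> carrier (S \<Gamma>)"
      then show "f \<oplus>\<^bsub>S \<Gamma>\<^esub> h = h \<oplus>\<^bsub>S \<Gamma>\<^esub> f" by (simp add: a_comm skew_carrier_iff)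
    qed (auto simp: a_assoc skew_carrier_iff)
    show "monoid (S \<Gamma>)"
    proof (rule monoidI)
      fix f assume f: "f \<in> carrier (S \<Gamma>)"
      show "\<one>\<^bsub>S \<Gamma>\<^esub> \<otimes>\<^bsub>S \<Gamma>\<^esub> f = f" "f \<otimes>\<^bsub>S \<Gamma>\<^esub> \<one>\<^bsub>S \<Gamma>\<^esub> = f"
        using mon_sm[OF _ _ up[OF f], of \<one> 0] sm_term[OF up[OF f], of 0] coeff_closed[OF f] by (auto simp: fun_eq_iff)
    qed (auto intro: mon_closed sm_closed[OF \<Gamma>] sm_assoc up submonoid_zero[OF \<Gamma>])
  qed (simp_all add: sm_distrib_right sm_distrib_left up)
qed

lemma skew_minus:
  assumes "submonoid_G XS \<Gamma>" "f \<in> carrier (S \<Gamma>)"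
  shows "\<ominus>\<^bsub>S \<Gamma>\<^esub> f = (\<lambda>g. \<ominus> f g)"
proof -
  interpret A: ring "S \<Gamma>" using skew_is_ring[OF assms(1)] .
  have "(\<lambda>g. \<ominus> f g) \<in> carrier (S \<Gamma>)"
    using assms(2) unfolding skew_carrier_iff by (auto elim: rev_finite_subset)
  then show ?thesis
    using A.minus_equality[of "\<lambda>g. \<ominus> f g" f] assms(2) coeff_closed[OF assms(2)] by (simp add: l_neg)
qed

lemma skew_finsum:
  assumes \<Gamma>: "submonoid_G XS \<Gamma>" and f: "\<And>i. i \<in> Q \<Longrightarrow> f i \<in> carrier (S \<Gamma>)"
  shows "finsum (S \<Gamma>) f Q g = (\<Oplus>i\<in>Q. f i g)"
  using f
proof (induction Q rule: infinite_finite_induct)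
  case (insert x F)
  interpret A: ring "S \<Gamma>" using skew_is_ring[OF \<Gamma>] .
  from insert have "f \<in> F \<rightarrow> carrier (S \<Gamma>)" "(\<lambda>i. f i g) \<in> F \<rightarrow> carrier R" "f x g \<in> carrier R"
    by (auto intro: coeff_closed)
  then show ?case using insert by simp
next
  case (infinite A)
  interpret A: ring "S \<Gamma>" using skew_is_ring[OF \<Gamma>] .
  show ?case using infinite by (simp add: finsum_infinite A.finsum_infinite)
next
  case empty
  interpret A: ring "S \<Gamma>" using skew_is_ring[OF \<Gamma>] .
  show ?case by simp
qed

end

section \<open>The ring of fractions\<close>

lemma quot_group_eq: "quot_group T = {s - t | s t. s \<in> T \<and> t \<in> T}"
  by (auto simp: quot_group_def)

lemma submonoid_quot_group:
  assumes "submonoid_G XS T"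
  shows "submonoid_G XS (quot_group T)" "T \<subseteq> quot_group T" "g \<in> quot_group T \<Longrightarrow> - g \<in> quot_group T"
proof -
  note T = submonoid_zero[OF assms] submonoid_add[OF assms]
  have "s + s' \<in> quot_group T" if ss: "s \<in> quot_group T" "s' \<in> quot_group T" for s s'
  proof -
    obtain a b c d where "s = a - b" "s' = c - d" "a \<in> T" "b \<in> T" "c \<in> T" "d \<in> T"
      using ss by (auto simp: quot_group_eq)
    then have "s + s' = (a + c) - (b + d)" "a + c \<in> T" "b + d \<in> T" using T by (auto simp: algebra_simps)
    then show ?thesis unfolding quot_group_eq by blast
  qed
  moreover have "quot_group T \<subseteq> free_ab XS"
    using submonoid_subset[OF assms] free_ab_diff unfolding quot_group_eq by blast
  moreover show sub: "T \<subseteq> quot_group T"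
  proof
    fix t assume "t \<in> T"
    moreover have "t = t - 0" by simp
    ultimately show "t \<in> quot_group T" unfolding quot_group_eq using T(1) by blast
  qed
  ultimately show "submonoid_G XS (quot_group T)" using T(1) by (auto simp: submonoid_G_def)
  show "- g \<in> quot_group T" if g: "g \<in> quot_group T"
  proof -
    obtain a b where "g = a - b" "a \<in> T" "b \<in> T" using g by (auto simp: quot_group_eq)
    moreover from this have "- g = b - a" by simp
    ultimately show ?thesis unfolding quot_group_eq by blast
  qed
qed

text \<open>Writing each member as \<open>a - b\<close>, its \<open>b\<close> is added to the
  denominator found so far. Earlier members stay in \<open>T\<close> because \<open>T\<close> is
  closed under addition.\<close>

lemma common_denominator:
  assumes T: "submonoid_G XS T" and "finite D" "D \<subseteq> quot_group T"
  shows "\<exists>t\<in>T. \<forall>d\<in>D. t + d \<in> T"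
  using assms(2,3)
proof (induction D rule: finite_induct)
  case empty
  then show ?case using submonoid_zero[OF T] by blast
next
  case (insert x F)
  then obtain t where t: "t \<in> T" "\<forall>d\<in>F. t + d \<in> T" by blast
  obtain a b where ab: "x = a - b" "a \<in> T" "b \<in> T" using insert.prems by (auto simp: quot_group_eq)
  have "t + b \<in> T" using t ab submonoid_add[OF T] by blast
  moreover have "(t + b) + d \<in> T" if "d \<in> insert x F" for d
  proof (cases "d = x")
    case True
    then have "(t + b) + d = t + a" using ab by (simp add: algebra_simps)
    then show ?thesis using submonoid_add[OF T t(1) ab(2)] by metis
  next
    case False
    then have "t + d \<in> T" using that t by blast
    moreover have "(t + b) + d = (t + d) + b" by (simp add: algebra_simps)
    ultimately show ?thesis using submonoid_add[OF T _ ab(3)] by metis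
  qed
  ultimately show ?case by blast
qed

context skew
begin

lemma skew_carrier_restrict:
  "f \<in> carrier (S \<Delta>) \<Longrightarrow> (\<And>k. f k \<noteq> \<zero> \<Longrightarrow> k \<in> \<Gamma>) \<Longrightarrow> f \<in> carrier (S \<Gamma>)"
  by (auto simp: skew_carrier_iff)

lemma sm_closed_G: "f \<in> carrier (S G) \<Longrightarrow> h \<in> carrier (S G) \<Longrightarrow> f \<star> h \<in> carrier (S G)"
  by (rule sm_closed[OF submonoid_free_ab])

lemma one_sm: "f \<in> carrier (S G) \<Longrightarrow> mon \<one> 0 \<star> f = f"
  using ring.ring_simprules(12)[OF skew_is_ring[OF submonoid_free_ab], of f] by simp

lemma sm_one: "f \<in> carrier (S G) \<Longrightarrow> f \<star> mon \<one> 0 = f"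
  using monoid.r_one[OF ring.is_monoid[OF skew_is_ring[OF submonoid_free_ab]], of f] by simp

lemma term_sm: "t \<in> G \<Longrightarrow> f \<in> carrier (S G) \<Longrightarrow> (mon \<one> t \<star> f) k = \<beta> t (f (k - t))"
  by (simp add: mon_sm coeff_closed)

lemma term_sm_term: "s \<in> G \<Longrightarrow> t \<in> G \<Longrightarrow> mon \<one> s \<star> mon \<one> t = mon \<one> (s + t)"
  by (simp add: mon_sm_mon)

lemma term_neg_sm: "t \<in> G \<Longrightarrow> f \<in> carrier (S G) \<Longrightarrow> mon \<one> (- t) \<star> (mon \<one> t \<star> f) = f"
  using sm_assoc[of "mon \<one> (- t)" "mon \<one> t" f] term_sm_term[of "- t" t] one_sm[of f] by simp

lemma sm_term_neg: "t \<in> G \<Longrightarrow> f \<in> carrier (S G) \<Longrightarrow> (f \<star> mon \<one> t) \<star> mon \<one> (- t) = f"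
  using sm_assoc[of f "mon \<one> t" "mon \<one> (- t)"] term_sm_term[of t "- t"] sm_one[of f] by simp

lemma zero_sm: "f \<in> carrier (S G) \<Longrightarrow> (\<lambda>g. \<zero>) \<star> f = (\<lambda>g. \<zero>)"
  using ring.ring_simprules(24)[OF skew_is_ring[OF submonoid_free_ab], of f] by simp

lemma sm_zero: "f \<in> carrier (S G) \<Longrightarrow> f \<star> (\<lambda>g. \<zero>) = (\<lambda>g. \<zero>)"
  using ring.ring_simprules(25)[OF skew_is_ring[OF submonoid_free_ab], of f] by simp

lemma zero_skew_closed: "(\<lambda>g. \<zero>) \<in> carrier (S \<Gamma>)"
  by (simp add: skew_carrier_iff)

lemma term_sm_eq_zero:
  assumes "t \<in> G" "f \<in> carrier (S G)" "mon \<one> t \<star> f = (\<lambda>g. \<zero>)"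
  shows "f = (\<lambda>g. \<zero>)"
  using term_neg_sm[OF assms(1,2)] assms sm_zero[of "mon \<one> (- t)"] by simp

lemma sm_term_eq_zero:
  assumes "t \<in> G" "f \<in> carrier (S G)" "f \<star> mon \<one> t = (\<lambda>g. \<zero>)"
  shows "f = (\<lambda>g. \<zero>)"
  using sm_term_neg[OF assms(1,2)] assms zero_sm[of "mon \<one> (- t)"] by simp

lemma \<beta>_coeffs_closed:
  assumes "f \<in> carrier (S \<Gamma>)" "s \<in> G"
  shows "(\<lambda>g. \<beta> s (f g)) \<in> carrier (S \<Gamma>)"
  using assms unfolding skew_carrier_iff by auto

lemma term_commute:
  assumes "f \<in> carrier (S G)" "s \<in> G"
  shows "mon \<one> s \<star> f = (\<lambda>g. \<beta> s (f g)) \<star> mon \<one> s"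
  using assms by (auto simp: term_sm sm_term \<beta>_coeffs_closed)

context
  fixes T assumes T: "submonoid_G XS T"
begin

lemma TG: "t \<in> T \<Longrightarrow> t \<in> G"
  using submonoid_subset[OF T] by blast

lemma T_up: "f \<in> carrier (S T) \<Longrightarrow> f \<in> carrier (S G)"
  using skew_carrier_mono[OF submonoid_subset[OF T]] .

lemma Q_up: "f \<in> carrier (S (quot_group T)) \<Longrightarrow> f \<in> carrier (S G)"
  using skew_carrier_mono[OF submonoid_subset[OF submonoid_quot_group(1)[OF T]]] .

lemma T_Q: "f \<in> carrier (S T) \<Longrightarrow> f \<in> carrier (S (quot_group T))"
  using skew_carrier_mono[OF submonoid_quot_group(2)[OF T]] .

text \<open>Moving a term past an element only twists the coefficients and leaves the support in
  \<open>T\<close>. Both Ore conditions therefore hold with the given term itself as new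
  denominator, and terms are regular because they are invertible over \<open>G\<close>.\<close>

lemma denominator_set_terms: "denominator_set (S T) (term_elem R ` T)"
  unfolding denominator_set_def
proof (intro conjI)
  show "mult_closed (S T) (term_elem R ` T)"
    using submonoid_zero[OF T] submonoid_add[OF T]
    by (auto simp: mult_closed_def term_elem_eq term_sm_term TG)
  show "left_ore (S T) (term_elem R ` T)"
    unfolding left_ore_def
  proof (intro ballI)
    fix a s assume a: "a \<in> carrier (S T)" and s: "s \<in> term_elem R ` T"
    then obtain t where t: "t \<in> T" "s = mon \<one> t" by (auto simp: term_elem_eq)
    have "s \<otimes>\<^bsub>S T\<^esub> a = (\<lambda>g. \<beta> t (a g)) \<otimes>\<^bsub>S T\<^esub> s"
      using term_commute[OF T_up[OF a] TG[OF t(1)]] t by simp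
    then show "\<exists>a'\<in>carrier (S T). \<exists>s'\<in>term_elem R ` T. s' \<otimes>\<^bsub>S T\<^esub> a = a' \<otimes>\<^bsub>S T\<^esub> s"
      using s \<beta>_coeffs_closed[OF a TG[OF t(1)]] by blast
  qed
  show "right_ore (S T) (term_elem R ` T)"
    unfolding right_ore_def
  proof (intro ballI)
    fix a s assume a: "a \<in> carrier (S T)" and s: "s \<in> term_elem R ` T"
    then obtain t where t: "t \<in> T" "s = mon \<one> t" by (auto simp: term_elem_eq)
    let ?b = "\<lambda>g. \<beta> (- t) (a g)"
    have b: "?b \<in> carrier (S T)" using \<beta>_coeffs_closed[OF a] TG[OF t(1)] by simp
    have "mon \<one> t \<star> ?b = (\<lambda>g. \<beta> t (?b g)) \<star> mon \<one> t"
      by (rule term_commute[OF T_up[OF b] TG[OF t(1)]])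
    also have "(\<lambda>g. \<beta> t (?b g)) = a"
      using coeff_closed[OF a] TG[OF t(1)] by simp
    finally have "a \<otimes>\<^bsub>S T\<^esub> s = s \<otimes>\<^bsub>S T\<^esub> ?b" unfolding t(2) skew_mult by (rule sym)
    then show "\<exists>a'\<in>carrier (S T). \<exists>s'\<in>term_elem R ` T. a \<otimes>\<^bsub>S T\<^esub> s' = s \<otimes>\<^bsub>S T\<^esub> a'"
      using s b by blast
  qed
  show "\<forall>s\<in>term_elem R ` T. regular_elem (S T) s"
    unfolding regular_elem_def term_elem_eq
    by (auto intro: term_sm_eq_zero[OF TG T_up] sm_term_eq_zero[OF TG T_up])
qed

lemma ex_denominator:
  assumes q: "q \<in> carrier (S (quot_group T))"
  shows "\<exists>t\<in>T. mon \<one> t \<star> q \<in> carrier (S T) \<and> q \<star> mon \<one> t \<in> carrier (S T)"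
proof -
  obtain t where t: "t \<in> T" "\<forall>d\<in>{g. q g \<noteq> \<zero>}. t + d \<in> T"
    using common_denominator[OF T supp_finite[OF q] supp_subset[OF q]] by blast
  have tG: "t \<in> G" using TG t by blast
  have m: "mon \<one> t \<in> carrier (S G)" using tG by simp
  have k: "k \<in> T" if "q (k - t) \<noteq> \<zero>" for k
  proof -
    have "t + (k - t) \<in> T" using t that by blast
    then show ?thesis by simp
  qed
  have "mon \<one> t \<star> q \<in> carrier (S T)"
    by (rule skew_carrier_restrict[OF sm_closed_G[OF m Q_up[OF q]]])
       (metis k tG term_sm[OF tG Q_up[OF q]] \<beta>_zero)
  moreover have "q \<star> mon \<one> t \<in> carrier (S T)"
    by (rule skew_carrier_restrict[OF sm_closed_G[OF Q_up[OF q] m]])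
       (use k sm_term[OF Q_up[OF q] tG] in auto)
  ultimately show ?thesis using t(1) by blast
qed

lemma ring_of_fractions_terms: "ring_of_fractions (S (quot_group T)) (S T) (term_elem R ` T)"
proof -
  let ?Q = "S (quot_group T)"
  interpret A: ring "S T" using skew_is_ring[OF T] .
  interpret Q: ring ?Q using skew_is_ring[OF submonoid_quot_group(1)[OF T]] .
  have inv_t: "mon \<one> t \<in> Units ?Q" "inv\<^bsub>?Q\<^esub> (mon \<one> t) = mon \<one> (- t)" if t: "t \<in> T" for t
  proof -
    have "t \<in> quot_group T" "- t \<in> quot_group T" using submonoid_quot_group[OF T] t by auto
    then have c: "mon \<one> t \<in> carrier ?Q" "mon \<one> (- t) \<in> carrier ?Q" by auto
    have e: "mon \<one> t \<otimes>\<^bsub>?Q\<^esub> mon \<one> (- t) = \<one>\<^bsub>?Q\<^esub>" "mon \<one> (- t) \<otimes>\<^bsub>?Q\<^esub> mon \<one> t = \<one>\<^bsub>?Q\<^esub>"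
      using term_sm_term[of t "- t"] term_sm_term[of "- t" t] TG[OF t] by auto
    show "mon \<one> t \<in> Units ?Q" using c e unfolding Units_def by blast
    show "inv\<^bsub>?Q\<^esub> (mon \<one> t) = mon \<one> (- t)" by (rule Q.inv_unique'[OF c e, symmetric])
  qed
  have "subring (carrier (S T)) ?Q"
  proof (rule Q.subringI)
    show "carrier (S T) \<subseteq> carrier ?Q" using T_Q by blast
    show "\<one>\<^bsub>?Q\<^esub> \<in> carrier (S T)" using A.one_closed by simp
    fix f h assume f: "f \<in> carrier (S T)" and h: "h \<in> carrier (S T)"
    show "\<ominus>\<^bsub>?Q\<^esub> f \<in> carrier (S T)"
      using A.a_inv_closed[OF f] skew_minus[OF T f] skew_minus[OF submonoid_quot_group(1)[OF T] T_Q[OF f]]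
      by simp
    show "f \<otimes>\<^bsub>?Q\<^esub> h \<in> carrier (S T)" using A.m_closed[OF f h] by simp
    show "f \<oplus>\<^bsub>?Q\<^esub> h \<in> carrier (S T)" using A.a_closed[OF f h] by simp
  qed
  moreover have "\<exists>s\<in>term_elem R ` T. \<exists>b\<in>carrier (S T). q = inv\<^bsub>?Q\<^esub> s \<otimes>\<^bsub>?Q\<^esub> b"
    "\<exists>s\<in>term_elem R ` T. \<exists>b\<in>carrier (S T). q = b \<otimes>\<^bsub>?Q\<^esub> inv\<^bsub>?Q\<^esub> s" if q: "q \<in> carrier ?Q" for q
  proof -
    obtain t where t: "t \<in> T" "mon \<one> t \<star> q \<in> carrier (S T)" "q \<star> mon \<one> t \<in> carrier (S T)"
      using ex_denominator[OF q] by blast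
    have "q = inv\<^bsub>?Q\<^esub> (mon \<one> t) \<otimes>\<^bsub>?Q\<^esub> (mon \<one> t \<star> q)" "q = (q \<star> mon \<one> t) \<otimes>\<^bsub>?Q\<^esub> inv\<^bsub>?Q\<^esub> (mon \<one> t)"
      using inv_t[OF t(1)] term_neg_sm[OF TG[OF t(1)] Q_up[OF q]] sm_term_neg[OF TG[OF t(1)] Q_up[OF q]] by auto
    then show "\<exists>s\<in>term_elem R ` T. \<exists>b\<in>carrier (S T). q = inv\<^bsub>?Q\<^esub> s \<otimes>\<^bsub>?Q\<^esub> b"
      "\<exists>s\<in>term_elem R ` T. \<exists>b\<in>carrier (S T). q = b \<otimes>\<^bsub>?Q\<^esub> inv\<^bsub>?Q\<^esub> s"
      unfolding term_elem_eq using t by blast+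
  qed
  moreover have "term_elem R ` T \<subseteq> Units ?Q" using inv_t(1) by (auto simp: term_elem_eq)
  ultimately show ?thesis unfolding ring_of_fractions_def by simp
qed

section \<open>Left ideals of the monoid ring and of its ring of fractions\<close>

definition extend_to_fractions :: "(('x \<Rightarrow> int) \<Rightarrow> 'a) set \<Rightarrow> (('x \<Rightarrow> int) \<Rightarrow> 'a) set" where
  "extend_to_fractions I = {q \<in> carrier (S (quot_group T)). \<exists>t\<in>T. mon \<one> t \<star> q \<in> I}"

lemma term_sm_in_ideal:
  assumes "left_ideal I (S T)" "s \<in> T" "t \<in> T" "q \<in> carrier (S G)" "mon \<one> t \<star> q \<in> I"
  shows "mon \<one> (s + t) \<star> q \<in> I"
proof -
  have "mon \<one> (s + t) \<star> q = mon \<one> s \<star> (mon \<one> t \<star> q)"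
    using term_sm_term[of s t] sm_assoc[of "mon \<one> s" "mon \<one> t" q] assms TG by simp
  then show ?thesis
    using ring.left_ideal_mult[OF skew_is_ring[OF T] assms(1) _ assms(5), of "mon \<one> s"] assms(2) by simp
qed

text \<open>This is the left ideal that \<open>I\<close> generates in the ring of fractions:
  finitely many fractions have a common denominator, so one term \<open>t\<close> on the left is
  enough to describe it.\<close>

lemma left_ideal_extend_to_fractions:
  assumes I: "left_ideal I (S T)"
  shows "left_ideal (extend_to_fractions I) (S (quot_group T))"
proof -
  let ?Q = "S (quot_group T)"
  interpret A: ring "S T" using skew_is_ring[OF T] .
  interpret Q: ring ?Q using skew_is_ring[OF submonoid_quot_group(1)[OF T]] .
  show ?thesis
  proof (rule Q.left_idealI)
    show "extend_to_fractions I \<subseteq> carrier ?Q" by (auto simp: extend_to_fractions_def)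
    have "mon \<one> 0 \<star> (\<lambda>g. \<zero>) = (\<lambda>g. \<zero>)" by (rule one_sm[OF zero_skew_closed])
    then show "\<zero>\<^bsub>?Q\<^esub> \<in> extend_to_fractions I"
      using submonoid_zero[OF T] A.left_ideal_zero[OF I] zero_skew_closed
      by (auto simp: extend_to_fractions_def intro!: bexI[of _ 0])
  next
    fix x y assume "x \<in> extend_to_fractions I" "y \<in> extend_to_fractions I"
    then obtain s t where x: "x \<in> carrier ?Q" "s \<in> T" "mon \<one> s \<star> x \<in> I"
      and y: "y \<in> carrier ?Q" "t \<in> T" "mon \<one> t \<star> y \<in> I" by (auto simp: extend_to_fractions_def)
    have "mon \<one> (t + s) \<star> x \<in> I" "mon \<one> (s + t) \<star> y \<in> I"
      using term_sm_in_ideal[OF I] x y Q_up by blast+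
    then have "(mon \<one> (s + t) \<star> x) \<oplus>\<^bsub>S T\<^esub> (mon \<one> (s + t) \<star> y) \<in> I"
      using A.left_ideal_add[OF I] by (simp only: add.commute)
    then have "mon \<one> (s + t) \<star> (\<lambda>g. x g \<oplus> y g) \<in> I"
      using sm_distrib_left[OF Q_up[OF x(1)] Q_up[OF y(1)], of "mon \<one> (s + t)"] TG x y by simp
    moreover have "(\<lambda>g. x g \<oplus> y g) \<in> carrier ?Q" using skew_add_closed x y by blast
    ultimately show "x \<oplus>\<^bsub>?Q\<^esub> y \<in> extend_to_fractions I"
      using submonoid_add[OF T x(2) y(2)] by (auto simp: extend_to_fractions_def)
  next
    fix p x assume p: "p \<in> carrier ?Q" and "x \<in> extend_to_fractions I"
    then obtain t where x: "x \<in> carrier ?Q" "t \<in> T" "mon \<one> t \<star> x \<in> I" by (auto simp: extend_to_fractions_def)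
    have tG: "t \<in> G" using TG x by blast
    have nt: "mon \<one> (- t) \<in> carrier ?Q" using submonoid_quot_group[OF T] x(2) by auto
    \<comment> \<open>Clearing the denominator of \<open>p t^-1\<close>, rather than that of
      \<open>p\<close>, makes \<open>s p x = (s p t^-1) (t x)\<close> a product of an element of
      \<open>S T\<close> and an element of \<open>I\<close>.\<close>
    have pt: "p \<star> mon \<one> (- t) \<in> carrier ?Q" using Q.m_closed[OF p nt] by simp
    obtain s where s: "s \<in> T" "mon \<one> s \<star> (p \<star> mon \<one> (- t)) \<in> carrier (S T)"
      using ex_denominator[OF pt] by blast
    have sG: "s \<in> G" using TG s by blast
    note up = Q_up[OF p] Q_up[OF x(1)] Q_up[OF nt] Q_up[OF pt]
    have "(mon \<one> s \<star> (p \<star> mon \<one> (- t))) \<star> (mon \<one> t \<star> x) \<in> I"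
      using A.left_ideal_mult[OF I s(2) x(3)] by simp
    also have "(mon \<one> s \<star> (p \<star> mon \<one> (- t))) \<star> (mon \<one> t \<star> x)
        = mon \<one> s \<star> ((p \<star> mon \<one> (- t)) \<star> (mon \<one> t \<star> x))"
      by (rule sm_assoc) (use up sG tG sm_closed_G in auto)
    also have "(p \<star> mon \<one> (- t)) \<star> (mon \<one> t \<star> x) = p \<star> (mon \<one> (- t) \<star> (mon \<one> t \<star> x))"
      by (rule sm_assoc) (use up sG tG sm_closed_G in auto)
    also have "mon \<one> (- t) \<star> (mon \<one> t \<star> x) = x" by (rule term_neg_sm[OF tG up(2)])
    finally have "mon \<one> s \<star> (p \<star> x) \<in> I" .
    moreover have "p \<star> x \<in> carrier ?Q" using Q.m_closed[OF p x(1)] by simp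
    ultimately show "p \<otimes>\<^bsub>?Q\<^esub> x \<in> extend_to_fractions I"
      using s(1) by (auto simp: extend_to_fractions_def)
  qed
qed

lemma common_term:
  assumes "finite P" "\<And>I. I \<in> P \<Longrightarrow> left_ideal I (S T)" "\<And>I. I \<in> P \<Longrightarrow> f I \<in> extend_to_fractions I"
  shows "\<exists>t\<in>T. \<forall>I\<in>P. mon \<one> t \<star> f I \<in> I"
  using assms
proof (induction P rule: finite_induct)
  case empty
  then show ?case using submonoid_zero[OF T] by blast
next
  case (insert I F)
  then obtain t where t: "t \<in> T" "\<forall>J\<in>F. mon \<one> t \<star> f J \<in> J" by auto
  obtain s where s: "s \<in> T" "mon \<one> s \<star> f I \<in> I"
    using insert.prems(2)[of I] by (auto simp: extend_to_fractions_def)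
  have up: "f J \<in> carrier (S G)" if "J \<in> insert I F" for J
    using insert.prems(2)[OF that] Q_up by (auto simp: extend_to_fractions_def)
  have "mon \<one> (s + t) \<star> f J \<in> J" if J: "J \<in> insert I F" for J
  proof (cases "J = I")
    case True
    then show ?thesis
      using term_sm_in_ideal[OF insert.prems(1)[of I] t(1) s(1) up s(2)] by (simp add: add.commute)
  next
    case False
    then show ?thesis
      using term_sm_in_ideal[OF insert.prems(1)[OF J] s(1) t(1) up[OF J]] t(2) J by blast
  qed
  then show ?case using submonoid_add[OF T s(1) t(1)] by blast
qed

text \<open>A relation among elements of the extended ideals becomes a relation in
  \<open>S T\<close> after multiplication by one common term, and that term can be cancelled from
  each summand afterwards.\<close>

lemma udim_le_fractions: "udim_le (S T) (S (quot_group T))"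
proof (rule udim_leI[OF skew_is_ring[OF submonoid_quot_group(1)[OF T]], where I = "\<lambda>F. F" and V = "\<lambda>_. extend_to_fractions"])
  let ?Q = "S (quot_group T)"
  interpret A: ring "S T" using skew_is_ring[OF T] .
  interpret Q: ring ?Q using skew_is_ring[OF submonoid_quot_group(1)[OF T]] .
  fix F assume "indep_family (S T) F"
  then have F: "indep_on (S T) F (\<lambda>I. I)" by (simp add: indep_family_iff_indep_on)
  have "indep_on ?Q F extend_to_fractions"
    unfolding indep_on_def
  proof (intro conjI ballI allI impI)
    fix I assume I: "I \<in> F"
    have li: "left_ideal I (S T)" using indep_on_left_ideal[OF F I] .
    show "left_ideal (extend_to_fractions I) ?Q" by (rule left_ideal_extend_to_fractions[OF li])
    obtain x where x: "x \<in> I" "x \<noteq> \<zero>\<^bsub>S T\<^esub>" using A.nonzero_ex[OF li indep_on_nonzero[OF F I]] by blast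
    have xc: "x \<in> carrier (S T)" using A.left_ideal_carrier[OF li x(1)] .
    then have "x \<in> extend_to_fractions I"
      using x(1) T_Q submonoid_zero[OF T] one_sm[OF T_up[OF xc]]
      by (auto simp: extend_to_fractions_def intro!: bexI[of _ 0])
    then show "extend_to_fractions I \<noteq> {\<zero>\<^bsub>?Q\<^esub>}" using x(2) by auto
  next
    fix P f I
    assume "finite P \<and> P \<subseteq> F \<and> (\<forall>i\<in>P. f i \<in> extend_to_fractions i) \<and> finsum ?Q f P = \<zero>\<^bsub>?Q\<^esub>" and I: "I \<in> P"
    then have P: "finite P" "P \<subseteq> F" and f: "\<And>i. i \<in> P \<Longrightarrow> f i \<in> extend_to_fractions i"
      and z: "finsum ?Q f P = \<zero>\<^bsub>?Q\<^esub>" by auto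
    have li: "left_ideal J (S T)" if "J \<in> P" for J using indep_on_left_ideal[OF F] P that by blast
    obtain t where t: "t \<in> T" "\<forall>I\<in>P. mon \<one> t \<star> f I \<in> I" using common_term[OF P(1) li f] by blast
    have fQ: "f i \<in> carrier ?Q" if "i \<in> P" for i using f[OF that] by (simp add: extend_to_fractions_def)
    have tQ: "mon \<one> t \<in> carrier ?Q" using submonoid_quot_group(2)[OF T] t by auto
    have "(\<lambda>g. \<zero>) = mon \<one> t \<star> finsum ?Q f P"
      using z sm_zero[OF Q_up[OF tQ]] by simp
    also have "\<dots> = finsum ?Q (\<lambda>i. mon \<one> t \<star> f i) P"
      using Q.finsum_rdistr[OF P(1) tQ, of f] fQ by auto
    finally have z': "finsum ?Q (\<lambda>i. mon \<one> t \<star> f i) P = (\<lambda>g. \<zero>)" by simp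
    have tf: "mon \<one> t \<star> f i \<in> carrier (S T)" if "i \<in> P" for i
      using A.left_ideal_carrier[OF li[OF that]] t that by blast
    have "finsum (S T) (\<lambda>i. mon \<one> t \<star> f i) P g = \<zero>" for g
    proof -
      have "finsum (S T) (\<lambda>i. mon \<one> t \<star> f i) P g = finsum ?Q (\<lambda>i. mon \<one> t \<star> f i) P g"
        using skew_finsum[OF T, of P "\<lambda>i. mon \<one> t \<star> f i" g, OF tf]
          skew_finsum[OF submonoid_quot_group(1)[OF T], of P "\<lambda>i. mon \<one> t \<star> f i" g, OF T_Q[OF tf]]
        by simp
      then show ?thesis using z' by simp
    qed
    then have "finsum (S T) (\<lambda>i. mon \<one> t \<star> f i) P = \<zero>\<^bsub>S T\<^esub>" by auto
    then have "mon \<one> t \<star> f I = \<zero>\<^bsub>S T\<^esub>"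
      by (rule indep_onD[OF F P, rotated]) (use t(2) I in auto)
    then show "f I = \<zero>\<^bsub>?Q\<^esub>" using term_sm_eq_zero[OF TG[OF t(1)] Q_up[OF fQ[OF I]]] by simp
  qed
  then show "indep_on ?Q F extend_to_fractions \<and> (card_of F, card_of F) \<in> ordLeq" by simp
qed

text \<open>Intersecting with \<open>S T\<close> keeps a left ideal nonzero, since a denominator of
  a nonzero element can be cleared without leaving the ideal. Relations in \<open>S T\<close> are
  relations in the ring of fractions.\<close>

lemma udim_le_of_fractions: "udim_le (S (quot_group T)) (S T)"
proof (rule udim_leI[OF skew_is_ring[OF T], where I = "\<lambda>F. F" and V = "\<lambda>_ J. J \<inter> carrier (S T)"])
  let ?Q = "S (quot_group T)"
  interpret A: ring "S T" using skew_is_ring[OF T] .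
  interpret Q: ring ?Q using skew_is_ring[OF submonoid_quot_group(1)[OF T]] .
  fix F assume "indep_family ?Q F"
  then have F: "indep_on ?Q F (\<lambda>I. I)" by (simp add: indep_family_iff_indep_on)
  have "indep_on (S T) F (\<lambda>J. J \<inter> carrier (S T))"
    unfolding indep_on_def
  proof (intro conjI ballI allI impI)
    fix J assume J: "J \<in> F"
    have li: "left_ideal J ?Q" using indep_on_left_ideal[OF F J] .
    show "left_ideal (J \<inter> carrier (S T)) (S T)"
    proof (rule A.left_idealI)
      show "\<zero>\<^bsub>S T\<^esub> \<in> J \<inter> carrier (S T)" using Q.left_ideal_zero[OF li] A.zero_closed by simp
      show "x \<oplus>\<^bsub>S T\<^esub> y \<in> J \<inter> carrier (S T)" if "x \<in> J \<inter> carrier (S T)" "y \<in> J \<inter> carrier (S T)" for x y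
        using that Q.left_ideal_add[OF li, of x y] A.a_closed[of x y] by simp
      show "a \<otimes>\<^bsub>S T\<^esub> x \<in> J \<inter> carrier (S T)" if "a \<in> carrier (S T)" "x \<in> J \<inter> carrier (S T)" for a x
        using that Q.left_ideal_mult[OF li T_Q, of a x] A.m_closed[of a x] by simp
    qed simp
    obtain x where x: "x \<in> J" "x \<noteq> \<zero>\<^bsub>?Q\<^esub>" using Q.nonzero_ex[OF li indep_on_nonzero[OF F J]] by blast
    have xc: "x \<in> carrier ?Q" using Q.left_ideal_carrier[OF li x(1)] .
    obtain t where t: "t \<in> T" "mon \<one> t \<star> x \<in> carrier (S T)" using ex_denominator[OF xc] by blast
    have "mon \<one> t \<star> x \<in> J"
      using Q.left_ideal_mult[OF li T_Q x(1), of "mon \<one> t"] t by simp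
    moreover have "mon \<one> t \<star> x \<noteq> \<zero>\<^bsub>S T\<^esub>"
      using term_sm_eq_zero[OF TG[OF t(1)] Q_up[OF xc]] x(2) by auto
    ultimately show "J \<inter> carrier (S T) \<noteq> {\<zero>\<^bsub>S T\<^esub>}" using t(2) by blast
  next
    fix P f I
    assume "finite P \<and> P \<subseteq> F \<and> (\<forall>i\<in>P. f i \<in> i \<inter> carrier (S T)) \<and> finsum (S T) f P = \<zero>\<^bsub>S T\<^esub>" and I: "I \<in> P"
    then have P: "finite P" "P \<subseteq> F" and f: "\<And>i. i \<in> P \<Longrightarrow> f i \<in> i" "\<And>i. i \<in> P \<Longrightarrow> f i \<in> carrier (S T)"
      and z: "finsum (S T) f P = \<zero>\<^bsub>S T\<^esub>" by auto
    have "finsum ?Q f P g = \<zero>" for g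
    proof -
      have "finsum ?Q f P g = finsum (S T) f P g"
        using skew_finsum[OF T, of P f g, OF f(2)]
          skew_finsum[OF submonoid_quot_group(1)[OF T], of P f g, OF T_Q[OF f(2)]] by simp
      then show ?thesis using z by simp
    qed
    then have "finsum ?Q f P = \<zero>\<^bsub>?Q\<^esub>" by auto
    then have "f I = \<zero>\<^bsub>?Q\<^esub>" by (rule indep_onD[OF F P, rotated]) (use f I in auto)
    then show "f I = \<zero>\<^bsub>S T\<^esub>" by simp
  qed
  then show "indep_on (S T) F (\<lambda>J. J \<inter> carrier (S T)) \<and> (card_of F, card_of F) \<in> ordLeq" by simp
qed

lemma udim_eq_fractions: "udim_eq (S T) (S (quot_group T))"
  using udim_le_fractions udim_le_of_fractions by (simp add: udim_eq_def)

end

end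

section \<open>Total order and growth in free abelian groups\<close>

lemma finite_linear_order_max:
  assumes r: "linear_order_on UNIV r" and "finite A" "A \<noteq> {}"
  shows "\<exists>m\<in>A. \<forall>a\<in>A. (a, m) \<in> r"
  using assms(2,3)
proof (induction A rule: finite_ne_induct)
  case (singleton x)
  then show ?case using r by (auto simp: order_on_defs refl_on_def)
next
  case (insert x F)
  then obtain m where m: "m \<in> F" "\<forall>a\<in>F. (a, m) \<in> r" by blast
  have tr: "trans r" and tot: "(x, m) \<in> r \<or> (m, x) \<in> r" and refl: "(x, x) \<in> r"
    using r by (cases "x = m"; auto simp: order_on_defs refl_on_def total_on_def)+
  from tot show ?case
  proof
    assume "(x, m) \<in> r"
    then show ?thesis using m by blast
  next
    assume "(m, x) \<in> r"
    then have "\<forall>a\<in>insert x F. (a, x) \<in> r" using m refl tr by (auto dest: transD)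
    then show ?thesis by blast
  qed
qed

definition leads :: "'x rel \<Rightarrow> ('x \<Rightarrow> int) \<Rightarrow> 'x \<Rightarrow> bool" where
  "leads r g x \<longleftrightarrow> g x \<noteq> 0 \<and> (\<forall>y. (x, y) \<in> r \<and> y \<noteq> x \<longrightarrow> g y = 0)"

lemma ex_leads:
  assumes r: "linear_order_on UNIV r" and "finite {v. g v \<noteq> 0}" "g \<noteq> 0"
  shows "\<exists>x. leads r g x"
proof -
  have "{v. g v \<noteq> 0} \<noteq> {}" using assms(3) by (auto simp: fun_eq_iff)
  then obtain m where m: "g m \<noteq> 0" "\<And>a. g a \<noteq> 0 \<Longrightarrow> (a, m) \<in> r"
    using finite_linear_order_max[OF r assms(2)] by blast
  have "antisym r" using r by (auto simp: order_on_defs)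
  then have "g y = 0" if "(m, y) \<in> r" "y \<noteq> m" for y using m(2)[of y] that by (auto dest: antisymD)
  then show ?thesis using m(1) unfolding leads_def by blast
qed

text \<open>The variables are linearly ordered by the well-ordering theorem, and an exponent vector
  counts as positive when its value at the largest variable of its support is positive.\<close>

lemma ex_positive_cone:
  "\<exists>pos :: ('x \<Rightarrow> int) \<Rightarrow> bool. (\<forall>g h. pos g \<longrightarrow> pos h \<longrightarrow> pos (g + h)) \<and> \<not> pos 0 \<and>
     (\<forall>g. finite {v. g v \<noteq> 0} \<longrightarrow> g \<noteq> 0 \<longrightarrow> pos g \<or> pos (- g))"
proof -
  obtain r :: "'x rel" where "well_order_on UNIV r" using well_order_on by blast
  then have r: "linear_order_on UNIV r" by (simp add: well_order_on_def)
  define pos where "pos g \<longleftrightarrow> (\<exists>x. leads r g x \<and> g x > 0)" for g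
  have tr: "trans r" and tot: "\<And>x y. x = y \<or> (x, y) \<in> r \<or> (y, x) \<in> r" and anti: "antisym r"
    using r by (auto simp: order_on_defs total_on_def)
  have "pos (g + h)" if gh: "pos g" "pos h" for g h
  proof -
    obtain x y where x: "leads r g x" "g x > 0" and y: "leads r h y" "h y > 0" using gh by (auto simp: pos_def)
    \<comment> \<open>By symmetry the leading variable \<open>y'\<close> of the second summand may
      be taken as the larger one. There the first summand contributes a positive value or zero, so
      \<open>y'\<close> still leads the sum with a positive value.\<close>
    have *: "pos (g' + h')" if "leads r g' x'" "g' x' > 0" "leads r h' y'" "h' y' > 0" "(x', y') \<in> r" for g' h' x' y'
    proof -
      have g'y: "g' y' \<ge> 0" using that by (cases "x' = y'") (auto simp: leads_def)
      have "(g' + h') z = 0" if z: "(y', z) \<in> r" "z \<noteq> y'" for z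
      proof -
        have "(x', z) \<in> r" using transD[OF tr \<open>(x', y') \<in> r\<close> z(1)] .
        moreover have "z \<noteq> x'" using z antisymD[OF anti] \<open>(x', y') \<in> r\<close> by blast
        ultimately have "g' z = 0" using \<open>leads r g' x'\<close> by (auto simp: leads_def)
        moreover have "h' z = 0" using z \<open>leads r h' y'\<close> by (auto simp: leads_def)
        ultimately show ?thesis by simp
      qed
      then have "leads r (g' + h') y'" "(g' + h') y' > 0"
        using g'y \<open>h' y' > 0\<close> by (auto simp: leads_def)
      then show ?thesis by (auto simp only: pos_def)
    qed
    have "(x, y) \<in> r \<or> (y, x) \<in> r" using r tot[of x y] by (auto simp: order_on_defs refl_on_def)
    then show ?thesis using *[OF x y] *[OF y x] by (metis add.commute)
  qed
  moreover have "\<not> pos 0" by (auto simp: pos_def leads_def)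
  moreover have "pos g \<or> pos (- g)" if g: "finite {v. g v \<noteq> 0}" "g \<noteq> 0" for g
  proof -
    obtain x where x: "leads r g x" using ex_leads[OF r g] by blast
    then have "leads r (- g) x" "g x \<noteq> 0" by (auto simp: leads_def)
    then show ?thesis using x unfolding pos_def by (metis neg_0_less_iff_less not_less_iff_gr_or_eq uminus_apply)
  qed
  ultimately show ?thesis by blast
qed

text \<open>One positive cone is fixed by choice, so that later statements carry no order parameter;
  a term \<open>g\<close> lies below \<open>h\<close> when \<open>pos_cone (h - g)\<close>.\<close>

definition pos_cone :: "('x \<Rightarrow> int) \<Rightarrow> bool" where
  "pos_cone = (SOME pos. (\<forall>g h. pos g \<longrightarrow> pos h \<longrightarrow> pos (g + h)) \<and> \<not> pos 0 \<and>
     (\<forall>g. finite {v. g v \<noteq> 0} \<longrightarrow> g \<noteq> 0 \<longrightarrow> pos g \<or> pos (- g)))"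

lemma pos_cone_add: "pos_cone g \<Longrightarrow> pos_cone h \<Longrightarrow> pos_cone (g + h)"
  and pos_cone_zero: "\<not> pos_cone 0"
  and pos_cone_total: "finite {v. g v \<noteq> 0} \<Longrightarrow> g \<noteq> 0 \<Longrightarrow> pos_cone g \<or> pos_cone (- g)"
  using someI_ex[OF ex_positive_cone] unfolding pos_cone_def[symmetric] by blast+

lemma pos_cone_asym: "pos_cone (g - h) \<Longrightarrow> \<not> pos_cone (h - g)"
  using pos_cone_add[of "g - h" "h - g"] pos_cone_zero by auto

text \<open>The largest element of \<open>D\<close> in the translation-invariant order given by
  \<open>pos_cone\<close>; on supports it picks out the leading term.\<close>

definition is_top :: "('x \<Rightarrow> int) \<Rightarrow> ('x \<Rightarrow> int) set \<Rightarrow> bool" where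
  "is_top m D \<longleftrightarrow> m \<in> D \<and> (\<forall>d\<in>D. d \<noteq> m \<longrightarrow> pos_cone (m - d))"

lemma ex_top:
  assumes "finite D" "D \<noteq> {}" "D \<subseteq> free_ab XS"
  shows "\<exists>m. is_top m D"
  using assms
proof (induction D rule: finite_ne_induct)
  case (singleton x)
  then show ?case by (auto simp: is_top_def)
next
  case (insert x F)
  then obtain m where m: "is_top m F" by blast
  have mx: "m \<noteq> x" "m \<in> F" using m insert.hyps by (auto simp: is_top_def)
  then have "m - x \<in> free_ab XS" using insert.prems by (intro free_ab_diff) auto
  then have fin: "finite {v. (m - x) v \<noteq> 0}" unfolding free_ab_iff by blast
  have "m - x \<noteq> 0" using mx(1) by simp
  then have "pos_cone (m - x) \<or> pos_cone (- (m - x))" using pos_cone_total[OF fin] by blast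
  then show ?case
  proof
    assume "pos_cone (m - x)"
    then have "is_top m (insert x F)" using m by (simp add: is_top_def)
    then show ?thesis by blast
  next
    assume p: "pos_cone (- (m - x))"
    then have p: "pos_cone (x - m)" by simp
    have "pos_cone (x - d)" if d: "d \<in> F" for d
    proof (cases "d = m")
      case False
      then have "pos_cone (m - d)" using m d by (auto simp: is_top_def)
      then have "pos_cone ((x - m) + (m - d))" by (rule pos_cone_add[OF p])
      then show ?thesis by simp
    qed (use p in simp)
    then have "is_top x (insert x F)" by (simp add: is_top_def)
    then show ?thesis by blast
  qed
qed

section \<open>Polynomial growth of sumsets\<close>

lemma ex_power_less_exp: "\<exists>k. (k + 1) ^ n < (2 :: nat) ^ k"
proof -
  have sq: "(m + 5) ^ 2 < (2 :: nat) ^ (m + 5)" for m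
  proof (induction m)
    case (Suc m)
    have "(Suc m + 5) ^ 2 \<le> 2 * (m + 5) ^ 2" by (simp add: power2_eq_square algebra_simps)
    also have "\<dots> < 2 * 2 ^ (m + 5)" using Suc by simp
    also have "2 * 2 ^ (m + 5) = (2 :: nat) ^ (Suc m + 5)" by (simp add: eval_nat_numeral)
    finally show ?case .
  qed simp
  \<comment> \<open>The witness is \<open>k = 2 ^ ?m - 1\<close>: then \<open>(k + 1) ^ n\<close> is
    a power of two and only the exponents \<open>n * ?m\<close> and \<open>2 ^ ?m - 1\<close> are
    compared. The shift by 5 is there because squares stay strictly below powers of two from 5
    on.\<close>
  let ?m = "n + 5"
  have "n * ?m + 1 \<le> ?m ^ 2" by (simp add: power2_eq_square algebra_simps)
  then have lt: "n * ?m < 2 ^ ?m - 1" using sq[of n] by linarith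
  have "((2 ^ ?m - 1) + 1) ^ n = (2 :: nat) ^ (n * ?m)"
    by (simp add: power_mult[symmetric] mult.commute)
  also have "\<dots> < 2 ^ (2 ^ ?m - 1)" using lt by simp
  finally show ?thesis by blast
qed

text \<open>The \<open>k\<close>-fold sumsets of \<open>D\<close> grow polynomially in \<open>k\<close>, so their size cannot double at every step.\<close>

lemma ex_small_doubling:
  fixes D :: "('x \<Rightarrow> int) set"
  assumes D: "finite D" "D \<subseteq> \<Gamma>" and \<Gamma>: "submonoid_G XS \<Gamma>"
  shows "\<exists>P. finite P \<and> P \<noteq> {} \<and> P \<subseteq> \<Gamma> \<and> card ((\<lambda>(p, d). p + d) ` (P \<times> D)) < 2 * card P"
proof (rule ccontr)
  assume "\<not> ?thesis"
  \<comment> \<open>Negating the claim makes every nonempty finite set of terms at least double when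
    \<open>D\<close> is added, so the iterated sumsets \<open>P k\<close> have at least
    \<open>2 ^ k\<close> elements.\<close>
  then have dbl: "2 * card P \<le> card ((\<lambda>(p, d). p + d) ` (P \<times> D))" if "finite P" "P \<noteq> {}" "P \<subseteq> \<Gamma>" for P
    using that not_less by blast
  define P where "P k = ((\<lambda>P. (\<lambda>(p, d). p + d) ` (P \<times> D)) ^^ k) {0}" for k
  have P0: "P 0 = {0}" and PS: "P (Suc k) = (\<lambda>(p, d). p + d) ` (P k \<times> D)" for k
    by (simp_all add: P_def)
  have P: "finite (P k) \<and> P k \<subseteq> \<Gamma> \<and> 2 ^ k \<le> card (P k)" for k
  proof (induction k)
    case 0
    then show ?case using submonoid_zero[OF \<Gamma>] by (simp add: P0)
  next
    case (Suc k)
    then have "P k \<noteq> {}" by auto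
    then have "2 * card (P k) \<le> card (P (Suc k))" unfolding PS using dbl Suc by blast
    moreover have "finite (P (Suc k))" unfolding PS using Suc D by blast
    moreover have "P (Suc k) \<subseteq> \<Gamma>"
    proof
      fix g assume "g \<in> P (Suc k)"
      then obtain p d where "p \<in> P k" "d \<in> D" "g = p + d" unfolding PS by auto
      then show "g \<in> \<Gamma>" using Suc D(2) submonoid_add[OF \<Gamma>, of p d] by auto
    qed
    ultimately show ?case using Suc by simp
  qed
  define t :: "('x \<Rightarrow> int) \<Rightarrow> nat \<Rightarrow> 'x \<Rightarrow> int" where "t d n = (\<lambda>x. int n * d x)" for d n
  have tS: "t d (Suc n) = t d n + d" for d n by (simp add: t_def fun_eq_iff algebra_simps)
  \<comment> \<open>In an abelian group a \<open>k\<close>-fold sum depends only on how often each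
    \<open>d\<close> occurs. The multiplicities lie between 0 and \<open>k\<close>, which leaves at
    most \<open>(k + 1) ^ card D\<close> sums.\<close>
  have sub: "P k \<subseteq> (\<lambda>c. \<Sum>d\<in>D. t d (c d)) ` (D \<rightarrow>\<^sub>E {0..k})" for k
  proof (induction k)
    case 0
    have "(\<Sum>d\<in>D. t d ((\<lambda>d\<in>D. 0) d)) = 0"
      by (rule sum.neutral) (auto simp: t_def fun_eq_iff)
    moreover have "(\<lambda>d\<in>D. 0) \<in> D \<rightarrow>\<^sub>E {0..0::nat}" by auto
    ultimately have "0 \<in> (\<lambda>c. \<Sum>d\<in>D. t d (c d)) ` (D \<rightarrow>\<^sub>E {0..0})" by (intro image_eqI[OF sym])
    then show ?case unfolding P0 by (intro insert_subsetI empty_subsetI)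
  next
    case (Suc k)
    show ?case
    proof
      fix g assume "g \<in> P (Suc k)"
      then obtain p e where pe: "p \<in> P k" "e \<in> D" "g = p + e" unfolding PS by auto
      then obtain c where c: "c \<in> D \<rightarrow>\<^sub>E {0..k}" "p = (\<Sum>d\<in>D. t d (c d))" using Suc by blast
      let ?c = "c(e := Suc (c e))"
      have ck: "c d \<le> k" if "d \<in> D" for d using PiE_mem[OF c(1) that] by simp
      have ce: "?c d \<in> {0..Suc k}" if "d \<in> D" for d
        using ck[OF that] by (cases "d = e") auto
      have cu: "?c d = undefined" if "d \<notin> D" for d
        using PiE_arb[OF c(1) that] that pe(2) by auto
      have "(\<Sum>d\<in>D. t d (?c d)) = t e (Suc (c e)) + (\<Sum>d\<in>D - {e}. t d (?c d))"
        using sum.remove[OF D(1) pe(2), of "\<lambda>d. t d (?c d)"] by simp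
      also have "(\<Sum>d\<in>D - {e}. t d (?c d)) = (\<Sum>d\<in>D - {e}. t d (c d))"
        by (rule sum.cong) auto
      also have "t e (Suc (c e)) + \<dots> = (t e (c e) + (\<Sum>d\<in>D - {e}. t d (c d))) + e"
        by (simp only: tS ac_simps)
      also have "t e (c e) + (\<Sum>d\<in>D - {e}. t d (c d)) = p"
        using sum.remove[OF D(1) pe(2), of "\<lambda>d. t d (c d)"] c(2) by simp
      finally have "g = (\<Sum>d\<in>D. t d (?c d))" unfolding pe(3) by (rule sym)
      moreover have "?c \<in> D \<rightarrow>\<^sub>E {0..Suc k}" by (rule PiE_I[OF ce cu])
      ultimately show "g \<in> (\<lambda>c. \<Sum>d\<in>D. t d (c d)) ` (D \<rightarrow>\<^sub>E {0..Suc k})" by (rule image_eqI)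
    qed
  qed
  have "2 ^ k \<le> (k + 1) ^ card D" for k
  proof -
    have fin: "finite (D \<rightarrow>\<^sub>E {0..k})" using D(1) by (intro finite_PiE) auto
    have "2 ^ k \<le> card (P k)" using P by blast
    also have "\<dots> \<le> card ((\<lambda>c. \<Sum>d\<in>D. t d (c d)) ` (D \<rightarrow>\<^sub>E {0..k}))"
      by (rule card_mono[OF finite_imageI[OF fin] sub])
    also have "\<dots> \<le> card (D \<rightarrow>\<^sub>E {0..k})" by (rule card_image_le[OF fin])
    also have "\<dots> = (k + 1) ^ card D" using D(1) by (simp add: card_PiE)
    finally show ?thesis .
  qed
  moreover obtain k where "(k + 1) ^ card D < (2 :: nat) ^ k" using ex_power_less_exp by blast
  ultimately show False using not_less by blast
qed

section \<open>Extended left ideals and the singular ideal\<close>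

context skew
begin

text \<open>A product of terms equal to \<open>m + n\<close> whose second factor lies strictly below
  \<open>n\<close> has its first factor strictly above \<open>m\<close>. Only terms of
  \<open>f\<close> that do not kill \<open>h\<close> are required to lie below \<open>m\<close>, so
  \<open>m\<close> need not be the leading term of \<open>f\<close>;
  \<open>annihilator_termwise\<close> relies on this.\<close>

lemma coeff_at_top:
  assumes f: "f \<in> carrier (S G)" and h: "h \<in> carrier (S G)"
    and m: "f m \<noteq> \<zero>" and n: "is_top n {g. h g \<noteq> \<zero>}"
    and top: "\<And>g k. f g \<otimes> \<beta> g (h k) \<noteq> \<zero> \<Longrightarrow> g \<in> G \<Longrightarrow> g \<noteq> m \<Longrightarrow> pos_cone (m - g)"
  shows "(f \<star> h) (m + n) = f m \<otimes> \<beta> m (h n)"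
proof -
  note fc = coeff_closed[OF f] and hc = coeff_closed[OF h]
  let ?F = "{g. f g \<noteq> \<zero>}"
  have mG: "m \<in> G" using m supp_in[OF f] by simp
  have "(f \<star> h) (m + n) = (\<Oplus>g\<in>?F. f g \<otimes> \<beta> g (h (m + n - g)))"
    by (rule sm_eq[OF f h supp_finite[OF f] subset_refl supp_subset[OF f]])
  also have "\<dots> = (\<Oplus>g\<in>?F. if m = g then f g \<otimes> \<beta> g (h n) else \<zero>)"
  proof (rule finsum_cong'[OF refl])
    show "(\<lambda>g. if m = g then f g \<otimes> \<beta> g (h n) else \<zero>) \<in> ?F \<rightarrow> carrier R"
      using mG fc hc by auto
    fix g assume g: "g \<in> ?F"
    then have gG: "g \<in> G" using supp_in[OF f] by simp
    show "f g \<otimes> \<beta> g (h (m + n - g)) = (if m = g then f g \<otimes> \<beta> g (h n) else \<zero>)"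
    proof (cases "m = g")
      case True
      have "m + n - m = n" by simp
      then show ?thesis using True by metis
    next
      case False
      have "f g \<otimes> \<beta> g (h (m + n - g)) = \<zero>"
      proof (rule ccontr)
        assume nz: "f g \<otimes> \<beta> g (h (m + n - g)) \<noteq> \<zero>"
        have "h (m + n - g) \<noteq> \<zero>"
        proof
          assume e: "h (m + n - g) = \<zero>"
          show False using nz fc[of g] gG unfolding e by simp
        qed
        moreover have "m + n - g \<noteq> n"
          using False by (metis add.commute add_diff_cancel_left' add_left_cancel diff_add_cancel)
        ultimately have "pos_cone (n - (m + n - g))" using n unfolding is_top_def by blast
        moreover have "n - (m + n - g) = g - m" by simp
        ultimately have "pos_cone (g - m)" by metis
        moreover have "pos_cone (m - g)" using top[OF nz gG] False by metis
        ultimately show False using pos_cone_asym by blast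
      qed
      then show ?thesis using False by metis
    qed
  qed
  also have "\<dots> = f m \<otimes> \<beta> m (h n)"
    by (rule add.finprod_singleton) (use m supp_finite[OF f] supp_in[OF f] fc hc in auto)
  finally show ?thesis .
qed

lemma top_coeff:
  assumes f: "f \<in> carrier (S G)" and h: "h \<in> carrier (S G)"
    and m: "is_top m {g. f g \<noteq> \<zero>}" and n: "is_top n {g. h g \<noteq> \<zero>}"
  shows "(f \<star> h) (m + n) = f m \<otimes> \<beta> m (h n)"
proof (rule coeff_at_top[OF f h _ n])
  show "f m \<noteq> \<zero>" using m by (simp add: is_top_def)
  fix g k assume nz: "f g \<otimes> \<beta> g (h k) \<noteq> \<zero>" and g: "g \<in> G" "g \<noteq> m"
  have "f g \<noteq> \<zero>"
  proof
    assume e: "f g = \<zero>"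
    show False using nz coeff_closed[OF h] g(1) unfolding e by simp
  qed
  then show "pos_cone (m - g)" using m g(2) by (simp add: is_top_def)
qed

lemma ex_top_supp:
  assumes "f \<in> carrier (S G)" "f \<noteq> (\<lambda>g. \<zero>)"
  shows "\<exists>m. is_top m {g. f g \<noteq> \<zero>}"
proof (rule ex_top[OF supp_finite[OF assms(1)] _ supp_subset[OF assms(1)]])
  show "{g. f g \<noteq> \<zero>} \<noteq> {}" using assms(2) by auto
qed

text \<open>\<open>\<beta> g\<close> is a ring automorphism and so permutes the left ideals of
  \<open>R\<close>. Essentiality and uniformity pass to the twisted copies for the same
  reason.\<close>

lemma left_ideal_\<beta>:
  assumes I: "left_ideal I R" and g: "g \<in> G"
  shows "left_ideal (\<beta> g ` I) R"
proof (rule left_idealI)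
  note c = left_ideal_carrier[OF I]
  show "\<beta> g ` I \<subseteq> carrier R" using c g by auto
  show "\<zero> \<in> \<beta> g ` I" using left_ideal_zero[OF I] g by (metis \<beta>_zero image_eqI)
  show "x \<oplus> y \<in> \<beta> g ` I" if xy: "x \<in> \<beta> g ` I" "y \<in> \<beta> g ` I" for x y
  proof -
    obtain u v where "u \<in> I" "v \<in> I" "x = \<beta> g u" "y = \<beta> g v" using xy by blast
    then have "x \<oplus> y = \<beta> g (u \<oplus> v)" "u \<oplus> v \<in> I" using left_ideal_add[OF I] \<beta>_add[OF g] c by auto
    then show ?thesis by (rule image_eqI)
  qed
  fix a x assume a: "a \<in> carrier R" and "x \<in> \<beta> g ` I"
  then obtain u where u: "u \<in> I" "x = \<beta> g u" by blast
  have "a \<otimes> x = \<beta> g (\<beta> (- g) a \<otimes> u)" using a u g c by (simp add: \<beta>_mult)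
  moreover have "\<beta> (- g) a \<otimes> u \<in> I" using left_ideal_mult[OF I] u a g by simp
  ultimately show "a \<otimes> x \<in> \<beta> g ` I" by (rule image_eqI)
qed

lemma essential_left_ideal_\<beta>:
  assumes L: "essential_left_ideal L R" and g: "g \<in> G"
  shows "essential_left_ideal (\<beta> g ` L) R"
proof (rule essential_left_idealI[OF left_ideal_\<beta>[OF essential_left_idealD[OF L] g]])
  fix a assume a: "a \<in> carrier R" "a \<noteq> \<zero>"
  then have "\<beta> (- g) a \<in> carrier R" "\<beta> (- g) a \<noteq> \<zero>" using g by auto
  then obtain b where b: "b \<in> carrier R" "b \<otimes> \<beta> (- g) a \<in> L" "b \<otimes> \<beta> (- g) a \<noteq> \<zero>"
    using essential_left_ideal_multiple[OF L] by blast
  have "\<beta> g b \<otimes> a = \<beta> g (b \<otimes> \<beta> (- g) a)" using a b g by (simp add: \<beta>_mult)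
  then have "\<beta> g b \<otimes> a \<in> \<beta> g ` L" "\<beta> g b \<otimes> a \<noteq> \<zero>" using a b g by auto
  then show "\<exists>b\<in>carrier R. b \<otimes> a \<in> \<beta> g ` L \<and> b \<otimes> a \<noteq> \<zero>"
    using \<beta>_closed[OF g b(1)] by blast
qed

lemma uniform_left_ideal_\<beta>:
  assumes U: "uniform_left_ideal U R" and g: "g \<in> G"
  shows "uniform_left_ideal (\<beta> g ` U) R"
proof (rule uniform_left_idealI)
  note UI = uniform_left_idealD[OF U]
  note c = left_ideal_carrier[OF UI]
  show "left_ideal (\<beta> g ` U) R" by (rule left_ideal_\<beta>[OF UI g])
  obtain x where "x \<in> U" "x \<noteq> \<zero>" using nonzero_ex[OF UI] U by (auto simp: uniform_left_ideal_def)
  then have "\<beta> g x \<in> \<beta> g ` U" "\<beta> g x \<noteq> \<zero>" using c g by auto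
  then show "\<beta> g ` U \<noteq> {\<zero>}" by blast
  fix a b assume ab: "a \<in> \<beta> g ` U" "b \<in> \<beta> g ` U" "a \<noteq> \<zero>" "b \<noteq> \<zero>"
  then obtain u v where u: "u \<in> U" "a = \<beta> g u" and v: "v \<in> U" "b = \<beta> g v" by blast
  then have "u \<noteq> \<zero>" "v \<noteq> \<zero>" using ab g by auto
  then obtain r s where rs: "r \<in> carrier R" "s \<in> carrier R" "r \<otimes> u = s \<otimes> v" "r \<otimes> u \<noteq> \<zero>"
    using uniform_left_ideal_common_multiple[OF U] u v by blast
  have "\<beta> g r \<otimes> a = \<beta> g (r \<otimes> u)" "\<beta> g s \<otimes> b = \<beta> g (s \<otimes> v)"
    using \<beta>_mult[OF g rs(1) c[OF u(1)]] \<beta>_mult[OF g rs(2) c[OF v(1)]] u(2) v(2) by auto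
  moreover have "r \<otimes> u \<in> carrier R" by (rule m_closed[OF rs(1) c[OF u(1)]])
  ultimately have "\<beta> g r \<otimes> a = \<beta> g s \<otimes> b" "\<beta> g r \<otimes> a \<noteq> \<zero>"
    using rs(3,4) \<beta>_eq_zero_iff[OF g, of "r \<otimes> u"] by metis+
  then show "\<exists>r\<in>carrier R. \<exists>s\<in>carrier R. r \<otimes> a = s \<otimes> b \<and> r \<otimes> a \<noteq> \<zero>"
    using \<beta>_closed[OF g rs(1)] \<beta>_closed[OF g rs(2)] by blast
qed

text \<open>The left ideal generated by \<open>L\<close>: since \<open>g l = \<alpha>\<^sub>g(l) g\<close>, its elements are the sums of
  \<open>\<alpha>\<^sub>g(l) g\<close> with \<open>l \<in> L\<close>.\<close>

definition ext :: "('x \<Rightarrow> int) set \<Rightarrow> 'a set \<Rightarrow> (('x \<Rightarrow> int) \<Rightarrow> 'a) set" where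
  "ext \<Gamma> L = {f \<in> carrier (S \<Gamma>). \<forall>g\<in>\<Gamma>. \<beta> (- g) (f g) \<in> L}"

lemma mon0_sm: "r \<in> carrier R \<Longrightarrow> f \<in> carrier (S G) \<Longrightarrow> (mon r 0 \<star> f) k = r \<otimes> f k"
  by (simp add: mon_sm coeff_closed)

context
  fixes \<Gamma> assumes \<Gamma>: "submonoid_G XS \<Gamma>"
begin

lemma \<Gamma>_G: "g \<in> \<Gamma> \<Longrightarrow> g \<in> G"
  using submonoid_subset[OF \<Gamma>] by blast

lemma \<Gamma>_up: "f \<in> carrier (S \<Gamma>) \<Longrightarrow> f \<in> carrier (S G)"
  using skew_carrier_mono[OF submonoid_subset[OF \<Gamma>]] .

lemma left_ideal_ext:
  assumes L: "left_ideal L R"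
  shows "left_ideal (ext \<Gamma> L) (S \<Gamma>)"
proof -
  interpret A: ring "S \<Gamma>" using skew_is_ring[OF \<Gamma>] .
  show ?thesis
  proof (rule A.left_idealI)
    show "ext \<Gamma> L \<subseteq> carrier (S \<Gamma>)" by (auto simp: ext_def)
    show "\<zero>\<^bsub>S \<Gamma>\<^esub> \<in> ext \<Gamma> L"
      using zero_skew_closed \<Gamma>_G left_ideal_zero[OF L] by (simp add: ext_def)
    show "x \<oplus>\<^bsub>S \<Gamma>\<^esub> y \<in> ext \<Gamma> L" if x: "x \<in> ext \<Gamma> L" and y: "y \<in> ext \<Gamma> L" for x y
    proof -
      have c: "x \<in> carrier (S \<Gamma>)" "y \<in> carrier (S \<Gamma>)" using x y by (auto simp: ext_def)
      have "\<beta> (- g) (x g \<oplus> y g) \<in> L" if g: "g \<in> \<Gamma>" for g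
        using x y g left_ideal_add[OF L] \<beta>_add[of "- g" "x g" "y g"] \<Gamma>_G[OF g]
          coeff_closed[OF c(1)] coeff_closed[OF c(2)] by (simp add: ext_def)
      then show ?thesis using skew_add_closed[OF c] by (simp add: ext_def)
    qed
    fix a f assume a: "a \<in> carrier (S \<Gamma>)" and "f \<in> ext \<Gamma> L"
    then have f: "f \<in> carrier (S \<Gamma>)" and fL: "\<And>g. g \<in> \<Gamma> \<Longrightarrow> \<beta> (- g) (f g) \<in> L" by (auto simp: ext_def)
    note c = coeff_closed[OF a] coeff_closed[OF f]
    let ?F = "{g. a g \<noteq> \<zero>}"
    have "\<beta> (- k) ((a \<star> f) k) \<in> L" if k: "k \<in> \<Gamma>" for k
    proof -
      have kG: "- k \<in> G" using \<Gamma>_G[OF k] by simp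
      have "(a \<star> f) k = (\<Oplus>g\<in>?F. a g \<otimes> \<beta> g (f (k - g)))"
        by (rule sm_eq[OF \<Gamma>_up[OF a] \<Gamma>_up[OF f] supp_finite[OF a] subset_refl supp_subset[OF \<Gamma>_up[OF a]]])
      then have "\<beta> (- k) ((a \<star> f) k) = (\<Oplus>g\<in>?F. \<beta> (- k) (a g \<otimes> \<beta> g (f (k - g))))"
        using \<beta>_finsum[OF kG, of ?F "\<lambda>g. a g \<otimes> \<beta> g (f (k - g))"] c supp_in[OF \<Gamma>_up[OF a]] by simp
      also have "\<dots> \<in> L"
      proof (rule left_ideal_finsum[OF L])
        fix g assume "g \<in> ?F"
        then have gG: "g \<in> G" using supp_in[OF \<Gamma>_up[OF a]] by simp
        \<comment> \<open>Twisting back by \<open>- k\<close> turns the second factor into the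
          coefficient of \<open>f\<close> at \<open>k - g\<close> twisted back by exactly
          \<open>k - g\<close>, which is what membership in \<open>ext\<close> controls.\<close>
        have eq: "\<beta> (- k) (a g \<otimes> \<beta> g (f (k - g))) = \<beta> (- k) (a g) \<otimes> \<beta> (- k + g) (f (k - g))"
          using c gG kG by (simp add: \<beta>_mult \<beta>_comp)
        have "\<beta> (- k + g) (f (k - g)) \<in> L"
        proof (cases "k - g \<in> \<Gamma>")
          case True
          moreover have "- k + g = - (k - g)" by simp
          ultimately show ?thesis using fL by metis
        next
          case False
          then have z: "f (k - g) = \<zero>" using supp_in[OF f] by blast
          have "\<beta> (- k + g) \<zero> = \<zero>" using gG kG by (intro \<beta>_zero free_ab_add)
          then show ?thesis using left_ideal_zero[OF L] unfolding z by simp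
        qed
        then show "\<beta> (- k) (a g \<otimes> \<beta> g (f (k - g))) \<in> L"
          unfolding eq using left_ideal_mult[OF L] c kG by simp
      qed
      finally show ?thesis .
    qed
    then show "a \<otimes>\<^bsub>S \<Gamma>\<^esub> f \<in> ext \<Gamma> L" using sm_closed[OF \<Gamma> a f] by (simp add: ext_def)
  qed
qed

lemma mon_ext: "left_ideal L R \<Longrightarrow> u \<in> L \<Longrightarrow> mon u 0 \<in> ext \<Gamma> L"
proof -
  assume L: "left_ideal L R" and u: "u \<in> L"
  have uc: "u \<in> carrier R" using left_ideal_carrier[OF L u] .
  have "\<beta> (- g) (mon u 0 g) \<in> L" if "g \<in> \<Gamma>" for g
    using \<Gamma>_G[OF that] left_ideal_zero[OF L] u uc by (cases "g = 0") auto
  then show ?thesis using submonoid_zero[OF \<Gamma>] uc by (simp add: ext_def)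
qed

text \<open>Membership in \<open>ext\<close> asks that the coefficient at \<open>g\<close> lie in
  \<open>\<beta> g\<close> applied to \<open>L\<close>, again an essential left ideal. One scalar
  moves the finitely many coefficients into these ideals simultaneously.\<close>

lemma ex_multiple_in_ext:
  assumes L: "essential_left_ideal L R" and f: "f \<in> carrier (S \<Gamma>)" and nz: "f \<noteq> (\<lambda>g. \<zero>)"
  shows "\<exists>r\<in>carrier R. mon r 0 \<star> f \<in> ext \<Gamma> L \<and> mon r 0 \<star> f \<noteq> (\<lambda>g. \<zero>)"
proof -
  let ?F = "{g. f g \<noteq> \<zero>}"
  note LI = essential_left_idealD[OF L]
  have F: "finite ?F" using supp_finite[OF f] .
  have FG: "g \<in> G" if "g \<in> ?F" for g using supp_in[OF \<Gamma>_up[OF f]] that by simp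
  have ex: "\<exists>q\<in>?F. f q \<noteq> \<zero>" using nz by auto
  have "\<exists>b\<in>carrier R. (\<forall>q\<in>?F. b \<otimes> f q \<in> \<beta> q ` L) \<and> (\<exists>q\<in>?F. b \<otimes> f q \<noteq> \<zero>)"
    by (rule ex_multiple_in_essential[OF F essential_left_ideal_\<beta>[OF L FG] coeff_closed[OF f] ex])
  then obtain b where b: "b \<in> carrier R" "\<And>q. q \<in> ?F \<Longrightarrow> b \<otimes> f q \<in> \<beta> q ` L" "\<exists>q. b \<otimes> f q \<noteq> \<zero>" by blast
  have m: "(mon b 0 \<star> f) k = b \<otimes> f k" for k by (rule mon0_sm[OF b(1) \<Gamma>_up[OF f]])
  have mc: "mon b 0 \<star> f \<in> carrier (S \<Gamma>)"
    using sm_closed[OF \<Gamma> _ f] b(1) submonoid_zero[OF \<Gamma>] by simp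
  have "\<beta> (- g) ((mon b 0 \<star> f) g) \<in> L" if g: "g \<in> \<Gamma>" for g
  proof (cases "f g = \<zero>")
    case True
    then show ?thesis using m[of g] b(1) left_ideal_zero[OF LI] \<Gamma>_G[OF g] by simp
  next
    case False
    then obtain u where "u \<in> L" "b \<otimes> f g = \<beta> g u" using b(2) by blast
    then show ?thesis using m[of g] \<Gamma>_G[OF g] left_ideal_carrier[OF LI] by simp
  qed
  then have "mon b 0 \<star> f \<in> ext \<Gamma> L" using mc by (simp add: ext_def)
  moreover have "mon b 0 \<star> f \<noteq> (\<lambda>g. \<zero>)" using b(3) m by metis
  ultimately show ?thesis using b(1) by blast
qed

lemma essential_ext:
  assumes L: "essential_left_ideal L R"
  shows "essential_left_ideal (ext \<Gamma> L) (S \<Gamma>)"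
proof -
  interpret A: ring "S \<Gamma>" using skew_is_ring[OF \<Gamma>] .
  show ?thesis
  proof (rule A.essential_left_idealI[OF left_ideal_ext[OF essential_left_idealD[OF L]]])
    fix f assume f: "f \<in> carrier (S \<Gamma>)" "f \<noteq> \<zero>\<^bsub>S \<Gamma>\<^esub>"
    then have "f \<noteq> (\<lambda>g. \<zero>)" by simp
    then obtain r where "r \<in> carrier R" "mon r 0 \<star> f \<in> ext \<Gamma> L" "mon r 0 \<star> f \<noteq> (\<lambda>g. \<zero>)"
      using ex_multiple_in_ext[OF L f(1)] by blast
    then show "\<exists>b\<in>carrier (S \<Gamma>). b \<otimes>\<^bsub>S \<Gamma>\<^esub> f \<in> ext \<Gamma> L \<and> b \<otimes>\<^bsub>S \<Gamma>\<^esub> f \<noteq> \<zero>\<^bsub>S \<Gamma>\<^esub>"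
      using submonoid_zero[OF \<Gamma>] by (intro bexI[of _ "mon r 0"]) auto
  qed
qed

section \<open>The singular ideal, coefficient by coefficient\<close>

lemma coeff_in_singular_ideal:
  assumes f: "f \<in> carrier (S \<Gamma>)" and Z: "\<And>g. f g \<in> singular_ideal R"
  shows "f \<in> singular_ideal (S \<Gamma>)"
proof -
  note c = coeff_closed[OF f]
  \<comment> \<open>The extra element 0 keeps the index set nonempty, so that
    \<open>ex_multiple_in_essential\<close> also applies when \<open>f\<close> is zero.\<close>
  let ?F = "insert 0 {g. f g \<noteq> \<zero>}"
  have F: "finite ?F" using supp_finite[OF f] by simp
  \<comment> \<open>The common left annihilator of the finitely many coefficients. It is essential
    because each \<open>K g\<close> is, and its extension \<open>ext \<Gamma> L\<close> is an
    essential left ideal annihilating \<open>f\<close>.\<close>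
  define L where "L = {l \<in> carrier R. \<forall>g\<in>?F. l \<otimes> f g = \<zero>}"
  have "\<exists>K. essential_left_ideal K R \<and> (\<forall>l\<in>K. l \<otimes> f g = \<zero>)" for g
    using Z[of g] by (simp add: singular_ideal_def)
  then obtain K where K: "\<And>g. essential_left_ideal (K g) R" "\<And>g l. l \<in> K g \<Longrightarrow> l \<otimes> f g = \<zero>" by metis
  have "essential_left_ideal L R"
  proof (rule essential_left_idealI)
    show "left_ideal L R"
      by (rule left_idealI) (use c in \<open>auto simp: L_def l_distr m_assoc\<close>)
    fix a assume a: "a \<in> carrier R" "a \<noteq> \<zero>"
    have "\<exists>b\<in>carrier R. (\<forall>q\<in>?F. b \<otimes> a \<in> K q) \<and> (\<exists>q\<in>?F. b \<otimes> a \<noteq> \<zero>)"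
      by (rule ex_multiple_in_essential[OF F K(1), of "\<lambda>_. a"]) (use a in auto)
    then obtain b where b: "b \<in> carrier R" "\<And>q. q \<in> ?F \<Longrightarrow> b \<otimes> a \<in> K q" "b \<otimes> a \<noteq> \<zero>" by blast
    have "b \<otimes> a \<in> L" unfolding L_def using K(2)[OF b(2)] a b(1) by simp
    then show "\<exists>b\<in>carrier R. b \<otimes> a \<in> L \<and> b \<otimes> a \<noteq> \<zero>" using b by blast
  qed
  then have ess: "essential_left_ideal (ext \<Gamma> L) (S \<Gamma>)" by (rule essential_ext)
  have "p \<star> f = (\<lambda>g. \<zero>)" if p: "p \<in> ext \<Gamma> L" for p
  proof
    fix k
    have pc: "p \<in> carrier (S \<Gamma>)" and pL: "\<And>g. g \<in> \<Gamma> \<Longrightarrow> \<beta> (- g) (p g) \<in> L" using p by (auto simp: ext_def)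
    have "(p \<star> f) k = (\<Oplus>g\<in>{g. p g \<noteq> \<zero>}. p g \<otimes> \<beta> g (f (k - g)))"
      by (rule sm_eq[OF \<Gamma>_up[OF pc] \<Gamma>_up[OF f] supp_finite[OF pc] subset_refl supp_subset[OF \<Gamma>_up[OF pc]]])
    also have "\<dots> = (\<Oplus>g\<in>{g. p g \<noteq> \<zero>}. \<zero>)"
    proof (rule finsum_cong'[OF refl])
      fix g assume "g \<in> {g. p g \<noteq> \<zero>}"
      then have g: "g \<in> \<Gamma>" "g \<in> G" using supp_in[OF pc] \<Gamma>_G by auto
      \<comment> \<open>Pulling \<open>\<beta> g\<close> out exposes the twisted coefficient of
        \<open>p\<close>, an element of \<open>L\<close>, in front of an untwisted coefficient of
        \<open>f\<close>.\<close>
      have "p g \<otimes> \<beta> g (f (k - g)) = \<beta> g (\<beta> (- g) (p g) \<otimes> f (k - g))"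
        using g c coeff_closed[OF pc] by (simp add: \<beta>_mult)
      also have "\<beta> (- g) (p g) \<otimes> f (k - g) = \<zero>"
        using pL[OF g(1)] unfolding L_def by (cases "f (k - g) = \<zero>") auto
      finally show "p g \<otimes> \<beta> g (f (k - g)) = \<zero>" unfolding \<beta>_zero[OF g(2)] .
    qed auto
    finally show "(p \<star> f) k = \<zero>" by simp
  qed
  then show ?thesis using ess f unfolding singular_ideal_def by auto
qed

text \<open>The annihilator of \<open>f m\<close> is shown to be essential. For nonzero
  \<open>b\<close> in \<open>R\<close>, the essential ideal \<open>K\<close> contains a nonzero
  multiple \<open>h b\<close>; its leading coefficient \<open>h n \<beta> n b\<close> annihilates
  the twisted \<open>f m\<close>, and twisting back by \<open>- n\<close> gives a nonzero multiple
  of \<open>b\<close> that kills \<open>f m\<close>.\<close>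

lemma singular_ideal_top_coeff:
  assumes f: "f \<in> singular_ideal (S \<Gamma>)" and m: "is_top m {g. f g \<noteq> \<zero>}"
  shows "f m \<in> singular_ideal R"
proof -
  interpret A: ring "S \<Gamma>" using skew_is_ring[OF \<Gamma>] .
  obtain K where fc: "f \<in> carrier (S \<Gamma>)" and K: "essential_left_ideal K (S \<Gamma>)" "\<And>l. l \<in> K \<Longrightarrow> l \<star> f = (\<lambda>g. \<zero>)"
    using f by (auto simp: singular_ideal_def)
  have fm: "f m \<in> carrier R" using coeff_closed[OF fc] .
  let ?L = "{l \<in> carrier R. l \<otimes> f m = \<zero>}"
  have "essential_left_ideal ?L R"
  proof (rule essential_left_idealI)
    show "left_ideal ?L R"
      by (rule left_idealI) (use fm in \<open>auto simp: l_distr m_assoc\<close>)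
    fix b assume b: "b \<in> carrier R" "b \<noteq> \<zero>"
    have bc: "mon b 0 \<in> carrier (S \<Gamma>)" using b(1) submonoid_zero[OF \<Gamma>] by simp
    have "mon b 0 \<noteq> \<zero>\<^bsub>S \<Gamma>\<^esub>" using b(2) by (metis mon_apply(1) skew_zero)
    then obtain h where h: "h \<in> carrier (S \<Gamma>)" "h \<star> mon b 0 \<in> K" "h \<star> mon b 0 \<noteq> (\<lambda>g. \<zero>)"
      using A.essential_left_ideal_multiple[OF K(1) bc] by auto
    have hb: "h \<star> mon b 0 \<in> carrier (S G)" using sm_closed_G[OF \<Gamma>_up[OF h(1)] \<Gamma>_up[OF bc]] .
    obtain n where n: "is_top n {g. (h \<star> mon b 0) g \<noteq> \<zero>}" using ex_top_supp[OF hb h(3)] by blast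
    then have nz: "(h \<star> mon b 0) n \<noteq> \<zero>" by (simp add: is_top_def)
    then have nG: "n \<in> G" using supp_in[OF hb] by blast
    have hn: "(h \<star> mon b 0) n = h n \<otimes> \<beta> n b" using sm_mon[OF \<Gamma>_up[OF h(1)] b(1), of 0 n] nG by simp
    have hc: "h n \<in> carrier R" using coeff_closed[OF h(1)] .
    have "(h \<star> mon b 0) n \<otimes> \<beta> n (f m) = ((h \<star> mon b 0) \<star> f) (n + m)"
      using top_coeff[OF hb \<Gamma>_up[OF fc] n m] by simp
    then have "h n \<otimes> \<beta> n b \<otimes> \<beta> n (f m) = \<zero>" using K(2)[OF h(2)] hn by simp
    moreover have "\<beta> (- n) (h n \<otimes> \<beta> n b \<otimes> \<beta> n (f m)) = \<beta> (- n) (h n) \<otimes> b \<otimes> f m"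
      using nG hc b fm by (simp add: \<beta>_mult)
    ultimately have z: "\<beta> (- n) (h n) \<otimes> b \<otimes> f m = \<zero>" using nG by simp
    have "\<beta> n (\<beta> (- n) (h n) \<otimes> b) = h n \<otimes> \<beta> n b" using nG hc b by (simp add: \<beta>_mult)
    then have "\<beta> (- n) (h n) \<otimes> b \<noteq> \<zero>" using nz hn nG by auto
    then show "\<exists>a\<in>carrier R. a \<otimes> b \<in> ?L \<and> a \<otimes> b \<noteq> \<zero>"
      using z nG hc b by (intro bexI[of _ "\<beta> (- n) (h n)"]) auto
  qed
  then show ?thesis using fm unfolding singular_ideal_def by auto
qed

lemma singular_ideal_minus:
  assumes "f \<in> singular_ideal (S \<Gamma>)" "h \<in> singular_ideal (S \<Gamma>)"
  shows "(\<lambda>g. f g \<ominus> h g) \<in> singular_ideal (S \<Gamma>)"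
proof -
  interpret A: ring "S \<Gamma>" using skew_is_ring[OF \<Gamma>] .
  obtain K L where f: "f \<in> carrier (S \<Gamma>)" and K: "essential_left_ideal K (S \<Gamma>)" "\<And>l. l \<in> K \<Longrightarrow> l \<otimes>\<^bsub>S \<Gamma>\<^esub> f = \<zero>\<^bsub>S \<Gamma>\<^esub>"
    and h: "h \<in> carrier (S \<Gamma>)" and L: "essential_left_ideal L (S \<Gamma>)" "\<And>l. l \<in> L \<Longrightarrow> l \<otimes>\<^bsub>S \<Gamma>\<^esub> h = \<zero>\<^bsub>S \<Gamma>\<^esub>"
    using assms unfolding singular_ideal_def by blast
  note KI = essential_left_idealD[OF K(1)] and LI = essential_left_idealD[OF L(1)]
  have ess: "essential_left_ideal (K \<inter> L) (S \<Gamma>)"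
    unfolding essential_left_ideal_def
  proof (intro conjI allI impI)
    show "left_ideal (K \<inter> L) (S \<Gamma>)" by (rule A.left_ideal_Int[OF KI LI])
    fix I assume I: "left_ideal I (S \<Gamma>) \<and> I \<noteq> {\<zero>\<^bsub>S \<Gamma>\<^esub>}"
    then have "L \<inter> I \<noteq> {\<zero>\<^bsub>S \<Gamma>\<^esub>}" "left_ideal (L \<inter> I) (S \<Gamma>)"
      using L(1) A.left_ideal_Int[OF LI] by (auto simp: essential_left_ideal_def)
    then have "K \<inter> (L \<inter> I) \<noteq> {\<zero>\<^bsub>S \<Gamma>\<^esub>}" using K(1) unfolding essential_left_ideal_def by blast
    then show "K \<inter> L \<inter> I \<noteq> {\<zero>\<^bsub>S \<Gamma>\<^esub>}" by (simp only: Int_assoc not_False_eq_True)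
  qed
  have eq: "(\<lambda>g. f g \<ominus> h g) = f \<ominus>\<^bsub>S \<Gamma>\<^esub> h"
    using skew_minus[OF \<Gamma> h] by (simp add: a_minus_def)
  have z: "l \<otimes>\<^bsub>S \<Gamma>\<^esub> (f \<ominus>\<^bsub>S \<Gamma>\<^esub> h) = \<zero>\<^bsub>S \<Gamma>\<^esub>" if l: "l \<in> K \<inter> L" for l
  proof -
    have lc: "l \<in> carrier (S \<Gamma>)" using A.left_ideal_carrier[OF KI] l by blast
    have "l \<otimes>\<^bsub>S \<Gamma>\<^esub> (f \<ominus>\<^bsub>S \<Gamma>\<^esub> h) = l \<otimes>\<^bsub>S \<Gamma>\<^esub> f \<oplus>\<^bsub>S \<Gamma>\<^esub> \<ominus>\<^bsub>S \<Gamma>\<^esub> (l \<otimes>\<^bsub>S \<Gamma>\<^esub> h)"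
      unfolding a_minus_def using A.r_distr[OF f A.a_inv_closed[OF h] lc] A.r_minus[OF lc h] by metis
    also have "\<dots> = \<zero>\<^bsub>S \<Gamma>\<^esub> \<oplus>\<^bsub>S \<Gamma>\<^esub> \<ominus>\<^bsub>S \<Gamma>\<^esub> \<zero>\<^bsub>S \<Gamma>\<^esub>" using K(2) L(2) l by auto
    also have "\<dots> = \<zero>\<^bsub>S \<Gamma>\<^esub>" using A.r_neg[OF A.zero_closed] .
    finally show ?thesis .
  qed
  have "f \<ominus>\<^bsub>S \<Gamma>\<^esub> h \<in> carrier (S \<Gamma>)" by (rule A.minus_closed[OF f h])
  then show ?thesis unfolding eq singular_ideal_def using ess z by blast
qed

text \<open>For the inclusion from left to right the leading coefficient is singular, hence the
  leading monomial lies in the singular ideal by the other inclusion. Subtracting it shrinks the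
  support, and induction handles the remaining coefficients.\<close>

lemma singular_ideal_skew: "singular_ideal (S \<Gamma>) = coeff_in R \<beta> (singular_ideal R) \<Gamma>"
proof
  show "coeff_in R \<beta> (singular_ideal R) \<Gamma> \<subseteq> singular_ideal (S \<Gamma>)"
    unfolding coeff_in_def using coeff_in_singular_ideal by blast
  have ess: "essential_left_ideal (carrier R) R"
    by (rule essential_left_idealI[OF left_ideal_carrier_self]) (auto intro!: bexI[of _ \<one>])
  then have Z0: "\<zero> \<in> singular_ideal R" unfolding singular_ideal_def by auto
  have "f g \<in> singular_ideal R" if "f \<in> singular_ideal (S \<Gamma>)" for f g
    using that
  proof (induction "card {g. f g \<noteq> \<zero>}" arbitrary: f rule: less_induct)
    case less
    have f: "f \<in> carrier (S \<Gamma>)" using less.prems by (simp add: singular_ideal_def)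
    show ?case
    proof (cases "f = (\<lambda>g. \<zero>)")
      case True
      then show ?thesis using Z0 by simp
    next
      case False
      then obtain m where m: "is_top m {g. f g \<noteq> \<zero>}" using ex_top_supp[OF \<Gamma>_up[OF f]] by blast
      have fm: "f m \<in> singular_ideal R" by (rule singular_ideal_top_coeff[OF less.prems m])
      have m0: "f m \<noteq> \<zero>" using m by (simp add: is_top_def)
      have "mon (f m) m k \<in> singular_ideal R" for k using fm Z0 by (cases "k = m") auto
      moreover have "mon (f m) m \<in> carrier (S \<Gamma>)" using supp_in[OF f m0] coeff_closed[OF f] by simp
      ultimately have "mon (f m) m \<in> singular_ideal (S \<Gamma>)" using coeff_in_singular_ideal by blast
      then have h: "(\<lambda>g. f g \<ominus> mon (f m) m g) \<in> singular_ideal (S \<Gamma>)"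
        by (rule singular_ideal_minus[OF less.prems])
      have hm: "f m \<ominus> mon (f m) m m = \<zero>" and hk: "\<And>k. k \<noteq> m \<Longrightarrow> f k \<ominus> mon (f m) m k = f k"
        using coeff_closed[OF f] by (auto simp: a_minus_def r_neg)
      have sub: "f k \<noteq> \<zero>" if "f k \<ominus> mon (f m) m k \<noteq> \<zero>" for k
        using that hm hk[of k] by (cases "k = m") auto
      have "m \<in> {g. f g \<noteq> \<zero>}" "m \<notin> {g. f g \<ominus> mon (f m) m g \<noteq> \<zero>}" using m0 hm by auto
      then have "{g. f g \<ominus> mon (f m) m g \<noteq> \<zero>} \<subset> {g. f g \<noteq> \<zero>}" using sub by blast
      then have "card {g. f g \<ominus> mon (f m) m g \<noteq> \<zero>} < card {g. f g \<noteq> \<zero>}"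
        by (rule psubset_card_mono[OF supp_finite[OF f]])
      then have "f g \<ominus> mon (f m) m g \<in> singular_ideal R" using less.hyps[OF _ h] by blast
      then show ?thesis using hk[of g] fm by (cases "g = m") auto
    qed
  qed
  moreover have "f \<in> carrier (S \<Gamma>)" if "f \<in> singular_ideal (S \<Gamma>)" for f
    using that unfolding singular_ideal_def by blast
  ultimately show "singular_ideal (S \<Gamma>) \<subseteq> coeff_in R \<beta> (singular_ideal R) \<Gamma>"
    unfolding coeff_in_def by blast
qed

end

end

section \<open>Uniform left ideals of the skew ring\<close>

context ring
begin

definition ideal_sum :: "'i set \<Rightarrow> ('i \<Rightarrow> 'a set) \<Rightarrow> 'a set" where
  "ideal_sum I V = {finsum R f Q | f Q. finite Q \<and> Q \<subseteq> I \<and> (\<forall>i\<in>Q. f i \<in> V i)}"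

lemma ideal_sum_common_index:
  assumes V: "\<And>i. i \<in> I \<Longrightarrow> left_ideal (V i) R"
    and P: "finite P" "P \<subseteq> I" and Q: "Q \<subseteq> P" and f: "\<And>i. i \<in> Q \<Longrightarrow> f i \<in> V i"
  shows "finsum R f Q = (\<Oplus>i\<in>P. if i \<in> Q then f i else \<zero>)" "\<And>i. i \<in> P \<Longrightarrow> (if i \<in> Q then f i else \<zero>) \<in> V i"
proof -
  have c: "f i \<in> carrier R" if "i \<in> Q" for i
    using left_ideal_carrier[OF V f[OF that]] that P Q by blast
  show "finsum R f Q = (\<Oplus>i\<in>P. if i \<in> Q then f i else \<zero>)"
    by (rule add.finprod_mono_neutral_cong_left[OF P(1) Q]) (use c in auto)
  show "(if i \<in> Q then f i else \<zero>) \<in> V i" if "i \<in> P" for i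
    using f left_ideal_zero[OF V] that P by auto
qed

lemma left_ideal_ideal_sum:
  assumes V: "\<And>i. i \<in> I \<Longrightarrow> left_ideal (V i) R"
  shows "left_ideal (ideal_sum I V) R"
proof (rule left_idealI)
  have c: "f i \<in> carrier R" if "Q \<subseteq> I" "\<forall>i\<in>Q. f i \<in> V i" "i \<in> Q" for f i Q
    using left_ideal_carrier[OF V, of i "f i"] that by blast
  show "ideal_sum I V \<subseteq> carrier R"
    using c by (auto simp: ideal_sum_def intro!: finsum_closed)
  have "finsum R (\<lambda>_. \<zero>) {} \<in> ideal_sum I V"
    unfolding ideal_sum_def by (intro CollectI exI[of _ "\<lambda>_. \<zero>"] exI[of _ "{}"]) simp
  then show "\<zero> \<in> ideal_sum I V" by simp
next
  fix x y assume "x \<in> ideal_sum I V" "y \<in> ideal_sum I V"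
  then obtain f P g Q where x: "x = finsum R f P" "finite P" "P \<subseteq> I" "\<forall>i\<in>P. f i \<in> V i"
    and y: "y = finsum R g Q" "finite Q" "Q \<subseteq> I" "\<forall>i\<in>Q. g i \<in> V i" unfolding ideal_sum_def by blast
  let ?f = "\<lambda>i. if i \<in> P then f i else \<zero>" and ?g = "\<lambda>i. if i \<in> Q then g i else \<zero>"
  have PQ: "finite (P \<union> Q)" "P \<union> Q \<subseteq> I" using x y by auto
  note fx = ideal_sum_common_index[of I V "P \<union> Q" P f, OF V PQ] and gy = ideal_sum_common_index[of I V "P \<union> Q" Q g, OF V PQ]
  have fV: "?f i \<in> V i" and gV: "?g i \<in> V i" if "i \<in> P \<union> Q" for i
    using fx(2) gy(2) x y that by blast+
  have VI: "left_ideal (V i) R" if "i \<in> P \<union> Q" for i using V PQ that by blast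
  have "x \<oplus> y = (\<Oplus>i\<in>P \<union> Q. ?f i) \<oplus> (\<Oplus>i\<in>P \<union> Q. ?g i)"
    using fx(1) gy(1) x y by simp
  also have "\<dots> = (\<Oplus>i\<in>P \<union> Q. ?f i \<oplus> ?g i)"
    by (rule finsum_addf[symmetric]) (use left_ideal_carrier[OF VI fV] left_ideal_carrier[OF VI gV] in blast)+
  finally have "x \<oplus> y = (\<Oplus>i\<in>P \<union> Q. ?f i \<oplus> ?g i)" .
  moreover have "\<forall>i\<in>P \<union> Q. ?f i \<oplus> ?g i \<in> V i" using left_ideal_add[OF VI fV gV] by blast
  ultimately show "x \<oplus> y \<in> ideal_sum I V" unfolding ideal_sum_def using PQ by blast
next
  fix a x assume a: "a \<in> carrier R" and "x \<in> ideal_sum I V"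
  then obtain f P where x: "x = finsum R f P" "finite P" "P \<subseteq> I" "\<forall>i\<in>P. f i \<in> V i"
    unfolding ideal_sum_def by blast
  have VI: "left_ideal (V i) R" if "i \<in> P" for i using V x that by blast
  have "a \<otimes> x = (\<Oplus>i\<in>P. a \<otimes> f i)"
    unfolding x(1) by (rule finsum_rdistr) (use x a left_ideal_carrier[OF VI] in auto)
  moreover have "\<forall>i\<in>P. a \<otimes> f i \<in> V i" using left_ideal_mult[OF VI a] x by blast
  ultimately show "a \<otimes> x \<in> ideal_sum I V" unfolding ideal_sum_def using x by blast
qed

lemma uniform_cover_essential:
  assumes "uniform_cover R I V"
  shows "essential_left_ideal (ideal_sum I V) R"
proof (rule essential_left_idealI)
  show "left_ideal (ideal_sum I V) R"
    by (rule left_ideal_ideal_sum[OF indep_on_left_ideal]) (use assms in \<open>auto simp: uniform_cover_def\<close>)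
  fix a assume "a \<in> carrier R" "a \<noteq> \<zero>"
  then obtain b Q f where "b \<in> carrier R" "b \<otimes> a \<noteq> \<zero>" "finite Q" "Q \<subseteq> I" "\<forall>i\<in>Q. f i \<in> V i" "b \<otimes> a = finsum R f Q"
    using assms unfolding uniform_cover_def by blast
  then show "\<exists>b\<in>carrier R. b \<otimes> a \<in> ideal_sum I V \<and> b \<otimes> a \<noteq> \<zero>"
    unfolding ideal_sum_def by blast
qed

end

context skew
begin

text \<open>If every nonzero coefficient of \<open>w\<close> has the same annihilator as \<open>w\<close>, then the leading terms
  cannot cancel in \<open>f w\<close>.\<close>

lemma annihilator_termwise:
  assumes f: "f \<in> carrier (S G)" and w: "w \<in> carrier (S G)" and z: "f \<star> w = (\<lambda>g. \<zero>)"
    and good: "\<And>c g g'. c \<in> carrier R \<Longrightarrow> w g \<noteq> \<zero> \<Longrightarrow> c \<otimes> w g = \<zero> \<Longrightarrow> c \<otimes> w g' = \<zero>"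
    and pG: "p \<in> G"
  shows "f p \<otimes> \<beta> p (w g) = \<zero>"
proof (cases "w = (\<lambda>g. \<zero>)")
  case True
  then show ?thesis using coeff_closed[OF f] pG by simp
next
  case wnz: False
  note fc = coeff_closed[OF f] and wc = coeff_closed[OF w]
  let ?F = "{g. f g \<noteq> \<zero>}"
  \<comment> \<open>The terms of \<open>f\<close> that do not annihilate \<open>w\<close>. Larger
    terms of \<open>f\<close> may exist, but they contribute nothing to \<open>f w\<close>, so the
    largest element of \<open>N\<close> determines a coefficient of the product.\<close>
  define N where "N = {p. \<exists>g. p \<in> G \<and> f p \<otimes> \<beta> p (w g) \<noteq> \<zero>}"
  have NF: "N \<subseteq> ?F" using wc by (auto simp: N_def)
  have NG: "N \<subseteq> G" by (auto simp: N_def)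
  have "N = {}"
  proof (rule ccontr)
    assume "N \<noteq> {}"
    then obtain m where m: "is_top m N" using ex_top[OF finite_subset[OF NF supp_finite[OF f]] _ NG] by blast
    obtain n where n: "is_top n {g. w g \<noteq> \<zero>}" using ex_top_supp[OF w wnz] by blast
    have mN: "m \<in> N" and nw: "w n \<noteq> \<zero>" using m n by (auto simp: is_top_def)
    have mG: "m \<in> G" using mN NG by blast
    have m0: "f m \<noteq> \<zero>" using mN NF by blast
    have "(f \<star> w) (m + n) = f m \<otimes> \<beta> m (w n)"
    proof (rule coeff_at_top[OF f w m0 n])
      fix g k assume nz: "f g \<otimes> \<beta> g (w k) \<noteq> \<zero>" and g: "g \<in> G" "g \<noteq> m"
      then have "g \<in> N" unfolding N_def by blast
      then show "pos_cone (m - g)" using m g(2) by (simp add: is_top_def)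
    qed
    then have "f m \<otimes> \<beta> m (w n) = \<zero>" using z by simp
    moreover have eq: "f m \<otimes> \<beta> m (w g) = \<beta> m (\<beta> (- m) (f m) \<otimes> w g)" for g
      using fc wc mG by (simp add: \<beta>_mult)
    ultimately have "\<beta> (- m) (f m) \<otimes> w n = \<zero>" using fc wc mG by simp
    \<comment> \<open>Killing one nonzero coefficient of \<open>w\<close> means killing all of them,
      so the term \<open>m\<close> annihilates \<open>w\<close> and cannot belong to
      \<open>N\<close>.\<close>
    then have "\<beta> (- m) (f m) \<otimes> w g = \<zero>" for g
      using good[of "\<beta> (- m) (f m)" n g] nw fc mG by simp
    then have "f m \<otimes> \<beta> m (w g) = \<zero>" for g using eq mG by simp
    then show False using mN by (simp add: N_def)
  qed
  then show ?thesis using pG unfolding N_def by blast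
qed

context
  fixes \<Gamma> assumes \<Gamma>: "submonoid_G XS \<Gamma>"
begin

lemma ex_good_multiple:
  assumes f: "f \<in> carrier (S \<Gamma>)" and nz: "f \<noteq> (\<lambda>g. \<zero>)"
  shows "\<exists>b\<in>carrier R. mon b 0 \<star> f \<noteq> (\<lambda>g. \<zero>) \<and>
    (\<forall>c\<in>carrier R. \<forall>g g'. (mon b 0 \<star> f) g \<noteq> \<zero> \<longrightarrow> c \<otimes> (mon b 0 \<star> f) g = \<zero> \<longrightarrow> c \<otimes> (mon b 0 \<star> f) g' = \<zero>)"
proof -
  let ?F = "{g. f g \<noteq> \<zero>}"
  have "\<exists>q\<in>?F. f q \<noteq> \<zero>" using nz by auto
  from ex_multiple_uniform_annihilator[of ?F f, OF supp_finite[OF f] coeff_closed[OF f] this]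
  obtain b where b: "b \<in> carrier R" "\<exists>q\<in>?F. b \<otimes> f q \<noteq> \<zero>"
    and good: "\<forall>c\<in>carrier R. \<forall>q\<in>?F. b \<otimes> f q \<noteq> \<zero> \<longrightarrow> c \<otimes> (b \<otimes> f q) = \<zero> \<longrightarrow> (\<forall>q'\<in>?F. c \<otimes> (b \<otimes> f q') = \<zero>)"
    by (rule bexE) (elim conjE, rule that)
  have m: "(mon b 0 \<star> f) k = b \<otimes> f k" for k by (rule mon0_sm[OF b(1) \<Gamma>_up[OF \<Gamma> f]])
  have z: "c \<otimes> (b \<otimes> f g') = \<zero>" if c: "c \<in> carrier R" "b \<otimes> f g \<noteq> \<zero>" "c \<otimes> (b \<otimes> f g) = \<zero>" for c g g'
  proof (cases "f g' = \<zero>")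
    case True
    then show ?thesis using c b by simp
  next
    case False
    moreover have "f g \<noteq> \<zero>" using c(2) b(1) by auto
    ultimately show ?thesis using good c by blast
  qed
  have nz': "mon b 0 \<star> f \<noteq> (\<lambda>g. \<zero>)" using b(2) m by metis
  show ?thesis
    by (rule bexI[OF _ b(1)], rule conjI[OF nz'], intro ballI allI impI, unfold m, rule z)
qed

text \<open>The translates of \<open>f\<close> and \<open>h\<close> by \<open>P\<close> are rows,
  the terms in \<open>P D\<close> are columns, and the entries in column \<open>q\<close> lie in the
  uniform left ideal \<open>\<beta> q\<close> of \<open>U\<close>. Small doubling leaves fewer
  columns than rows, as \<open>dependent_in_uniform\<close> requires.\<close>

lemma uniform_ext_good:
  assumes U: "uniform_left_ideal U R"
    and f: "f \<in> ext \<Gamma> U" "f \<noteq> (\<lambda>g. \<zero>)" and h: "h \<in> ext \<Gamma> U" "h \<noteq> (\<lambda>g. \<zero>)"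
    and gf: "\<And>c g g'. c \<in> carrier R \<Longrightarrow> f g \<noteq> \<zero> \<Longrightarrow> c \<otimes> f g = \<zero> \<Longrightarrow> c \<otimes> f g' = \<zero>"
    and gh: "\<And>c g g'. c \<in> carrier R \<Longrightarrow> h g \<noteq> \<zero> \<Longrightarrow> c \<otimes> h g = \<zero> \<Longrightarrow> c \<otimes> h g' = \<zero>"
  shows "\<exists>r\<in>carrier (S \<Gamma>). \<exists>s\<in>carrier (S \<Gamma>). r \<star> f = s \<star> h \<and> r \<star> f \<noteq> (\<lambda>g. \<zero>)"
proof -
  interpret A: ring "S \<Gamma>" using skew_is_ring[OF \<Gamma>] .
  note UI = uniform_left_idealD[OF U]
  note extI = left_ideal_ext[OF \<Gamma> UI]
  \<comment> \<open>The boolean selects \<open>f\<close> or \<open>h\<close>, so that all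
    \<open>2 |P|\<close> translates are indexed by \<open>P \<times> UNIV\<close>.\<close>
  define w where "w c = (if c then f else h)" for c
  have wE: "w c \<in> ext \<Gamma> U" and wnz: "w c \<noteq> (\<lambda>g. \<zero>)" for c using f h by (auto simp: w_def)
  have wA: "w c \<in> carrier (S \<Gamma>)" for c using A.left_ideal_carrier[OF extI wE] .
  have wG: "w c \<in> carrier (S G)" for c using \<Gamma>_up[OF \<Gamma> wA] .
  note wc = coeff_closed[OF wA]
  let ?D = "{g. f g \<noteq> \<zero>} \<union> {g. h g \<noteq> \<zero>}"
  have D: "finite ?D" "?D \<subseteq> \<Gamma>"
    using supp_finite[OF wA[of True]] supp_finite[OF wA[of False]] supp_subset[OF wA[of True]] supp_subset[OF wA[of False]]
    by (auto simp: w_def)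
  have wD: "g \<in> ?D" if "w c g \<noteq> \<zero>" for c g using that by (auto simp: w_def split: if_splits)
  obtain P where P: "finite P" "P \<subseteq> \<Gamma>" and small: "card ((\<lambda>(p, d). p + d) ` (P \<times> ?D)) < 2 * card P"
    using ex_small_doubling[OF D \<Gamma>] by blast
  define Q where "Q = (\<lambda>(p, d). p + d) ` (P \<times> ?D)"
  have Qf: "finite Q" unfolding Q_def using P D by blast
  have QI: "p + d \<in> Q" if "p \<in> P" "d \<in> ?D" for p d unfolding Q_def using that by (intro image_eqI[of _ _ "(p, d)"]) auto
  have Q\<Gamma>: "q \<in> \<Gamma>" if "q \<in> Q" for q
  proof -
    obtain p d where "p \<in> P" "d \<in> ?D" "q = p + d" using \<open>q \<in> Q\<close> unfolding Q_def by auto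
    then show ?thesis using submonoid_add[OF \<Gamma>, of p d] P D by blast
  qed
  have PG: "p \<in> G" if "p \<in> P" for p using P \<Gamma>_G[OF \<Gamma>] that by blast
  let ?J = "P \<times> (UNIV :: bool set)"
  define v where "v j q = (mon \<one> (fst j) \<star> w (snd j)) q" for j q
  have vq: "v (p, c) q = \<beta> p (w c (q - p))" if "p \<in> P" for p c q
    unfolding v_def using term_sm[OF PG[OF that] wG] by simp
  have "\<exists>b. (\<forall>j\<in>?J. b j \<in> carrier R) \<and> (\<forall>q\<in>Q. (\<Oplus>j\<in>?J. b j \<otimes> v j q) = \<zero>) \<and>
    (\<exists>j\<in>?J. \<exists>q\<in>Q. b j \<otimes> v j q \<noteq> \<zero>)"
  proof (rule dependent_in_uniform[where V = "\<lambda>q. \<beta> q ` U"])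
    show "finite Q" by (rule Qf)
    show "finite ?J" using P by simp
    show "card Q < card ?J" using small by (simp add: Q_def card_cartesian_product)
    show "uniform_left_ideal (\<beta> q ` U) R" if "q \<in> Q" for q
      by (rule uniform_left_ideal_\<beta>[OF U \<Gamma>_G[OF \<Gamma> Q\<Gamma>[OF that]]])
    show "v j q \<in> \<beta> q ` U" if j: "j \<in> ?J" and q: "q \<in> Q" for j q
    proof -
      have jP: "fst j \<in> P" using j by auto
      have "mon \<one> (fst j) \<in> carrier (S \<Gamma>)" using jP P by auto
      then have "mon \<one> (fst j) \<star> w (snd j) \<in> ext \<Gamma> U" using A.left_ideal_mult[OF extI _ wE] by simp
      then have "\<beta> (- q) (v j q) \<in> U" "v j q \<in> carrier R"
        using Q\<Gamma>[OF q] coeff_closed unfolding v_def ext_def by blast+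
      moreover from this have "v j q = \<beta> q (\<beta> (- q) (v j q))" using \<Gamma>_G[OF \<Gamma> Q\<Gamma>[OF q]] by simp
      ultimately show ?thesis by blast
    qed
    show "\<exists>q\<in>Q. v j q \<noteq> \<zero>" if j: "j \<in> ?J" for j
    proof -
      obtain p c where pc: "j = (p, c)" "p \<in> P" using j by auto
      obtain d where d: "w c d \<noteq> \<zero>" using wnz[of c] by auto
      have "p + d - p = d" by simp
      then have "v j (p + d) = \<beta> p (w c d)" using vq[OF pc(2), of c "p + d"] pc(1) by metis
      then have "v j (p + d) \<noteq> \<zero>" using d PG[OF pc(2)] wc by simp
      then show ?thesis using QI[OF pc(2) wD[OF d]] by blast
    qed
  qed
  then obtain b where b': "\<forall>j\<in>?J. b j \<in> carrier R" "\<forall>q\<in>Q. (\<Oplus>j\<in>?J. b j \<otimes> v j q) = \<zero>"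
    and bnz: "\<exists>j\<in>?J. \<exists>q\<in>Q. b j \<otimes> v j q \<noteq> \<zero>" by (elim exE conjE) (rule that)
  note b = bspec[OF b'(1)] and bz = bspec[OF b'(2)]
  \<comment> \<open>The coefficients of the relation are collected into one multiplier of
    \<open>f\<close> and one of \<open>h\<close>; the relation then reads
    \<open>Y True f + Y False h = 0\<close>.\<close>
  define Y where "Y c = (\<lambda>p. if p \<in> P then b (p, c) else \<zero>)" for c
  have Ysupp: "{p. Y c p \<noteq> \<zero>} \<subseteq> P" for c by (auto simp: Y_def)
  have YA: "Y c \<in> carrier (S \<Gamma>)" for c
    unfolding skew_carrier_iff using b finite_subset[OF Ysupp P(1)] Ysupp[of c] P(2) by (auto simp: Y_def)
  note YG = \<Gamma>_up[OF \<Gamma> YA]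
  have Yw: "(Y c \<star> w c) q = (\<Oplus>p\<in>P. b (p, c) \<otimes> v (p, c) q)" for c q
  proof -
    have "(Y c \<star> w c) q = (\<Oplus>p\<in>P. Y c p \<otimes> \<beta> p (w c (q - p)))"
      by (rule sm_eq[OF YG wG P(1) Ysupp]) (use PG in blast)
    also have "\<dots> = (\<Oplus>p\<in>P. b (p, c) \<otimes> v (p, c) q)"
      by (rule finsum_cong'[OF refl]) (use b vq PG wc in \<open>auto simp: Y_def\<close>)
    finally show ?thesis .
  qed
  have vc: "v j q \<in> carrier R" if "j \<in> ?J" for j q
    using vq[of "fst j" "snd j" q] PG[of "fst j"] wc that by auto
  have split: "(\<Oplus>j\<in>?J. b j \<otimes> v j q) = (Y True \<star> w True) q \<oplus> (Y False \<star> w False) q" for q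
  proof -
    let ?t = "\<lambda>j. b j \<otimes> v j q"
    have J: "?J = (\<lambda>p. (p, True)) ` P \<union> (\<lambda>p. (p, False)) ` P"
    proof (rule Set.set_eqI)
      fix j show "j \<in> ?J \<longleftrightarrow> j \<in> (\<lambda>p. (p, True)) ` P \<union> (\<lambda>p. (p, False)) ` P" by (cases j; cases "snd j") auto
    qed
    have tc: "?t j \<in> carrier R" if "j \<in> ?J" for j using b[OF that] vc[OF that] by simp
    have "finsum R ?t ?J = finsum R ?t ((\<lambda>p. (p, True)) ` P) \<oplus> finsum R ?t ((\<lambda>p. (p, False)) ` P)"
      unfolding J by (rule finsum_Un_disjoint) (use P tc in auto)
    also have "finsum R ?t ((\<lambda>p. (p, True)) ` P) = (\<Oplus>p\<in>P. ?t (p, True))"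
      by (rule finsum_reindex) (use tc in \<open>auto simp: inj_on_def\<close>)
    also have "finsum R ?t ((\<lambda>p. (p, False)) ` P) = (\<Oplus>p\<in>P. ?t (p, False))"
      by (rule finsum_reindex) (use tc in \<open>auto simp: inj_on_def\<close>)
    finally show ?thesis unfolding Yw .
  qed
  have YwG: "Y c \<star> w c \<in> carrier (S \<Gamma>)" for c using sm_closed[OF \<Gamma> YA wA] .
  have zQ: "(Y c \<star> w c) q = \<zero>" if "q \<notin> Q" for c q
  proof (rule ccontr)
    assume "(Y c \<star> w c) q \<noteq> \<zero>"
    then obtain p where p: "Y c p \<noteq> \<zero>" "w c (q - p) \<noteq> \<zero>" using sm_supp[OF YG wG] by blast
    have "p + (q - p) \<in> Q" using QI[OF _ wD[OF p(2)]] Ysupp p(1) by blast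
    then show False using that by simp
  qed
  have sum0: "(Y True \<star> w True) q \<oplus> (Y False \<star> w False) q = \<zero>" for q
    using split[of q] bz[of q] zQ[of q] by (cases "q \<in> Q") auto
  \<comment> \<open>If \<open>Y True f\<close> vanished, so would \<open>Y False h\<close>. Termwise
    annihilation would then make every summand of the relation zero, contradicting its
    nontriviality.\<close>
  have nz: "Y True \<star> w True \<noteq> (\<lambda>g. \<zero>)"
  proof
    assume T0: "Y True \<star> w True = (\<lambda>g. \<zero>)"
    have "(Y False \<star> w False) q = \<zero>" for q using sum0[of q] T0 coeff_closed[OF YwG[of False]] by simp
    then have "Y False \<star> w False = (\<lambda>g. \<zero>)" by auto
    then have z: "Y c \<star> w c = (\<lambda>g. \<zero>)" for c using T0 by (cases c) auto
    obtain p c q where pcq: "p \<in> P" "b (p, c) \<otimes> v (p, c) q \<noteq> \<zero>" using bnz by auto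
    have "Y c p \<otimes> \<beta> p (w c (q - p)) = \<zero>"
      by (rule annihilator_termwise[OF YG wG z _ PG[OF pcq(1)]]) (use gf gh in \<open>auto simp: w_def split: if_splits\<close>)
    then show False using pcq vq[OF pcq(1), of c q] by (simp add: Y_def)
  qed
  have "\<ominus>\<^bsub>S \<Gamma>\<^esub> Y False \<in> carrier (S \<Gamma>)" by (rule A.a_inv_closed[OF YA])
  moreover have "(Y True \<otimes>\<^bsub>S \<Gamma>\<^esub> f) \<oplus>\<^bsub>S \<Gamma>\<^esub> (Y False \<otimes>\<^bsub>S \<Gamma>\<^esub> h) = \<zero>\<^bsub>S \<Gamma>\<^esub>"
    using sum0 by (simp add: w_def)
  then have "Y True \<otimes>\<^bsub>S \<Gamma>\<^esub> f = \<ominus>\<^bsub>S \<Gamma>\<^esub> (Y False \<otimes>\<^bsub>S \<Gamma>\<^esub> h)"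
    using A.minus_equality[of "Y True \<otimes>\<^bsub>S \<Gamma>\<^esub> f" "Y False \<otimes>\<^bsub>S \<Gamma>\<^esub> h"] YwG[of True] YwG[of False] by (simp add: w_def)
  then have "Y True \<otimes>\<^bsub>S \<Gamma>\<^esub> f = (\<ominus>\<^bsub>S \<Gamma>\<^esub> Y False) \<otimes>\<^bsub>S \<Gamma>\<^esub> h"
    using A.l_minus[OF YA wA[of False]] by (simp add: w_def)
  ultimately show ?thesis using YA nz unfolding skew_mult w_def by (metis (full_types))
qed

text \<open>Scalar multiples of \<open>f\<close> and \<open>h\<close> with uniform annihilators
  exist and stay in \<open>ext \<Gamma> U\<close>; a common multiple of the scaled elements is also
  one of \<open>f\<close> and \<open>h\<close>.\<close>

lemma uniform_ext:
  assumes U: "uniform_left_ideal U R"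
  shows "uniform_left_ideal (ext \<Gamma> U) (S \<Gamma>)"
proof -
  interpret A: ring "S \<Gamma>" using skew_is_ring[OF \<Gamma>] .
  note UI = uniform_left_idealD[OF U]
  note extI = left_ideal_ext[OF \<Gamma> UI]
  show ?thesis
  proof (rule A.uniform_left_idealI[OF extI])
    obtain u where u: "u \<in> U" "u \<noteq> \<zero>" using nonzero_ex[OF UI] U by (auto simp: uniform_left_ideal_def)
    then have "mon u 0 \<in> ext \<Gamma> U" "mon u 0 \<noteq> \<zero>\<^bsub>S \<Gamma>\<^esub>" using mon_ext[OF \<Gamma> UI] by (auto dest: fun_cong[of _ _ 0])
    then show "ext \<Gamma> U \<noteq> {\<zero>\<^bsub>S \<Gamma>\<^esub>}" by blast
    fix f h assume f: "f \<in> ext \<Gamma> U" and h: "h \<in> ext \<Gamma> U" and nz: "f \<noteq> \<zero>\<^bsub>S \<Gamma>\<^esub>" "h \<noteq> \<zero>\<^bsub>S \<Gamma>\<^esub>"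
    have fc: "f \<in> carrier (S \<Gamma>)" and hc: "h \<in> carrier (S \<Gamma>)" using A.left_ideal_carrier[OF extI] f h by auto
    obtain b where b: "b \<in> carrier R" "mon b 0 \<star> f \<noteq> (\<lambda>g. \<zero>)"
      and gb: "\<forall>c\<in>carrier R. \<forall>g g'. (mon b 0 \<star> f) g \<noteq> \<zero> \<longrightarrow> c \<otimes> (mon b 0 \<star> f) g = \<zero> \<longrightarrow> c \<otimes> (mon b 0 \<star> f) g' = \<zero>"
      using ex_good_multiple[OF fc] nz by auto
    obtain d where d: "d \<in> carrier R" "mon d 0 \<star> h \<noteq> (\<lambda>g. \<zero>)"
      and gd: "\<forall>c\<in>carrier R. \<forall>g g'. (mon d 0 \<star> h) g \<noteq> \<zero> \<longrightarrow> c \<otimes> (mon d 0 \<star> h) g = \<zero> \<longrightarrow> c \<otimes> (mon d 0 \<star> h) g' = \<zero>"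
      using ex_good_multiple[OF hc] nz by auto
    have bc: "mon b 0 \<in> carrier (S \<Gamma>)" and dc: "mon d 0 \<in> carrier (S \<Gamma>)"
      using b d submonoid_zero[OF \<Gamma>] by auto
    have E: "mon b 0 \<star> f \<in> ext \<Gamma> U" "mon d 0 \<star> h \<in> ext \<Gamma> U"
      using A.left_ideal_mult[OF extI bc f] A.left_ideal_mult[OF extI dc h] by auto
    have "\<exists>r\<in>carrier (S \<Gamma>). \<exists>s\<in>carrier (S \<Gamma>). r \<star> (mon b 0 \<star> f) = s \<star> (mon d 0 \<star> h) \<and> r \<star> (mon b 0 \<star> f) \<noteq> (\<lambda>g. \<zero>)"
      by (rule uniform_ext_good[OF U E(1) b(2) E(2) d(2)]) (use gb gd in blast)+
    then obtain r s where rs: "r \<in> carrier (S \<Gamma>)" "s \<in> carrier (S \<Gamma>)"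
      "r \<star> (mon b 0 \<star> f) = s \<star> (mon d 0 \<star> h)" "r \<star> (mon b 0 \<star> f) \<noteq> (\<lambda>g. \<zero>)" by blast
    have "(r \<otimes>\<^bsub>S \<Gamma>\<^esub> mon b 0) \<otimes>\<^bsub>S \<Gamma>\<^esub> f = (s \<otimes>\<^bsub>S \<Gamma>\<^esub> mon d 0) \<otimes>\<^bsub>S \<Gamma>\<^esub> h"
      "(r \<otimes>\<^bsub>S \<Gamma>\<^esub> mon b 0) \<otimes>\<^bsub>S \<Gamma>\<^esub> f \<noteq> \<zero>\<^bsub>S \<Gamma>\<^esub>"
      using A.m_assoc[OF rs(1) bc fc] A.m_assoc[OF rs(2) dc hc] rs(3,4) by auto
    then show "\<exists>r\<in>carrier (S \<Gamma>). \<exists>s\<in>carrier (S \<Gamma>). r \<otimes>\<^bsub>S \<Gamma>\<^esub> f = s \<otimes>\<^bsub>S \<Gamma>\<^esub> h \<and> r \<otimes>\<^bsub>S \<Gamma>\<^esub> f \<noteq> \<zero>\<^bsub>S \<Gamma>\<^esub>"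
      using A.m_closed[OF rs(1) bc] A.m_closed[OF rs(2) dc] by blast
  qed
qed

text \<open>Taking the coefficient at \<open>g\<close> and twisting back by \<open>- g\<close> turns
  a relation among the extended ideals into a relation among the \<open>V i\<close>.\<close>

lemma indep_on_ext:
  assumes ind: "indep_on R I V"
  shows "indep_on (S \<Gamma>) I (\<lambda>i. ext \<Gamma> (V i))"
  unfolding indep_on_def
proof (intro conjI ballI allI impI)
  fix i assume i: "i \<in> I"
  note VI = indep_on_left_ideal[OF ind i]
  show "left_ideal (ext \<Gamma> (V i)) (S \<Gamma>)" by (rule left_ideal_ext[OF \<Gamma> VI])
  obtain u where u: "u \<in> V i" "u \<noteq> \<zero>" using nonzero_ex[OF VI indep_on_nonzero[OF ind i]] by blast
  then have "mon u 0 \<in> ext \<Gamma> (V i)" "mon u 0 \<noteq> \<zero>\<^bsub>S \<Gamma>\<^esub>" using mon_ext[OF \<Gamma> VI] by (auto dest: fun_cong[of _ _ 0])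
  then show "ext \<Gamma> (V i) \<noteq> {\<zero>\<^bsub>S \<Gamma>\<^esub>}" by blast
next
  fix Q f i
  assume "finite Q \<and> Q \<subseteq> I \<and> (\<forall>i\<in>Q. f i \<in> ext \<Gamma> (V i)) \<and> finsum (S \<Gamma>) f Q = \<zero>\<^bsub>S \<Gamma>\<^esub>" and i: "i \<in> Q"
  then have Q: "finite Q" "Q \<subseteq> I" and f: "\<And>i. i \<in> Q \<Longrightarrow> f i \<in> ext \<Gamma> (V i)" and z: "finsum (S \<Gamma>) f Q = \<zero>\<^bsub>S \<Gamma>\<^esub>" by auto
  have fc: "f i \<in> carrier (S \<Gamma>)" and fV: "\<And>g. g \<in> \<Gamma> \<Longrightarrow> \<beta> (- g) (f i g) \<in> V i" if "i \<in> Q" for i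
    using f[OF that] by (auto simp: ext_def)
  have "f i g = \<zero>" for g
  proof (cases "g \<in> \<Gamma>")
    case False
    then show ?thesis using supp_in[OF fc[OF i]] by blast
  next
    case True
    then have gG: "- g \<in> G" using \<Gamma>_G[OF \<Gamma>] by simp
    have "(\<Oplus>j\<in>Q. f j g) = \<zero>" using skew_finsum[OF \<Gamma>, of Q f g, OF fc] z by simp
    then have "(\<Oplus>j\<in>Q. \<beta> (- g) (f j g)) = \<zero>"
      using \<beta>_finsum[OF gG, of Q "\<lambda>j. f j g"] coeff_closed[OF fc] gG by simp
    then have "\<beta> (- g) (f i g) = \<zero>"
      by (rule indep_onD[OF ind Q, rotated]) (use fV True i in auto)
    then show ?thesis using gG coeff_closed[OF fc[OF i]] by simp
  qed
  then show "f i = \<zero>\<^bsub>S \<Gamma>\<^esub>" by auto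
qed

text \<open>Each of the finitely many coefficients, twisted back, is a finite sum of elements of the
  \<open>V i\<close>. Over a common finite index set these decompositions can be regrouped by
  \<open>i\<close> instead of by term.\<close>

lemma ext_ideal_sum:
  assumes V: "\<And>i. i \<in> I \<Longrightarrow> left_ideal (V i) R" and f: "f \<in> ext \<Gamma> (ideal_sum I V)"
  shows "\<exists>Q v. finite Q \<and> Q \<subseteq> I \<and> (\<forall>i\<in>Q. v i \<in> ext \<Gamma> (V i)) \<and> f = finsum (S \<Gamma>) v Q"
proof -
  have fc: "f \<in> carrier (S \<Gamma>)" and fs: "\<And>g. g \<in> \<Gamma> \<Longrightarrow> \<beta> (- g) (f g) \<in> ideal_sum I V" using f by (auto simp: ext_def)
  let ?F = "{g. f g \<noteq> \<zero>}"
  have F: "finite ?F" "?F \<subseteq> \<Gamma>" using supp_finite[OF fc] supp_subset[OF fc] .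
  have "\<forall>g\<in>?F. \<exists>t. finite (snd t) \<and> snd t \<subseteq> I \<and> (\<forall>i\<in>snd t. fst t i \<in> V i) \<and> \<beta> (- g) (f g) = finsum R (fst t) (snd t)"
  proof
    fix g assume "g \<in> ?F"
    then have "\<beta> (- g) (f g) \<in> ideal_sum I V" using fs F by blast
    then obtain u P where "\<beta> (- g) (f g) = finsum R u P" "finite P" "P \<subseteq> I" "\<forall>i\<in>P. u i \<in> V i"
      unfolding ideal_sum_def by blast
    then show "\<exists>t. finite (snd t) \<and> snd t \<subseteq> I \<and> (\<forall>i\<in>snd t. fst t i \<in> V i) \<and> \<beta> (- g) (f g) = finsum R (fst t) (snd t)"
      by (intro exI[of _ "(u, P)"]) simp
  qed
  from bchoice[OF this]
  obtain t where t: "\<forall>g\<in>?F. finite (snd (t g)) \<and> snd (t g) \<subseteq> I \<and> (\<forall>i\<in>snd (t g). fst (t g) i \<in> V i) \<and>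
      \<beta> (- g) (f g) = finsum R (fst (t g)) (snd (t g))" by (elim exE)
  define Q where "Q = (\<Union>g\<in>?F. snd (t g))"
  have Q: "finite Q" "Q \<subseteq> I" unfolding Q_def using t F by auto
  define u where "u g i = (if i \<in> snd (t g) then fst (t g) i else \<zero>)" for g i
  have uV: "u g i \<in> V i" if "g \<in> ?F" "i \<in> Q" for g i
    unfolding u_def by (rule ideal_sum_common_index(2)[OF V Q]) (use t that in \<open>auto simp: Q_def\<close>)
  have us: "\<beta> (- g) (f g) = (\<Oplus>i\<in>Q. u g i)" if g: "g \<in> ?F" for g
  proof -
    have "finsum R (fst (t g)) (snd (t g)) = (\<Oplus>i\<in>Q. u g i)"
      unfolding u_def by (rule ideal_sum_common_index(1)[OF V Q]) (use t g in \<open>auto simp: Q_def\<close>)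
    then show ?thesis using t g by simp
  qed
  \<comment> \<open>The \<open>i\<close>-th summand gathers the \<open>i\<close>-th parts of all
    coefficients, each twisted forward again to its term.\<close>
  define v where "v i g = (if g \<in> ?F then \<beta> g (u g i) else \<zero>)" for i g
  have VI: "left_ideal (V i) R" if "i \<in> Q" for i using V Q that by blast
  have uc: "u g i \<in> carrier R" if "g \<in> ?F" "i \<in> Q" for g i using left_ideal_carrier[OF VI uV] that by blast
  have FG: "g \<in> G" if "g \<in> ?F" for g using F \<Gamma>_G[OF \<Gamma>] that by blast
  have vc: "v i \<in> carrier (S \<Gamma>)" if i: "i \<in> Q" for i
  proof -
    have "{g. v i g \<noteq> \<zero>} \<subseteq> ?F" by (auto simp: v_def)
    moreover have "v i g \<in> carrier R" for g using uc[OF _ i] FG by (auto simp: v_def)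
    ultimately show ?thesis unfolding skew_carrier_iff using F finite_subset by blast
  qed
  have "v i \<in> ext \<Gamma> (V i)" if i: "i \<in> Q" for i
  proof -
    have "\<beta> (- g) (v i g) \<in> V i" if g: "g \<in> \<Gamma>" for g
    proof (cases "g \<in> ?F")
      case True
      then have "\<beta> (- g) (v i g) = u g i" using uc[OF True i] FG[OF True] by (simp add: v_def)
      then show ?thesis using uV[OF True i] by simp
    next
      case False
      then have "\<beta> (- g) (v i g) = \<zero>" using \<Gamma>_G[OF \<Gamma> g] by (simp add: v_def)
      then show ?thesis using left_ideal_zero[OF VI[OF i]] by simp
    qed
    then show ?thesis using vc[OF i] by (simp add: ext_def)
  qed
  moreover have "f = finsum (S \<Gamma>) v Q"
  proof
    fix g
    have "finsum (S \<Gamma>) v Q g = (\<Oplus>i\<in>Q. v i g)" by (rule skew_finsum[OF \<Gamma> vc])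
    also have "\<dots> = f g"
    proof (cases "g \<in> ?F")
      case True
      have "(\<Oplus>i\<in>Q. v i g) = (\<Oplus>i\<in>Q. \<beta> g (u g i))"
        by (rule finsum_cong'[OF refl]) (use True uc FG in \<open>auto simp: v_def\<close>)
      also have "\<dots> = \<beta> g (\<Oplus>i\<in>Q. u g i)" by (rule \<beta>_finsum[symmetric]) (use True uc FG in auto)
      also have "\<dots> = \<beta> g (\<beta> (- g) (f g))" using us[OF True] by simp
      also have "\<dots> = f g" using FG[OF True] coeff_closed[OF fc] by simp
      finally show ?thesis .
    next
      case False
      have "(\<Oplus>i\<in>Q. v i g) = (\<Oplus>i\<in>Q. \<zero>)"
        by (rule finsum_cong'[OF refl]) (use False in \<open>auto simp: v_def\<close>)
      then show ?thesis using False by simp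
    qed
    finally show "f g = finsum (S \<Gamma>) v Q g" by simp
  qed
  ultimately show ?thesis using Q by blast
qed

text \<open>The index set is unchanged, which is what makes the uniform dimensions of
  \<open>R\<close> and of the skew ring comparable through one cardinal.\<close>

lemma uniform_cover_ext:
  assumes cov: "uniform_cover R I V"
  shows "uniform_cover (S \<Gamma>) I (\<lambda>i. ext \<Gamma> (V i))"
  unfolding uniform_cover_def
proof (intro conjI ballI impI)
  have ind: "indep_on R I V" using cov by (simp add: uniform_cover_def)
  show "indep_on (S \<Gamma>) I (\<lambda>i. ext \<Gamma> (V i))" by (rule indep_on_ext[OF ind])
  show "uniform_left_ideal (ext \<Gamma> (V i)) (S \<Gamma>)" if "i \<in> I" for i
    using uniform_ext cov that by (simp add: uniform_cover_def)
  fix f assume f: "f \<in> carrier (S \<Gamma>)" and "f \<noteq> \<zero>\<^bsub>S \<Gamma>\<^esub>"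
  then have "f \<noteq> (\<lambda>g. \<zero>)" by simp
  then obtain r where r: "r \<in> carrier R" "mon r 0 \<star> f \<in> ext \<Gamma> (ideal_sum I V)" "mon r 0 \<star> f \<noteq> (\<lambda>g. \<zero>)"
    using ex_multiple_in_ext[OF \<Gamma> uniform_cover_essential[OF cov] f] by blast
  have "mon r 0 \<in> carrier (S \<Gamma>)" using r(1) submonoid_zero[OF \<Gamma>] by simp
  moreover have "\<exists>Q v. finite Q \<and> Q \<subseteq> I \<and> (\<forall>i\<in>Q. v i \<in> ext \<Gamma> (V i)) \<and> mon r 0 \<star> f = finsum (S \<Gamma>) v Q"
    by (rule ext_ideal_sum[OF indep_on_left_ideal[OF ind] r(2)])
  ultimately show "\<exists>b\<in>carrier (S \<Gamma>). b \<otimes>\<^bsub>S \<Gamma>\<^esub> f \<noteq> \<zero>\<^bsub>S \<Gamma>\<^esub> \<and>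
      (\<exists>Q v. finite Q \<and> Q \<subseteq> I \<and> (\<forall>i\<in>Q. v i \<in> ext \<Gamma> (V i)) \<and> b \<otimes>\<^bsub>S \<Gamma>\<^esub> f = finsum (S \<Gamma>) v Q)"
    using r(3) unfolding skew_mult skew_zero by blast
qed

lemma udim_le_skew: "udim_le R (S \<Gamma>)"
proof (rule udim_leI[OF skew_is_ring[OF \<Gamma>], where I = "\<lambda>F. F" and V = "\<lambda>_ J. ext \<Gamma> J"])
  fix F assume "indep_family R F"
  then show "indep_on (S \<Gamma>) F (\<lambda>J. ext \<Gamma> J) \<and> (card_of F, card_of F) \<in> ordLeq"
    using indep_on_ext by (simp add: indep_family_iff_indep_on)
qed

lemma enough_uniform_skew:
  assumes "enough_uniform R"
  shows "enough_uniform (S \<Gamma>)" "udim_eq (S \<Gamma>) R"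
proof -
  interpret A: ring "S \<Gamma>" using skew_is_ring[OF \<Gamma>] .
  obtain M where M: "uniform_cover R M (\<lambda>U. U)" using ex_uniform_cover[OF assms] by blast
  then have cov: "uniform_cover (S \<Gamma>) M (ext \<Gamma>)" by (rule uniform_cover_ext)
  show "enough_uniform (S \<Gamma>)" by (rule A.uniform_cover_enough_uniform[OF cov])
  have "udim_le (S \<Gamma>) R"
  \<comment> \<open>The same \<open>M\<close> answers every family: it is independent in
    \<open>R\<close>, and its extension bounds all independent families of
    \<open>S \<Gamma>\<close>.\<close>
  proof (rule udim_leI[OF ring_axioms, where I = "\<lambda>_. M" and V = "\<lambda>_ U. U"])
    fix F assume "indep_family (S \<Gamma>) F"
    then show "indep_on R M (\<lambda>U. U) \<and> (card_of F, card_of M) \<in> ordLeq"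
      using A.uniform_cover_card_bound[OF cov] M by (simp add: uniform_cover_def)
  qed
  then show "udim_eq (S \<Gamma>) R" using udim_le_skew by (simp add: udim_eq_def)
qed

end

end

section \<open>Subgroups of free abelian groups\<close>

definition additive_subset :: "('x \<Rightarrow> int) set \<Rightarrow> bool" where
  "additive_subset H \<longleftrightarrow> 0 \<in> H \<and> (\<forall>g\<in>H. \<forall>h\<in>H. g + h \<in> H) \<and> (\<forall>g\<in>H. - g \<in> H)"

lemma additive_subset_scale:
  assumes H: "additive_subset H" and g: "g \<in> H"
  shows "(\<lambda>v. k * g v) \<in> H"
proof -
  have nat: "(\<lambda>v. int n * g v) \<in> H" for n
  proof (induction n)
    case 0
    have "(\<lambda>v. int 0 * g v) = 0" by (simp add: fun_eq_iff)
    then show ?case using H unfolding additive_subset_def by metis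
  next
    case (Suc n)
    have "(\<lambda>v. int (Suc n) * g v) = (\<lambda>v. int n * g v) + g" by (simp add: fun_eq_iff algebra_simps)
    then show ?case using Suc H g unfolding additive_subset_def by metis
  qed
  show ?thesis
  proof (cases "k \<ge> 0")
    case True
    then show ?thesis using nat[of "nat k"] by simp
  next
    case False
    have "- (\<lambda>v. int (nat (- k)) * g v) \<in> H" using nat H unfolding additive_subset_def by blast
    moreover have "- (\<lambda>v. int (nat (- k)) * g v) = (\<lambda>v. k * g v)" using False by (simp add: fun_eq_iff)
    ultimately show ?thesis by metis
  qed
qed

lemma zcomb_empty: "zcomb c {} = 0"
  by (simp add: zcomb_def fun_eq_iff)

lemma zcomb_insert: "finite F \<Longrightarrow> y \<notin> F \<Longrightarrow> zcomb c (insert y F) = (\<lambda>v. c y * y v) + zcomb c F"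
  by (simp add: zcomb_def fun_eq_iff)

lemma zcomb_cong: "(\<And>y. y \<in> F \<Longrightarrow> c y = d y) \<Longrightarrow> zcomb c F = zcomb d F"
  by (simp add: zcomb_def)

lemma zcomb_extend: "finite F' \<Longrightarrow> F \<subseteq> F' \<Longrightarrow> zcomb c F = zcomb (\<lambda>y. if y \<in> F then c y else 0) F'"
  unfolding zcomb_def by (rule ext, rule sum.mono_neutral_cong_left) auto

lemma zcomb_add: "zcomb c F + zcomb d F = zcomb (\<lambda>y. c y + d y) F"
  by (simp add: zcomb_def fun_eq_iff sum.distrib algebra_simps)

lemma zcomb_diff: "zcomb c F - zcomb d F = zcomb (\<lambda>y. c y - d y) F"
  by (simp add: zcomb_def fun_eq_iff sum_subtractf algebra_simps)

lemma zcomb_mem: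
  assumes H: "additive_subset H" and "finite F" "F \<subseteq> H"
  shows "zcomb c F \<in> H"
  using assms(2,3)
proof (induction F rule: finite_induct)
  case empty
  show ?case unfolding zcomb_empty using H unfolding additive_subset_def by blast
next
  case (insert y F)
  then have "(\<lambda>v. c y * y v) \<in> H" "zcomb c F \<in> H" using additive_subset_scale[OF H] by auto
  then show ?case unfolding zcomb_insert[OF insert.hyps] using H unfolding additive_subset_def by blast
qed

text \<open>The values at \<open>x\<close> of the elements of \<open>H\<close> form a subgroup of
  the integers. Its least positive value divides all others by division with remainder, and
  \<open>b\<close> is an element attaining that value.\<close>

lemma ex_coordinate_generator:
  assumes H: "additive_subset H" and g: "g \<in> H" "g x \<noteq> 0"
  shows "\<exists>b\<in>H. b x > 0 \<and> (\<forall>h\<in>H. b x dvd h x)"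
proof -
  let ?P = "\<lambda>b. b \<in> H \<and> b x > 0"
  have "?P g \<or> ?P (- g)" using g H unfolding additive_subset_def by auto
  then obtain a where "?P a" by blast
  then obtain b where b: "?P b" and min: "\<And>h. ?P h \<Longrightarrow> nat (b x) \<le> nat (h x)"
    using ex_has_least_nat[of ?P a "\<lambda>h. nat (h x)"] by blast
  have "b x dvd h x" if h: "h \<in> H" for h
  proof -
    let ?h = "h + (\<lambda>v. - (h x div b x) * b v)"
    have "(\<lambda>v. - (h x div b x) * b v) \<in> H" by (rule additive_subset_scale[OF H]) (use b in blast)
    then have hH: "?h \<in> H" using H h unfolding additive_subset_def by blast
    have hx: "?h x = h x mod b x" by (simp add: minus_div_mult_eq_mod[symmetric])
    have "\<not> ?h x > 0"
    proof
      assume "?h x > 0"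
      then have "nat (b x) \<le> nat (?h x)" using min hH by blast
      moreover have "?h x < b x" using b unfolding hx by simp
      ultimately show False using b by linarith
    qed
    then have "h x mod b x = 0" unfolding hx using b pos_mod_sign[of "b x" "h x"] by linarith
    then show ?thesis by auto
  qed
  then show ?thesis using b by blast
qed

text \<open>Among the elements supported at or below a variable \<open>x\<close>, the values at
  \<open>x\<close> form a cyclic group; when it is nonzero, an element attaining a generator joins
  the basis. Subtracting multiples of these elements lowers the leading variable, which terminates
  in a well-order, and distinct leading variables give independence.\<close>

lemma ex_zbasis:
  assumes G: "additive_subset G" and fin: "\<And>g. g \<in> G \<Longrightarrow> finite {v. g v \<noteq> 0}"
  shows "\<exists>B. is_zbasis B G"
proof -
  obtain r :: "'a rel" where wo: "well_order_on UNIV r" using well_order_on by blast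
  then have r: "linear_order_on UNIV r" and wf: "wf (r - Id)" by (auto simp: well_order_on_def)
  have anti: "antisym r" and tot: "\<And>x y. x = y \<or> (x, y) \<in> r \<or> (y, x) \<in> r"
    using r by (auto simp: order_on_defs total_on_def)
  define H where "H x = {g \<in> G. \<forall>y. (x, y) \<in> r \<and> y \<noteq> x \<longrightarrow> g y = 0}" for x
  have HG: "additive_subset (H x)" for x using G unfolding additive_subset_def H_def by auto
  define I where "I = {x. \<exists>g\<in>H x. g x \<noteq> 0}"
  have "\<forall>x\<in>I. \<exists>b. b \<in> H x \<and> b x > 0 \<and> (\<forall>h\<in>H x. b x dvd h x)"
    using ex_coordinate_generator[OF HG] unfolding I_def by blast
  from bchoice[OF this] obtain b where
    b': "\<forall>x\<in>I. b x \<in> H x \<and> b x x > 0 \<and> (\<forall>h\<in>H x. b x x dvd h x)" by (elim exE)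
  then have b: "\<And>x. x \<in> I \<Longrightarrow> b x \<in> H x" "\<And>x. x \<in> I \<Longrightarrow> b x x > 0"
    "\<And>x h. x \<in> I \<Longrightarrow> h \<in> H x \<Longrightarrow> b x x dvd h x" by auto
  have lead: "\<exists>x. g \<in> H x \<and> g x \<noteq> 0" if "g \<in> G" "g \<noteq> 0" for g
    using ex_leads[OF r fin[OF that(1)] that(2)] that(1) unfolding leads_def H_def by blast
  define span where "span = {zcomb c F | c F. finite F \<and> F \<subseteq> b ` I}"
  have span0: "0 \<in> span"
    unfolding span_def by (intro CollectI exI[of _ "\<lambda>_. 0"] exI[of _ "{}"]) (simp add: zcomb_empty)
  have span_add: "g + (\<lambda>v. k * b x v) \<in> span" if g: "g \<in> span" and x: "x \<in> I" for g k x
  proof -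
    obtain c F where cF: "g = zcomb c F" "finite F" "F \<subseteq> b ` I" using g unfolding span_def by blast
    let ?F = "insert (b x) F"
    have "(\<lambda>v. k * b x v) = zcomb (\<lambda>_. k) {b x}" by (simp add: zcomb_def)
    also have "\<dots> = zcomb (\<lambda>y. if y \<in> {b x} then k else 0) ?F" by (rule zcomb_extend) (use cF in auto)
    moreover have "g = zcomb (\<lambda>y. if y \<in> F then c y else 0) ?F" unfolding cF(1) by (rule zcomb_extend) (use cF in auto)
    ultimately have "g + (\<lambda>v. k * b x v) = zcomb (\<lambda>y. (if y \<in> F then c y else 0) + (if y \<in> {b x} then k else 0)) ?F"
      using zcomb_add by metis
    moreover have "finite ?F" "?F \<subseteq> b ` I" using cF x by auto
    ultimately show ?thesis unfolding span_def by blast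
  qed
  have span_H: "\<forall>g. g \<in> H x \<longrightarrow> g \<in> span" for x
  proof (induction x rule: wf_induct_rule[OF wf])
    case (1 x)
    show ?case
    proof (intro allI impI)
      fix g assume g: "g \<in> H x"
      \<comment> \<open>A nonzero element of \<open>H x\<close> that vanishes at \<open>x\<close>
        has a smaller leading variable, where the induction hypothesis applies.\<close>
      have low: "h \<in> span" if h: "h \<in> H x" "h x = 0" for h
      proof (cases "h = 0")
        case False
        then obtain y where y: "h \<in> H y" "h y \<noteq> 0" using lead h unfolding H_def by blast
        have "y \<noteq> x" using y h by auto
        moreover have "(x, y) \<notin> r" using h y \<open>y \<noteq> x\<close> unfolding H_def by blast
        ultimately have "(y, x) \<in> r - Id" using tot[of x y] by auto
        then show ?thesis using 1 y by blast
      qed (use span0 in simp)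
      show "g \<in> span"
      proof (cases "g x = 0")
        case True
        then show ?thesis using low g by blast
      next
        case False
        then have x: "x \<in> I" using g unfolding I_def by blast
        obtain k where k: "g x = b x x * k" using b(3)[OF x g] by (elim dvdE)
        let ?h = "g + (\<lambda>v. - k * b x v)"
        have "(\<lambda>v. - k * b x v) \<in> H x" by (rule additive_subset_scale[OF HG b(1)[OF x]])
        then have "?h \<in> H x" using HG[of x] g unfolding additive_subset_def by blast
        moreover have "?h x = 0" using k by simp
        ultimately have "?h \<in> span" by (rule low)
        then have "?h + (\<lambda>v. k * b x v) \<in> span" by (rule span_add[OF _ x])
        moreover have "?h + (\<lambda>v. k * b x v) = g" by (simp add: fun_eq_iff)
        ultimately show ?thesis by metis
      qed
    qed
  qed
  have spanG: "\<exists>F c. finite F \<and> F \<subseteq> b ` I \<and> g = zcomb c F" if g: "g \<in> G" for g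
  proof -
    have "g \<in> span"
    proof (cases "g = 0")
      case False
      then show ?thesis using lead[OF g] span_H by blast
    qed (use span0 in simp)
    then show ?thesis unfolding span_def by blast
  qed
  have indep: "c y = 0" if F: "finite F" "F \<subseteq> b ` I" "zcomb c F = 0" and y: "y \<in> F" for F c y
  proof (rule ccontr)
    assume "c y \<noteq> 0"
    let ?N = "{x \<in> I. b x \<in> F \<and> c (b x) \<noteq> 0}"
    have binj: "x = x'" if "x \<in> I" "x' \<in> I" "b x = b x'" for x x'
    proof (rule ccontr)
      assume ne: "x \<noteq> x'"
      have "b x x' = 0" if "(x, x') \<in> r" using b(1)[OF \<open>x \<in> I\<close>] that ne unfolding H_def by blast
      moreover have "b x' x = 0" if "(x', x) \<in> r" using b(1)[OF \<open>x' \<in> I\<close>] that ne unfolding H_def by blast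
      ultimately show False using tot[of x x'] ne b(2)[OF \<open>x \<in> I\<close>] b(2)[OF \<open>x' \<in> I\<close>] \<open>b x = b x'\<close> by auto
    qed
    have "inj_on b ?N" using binj by (auto simp: inj_on_def)
    moreover have "finite (b ` ?N)" by (rule finite_subset[OF _ F(1)]) auto
    ultimately have "finite ?N" using finite_imageD by blast
    moreover have "?N \<noteq> {}" using F(2) y \<open>c y \<noteq> 0\<close> by blast
    \<comment> \<open>The relation is evaluated at the largest leading variable \<open>m\<close>
      among basis elements with nonzero coefficient: the others have smaller leading variables and
      so vanish at \<open>m\<close>.\<close>
    ultimately have "\<exists>m\<in>?N. \<forall>x\<in>?N. (x, m) \<in> r" by (rule finite_linear_order_max[OF r])
    then obtain m where m: "m \<in> ?N" and mr: "\<forall>x\<in>?N. (x, m) \<in> r" by (rule bexE)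
    have "(\<Sum>y\<in>F. c y * y m) = c (b m) * b m m + (\<Sum>y\<in>F - {b m}. c y * y m)"
      by (rule sum.remove[OF F(1)]) (use m in blast)
    also have "(\<Sum>y\<in>F - {b m}. c y * y m) = 0"
    proof (rule sum.neutral, rule ballI)
      fix z assume z: "z \<in> F - {b m}"
      then obtain x where x: "x \<in> I" "z = b x" using F(2) by blast
      show "c z * z m = 0"
      proof (cases "c z = 0")
        case False
        then have "(x, m) \<in> r" using mr x z by blast
        moreover have "m \<noteq> x" using z x by auto
        ultimately have "b x m = 0" using b(1)[OF x(1)] unfolding H_def by blast
        then show ?thesis using x by simp
      qed simp
    qed
    finally have "zcomb c F m = c (b m) * b m m" by (simp add: zcomb_def)
    then show False using F(3) m b(2)[of m] by auto
  qed
  have "b ` I \<subseteq> G" using b(1) unfolding H_def by blast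
  then have "is_zbasis (b ` I) G"
    unfolding is_zbasis_def gzero_eq using spanG indep by blast
  then show ?thesis by blast
qed

text \<open>This makes the results on fractions applicable with \<open>gen_monoid B\<close> as the
  monoid of terms; its group of quotients is all of \<open>G\<close>.\<close>

lemma gen_monoid_zbasis:
  assumes G: "additive_subset G" "G \<subseteq> free_ab XS" and B: "is_zbasis B G"
  shows "submonoid_G XS (gen_monoid B)" "quot_group (gen_monoid B) = G"
proof -
  have BG: "B \<subseteq> G" using B by (simp add: is_zbasis_def)
  have MG: "gen_monoid B \<subseteq> G"
    using zcomb_mem[OF G(1)] BG unfolding gen_monoid_def by blast
  have zero: "0 \<in> gen_monoid B"
    unfolding gen_monoid_def by (intro CollectI exI[of _ "\<lambda>_. 0"] exI[of _ "{}"]) (simp add: zcomb_empty)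
  have "s + t \<in> gen_monoid B" if s: "s \<in> gen_monoid B" and t: "t \<in> gen_monoid B" for s t
  proof -
    obtain c F where c: "s = zcomb c F" "finite F" "F \<subseteq> B" "\<forall>y. c y \<ge> 0" using s unfolding gen_monoid_def by blast
    obtain d E where d: "t = zcomb d E" "finite E" "E \<subseteq> B" "\<forall>y. d y \<ge> 0" using t unfolding gen_monoid_def by blast
    have "s = zcomb (\<lambda>y. if y \<in> F then c y else 0) (F \<union> E)" unfolding c(1) by (rule zcomb_extend) (use c d in auto)
    moreover have "t = zcomb (\<lambda>y. if y \<in> E then d y else 0) (F \<union> E)" unfolding d(1) by (rule zcomb_extend) (use c d in auto)
    ultimately have "s + t = zcomb (\<lambda>y. (if y \<in> F then c y else 0) + (if y \<in> E then d y else 0)) (F \<union> E)"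
      using zcomb_add by metis
    moreover have "finite (F \<union> E)" "F \<union> E \<subseteq> B" "\<forall>y. (if y \<in> F then c y else 0) + (if y \<in> E then d y else 0) \<ge> 0"
      using c d by auto
    ultimately show ?thesis unfolding gen_monoid_def by blast
  qed
  then show "submonoid_G XS (gen_monoid B)"
    unfolding submonoid_G_def gzero_eq gadd_eq using zero MG G(2) by blast
  show "quot_group (gen_monoid B) = G"
  proof
    show "quot_group (gen_monoid B) \<subseteq> G"
    proof
      fix g assume "g \<in> quot_group (gen_monoid B)"
      then obtain s t where "g = s - t" "s \<in> G" "t \<in> G" using MG unfolding quot_group_eq by blast
      then have "g = s + - t" "s \<in> G" "- t \<in> G" using G(1) unfolding additive_subset_def by auto
      then show "g \<in> G" using G(1) unfolding additive_subset_def by blast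
    qed
    show "G \<subseteq> quot_group (gen_monoid B)"
    proof
      fix g assume "g \<in> G"
      then obtain F c where c: "finite F" "F \<subseteq> B" "g = zcomb c F" using B unfolding is_zbasis_def by blast
      \<comment> \<open>An integer combination is the difference of its positive and negative parts,
        both of which lie in the monoid.\<close>
      let ?p = "\<lambda>y. max (c y) 0" and ?n = "\<lambda>y. max (- c y) 0"
      have "g = zcomb (\<lambda>y. ?p y - ?n y) F" unfolding c(3) by (rule zcomb_cong) auto
      then have "g = zcomb ?p F - zcomb ?n F" using zcomb_diff by metis
      moreover have "\<forall>y. ?p y \<ge> 0" "\<forall>y. ?n y \<ge> 0" by auto
      then have "zcomb ?p F \<in> gen_monoid B" "zcomb ?n F \<in> gen_monoid B"
        unfolding gen_monoid_def using c(1,2) by blast+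
      ultimately show "g \<in> quot_group (gen_monoid B)" unfolding quot_group_eq by blast
    qed
  qed
qed

theorem mainTheorem5:
  fixes R :: "('a, 'm) ring_scheme"
    and XS :: "'x set"
    and \<beta> :: "('x \<Rightarrow> int) \<Rightarrow> 'a \<Rightarrow> 'a"
    and T :: "('x \<Rightarrow> int) set"
  assumes "ring R"
    and "XS \<noteq> {}"
    and "skew_data R XS \<beta>"
    and "submonoid_G XS T"
  shows "denominator_set (skew_ring R \<beta> T) (term_elem R ` T)
    \<and> (\<exists>X'. is_zbasis X' (quot_group T)
          \<and> ring_of_fractions (skew_ring R \<beta> (quot_group T)) (skew_ring R \<beta> T) (term_elem R ` T)
          \<and> udim_eq (skew_ring R \<beta> T) (skew_ring R \<beta> (quot_group T))
          \<and> udim_eq (skew_ring R \<beta> (quot_group T)) (skew_ring R \<beta> (gen_monoid X')))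
    \<and> singular_ideal (skew_ring R \<beta> T) = coeff_in R \<beta> (singular_ideal R) T
    \<and> (enough_uniform R \<longrightarrow> enough_uniform (skew_ring R \<beta> T) \<and> udim_eq (skew_ring R \<beta> T) R)"
proof -
  interpret skew R XS \<beta> using assms(1,3) by (simp add: skew_def skew_axioms_def)
  note T = assms(4)
  note Q = submonoid_quot_group[OF T]
  have QG: "quot_group T \<subseteq> free_ab XS" by (rule submonoid_subset[OF Q(1)])
  have add: "additive_subset (quot_group T)"
    unfolding additive_subset_def using submonoid_zero[OF Q(1)] submonoid_add[OF Q(1)] Q(3) by blast
  have "finite {v. g v \<noteq> 0}" if "g \<in> quot_group T" for g
    using QG that unfolding free_ab_def by blast
  then obtain B where B: "is_zbasis B (quot_group T)" using ex_zbasis[OF add] by blast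
  note M = gen_monoid_zbasis[OF add QG B]
  \<comment> \<open>The monoid generated by the basis has the same group of quotients as
    \<open>T\<close>, so its monoid ring has the same ring of fractions; the comparison for
    \<open>gen_monoid B\<close> is read backwards.\<close>
  have u: "udim_eq (skew_ring R \<beta> (quot_group T)) (skew_ring R \<beta> (gen_monoid B))"
    using udim_eq_fractions[OF M(1)] unfolding M(2) by (simp add: udim_eq_def)
  show ?thesis
    by (intro conjI exI[of _ B] impI denominator_set_terms[OF T] B ring_of_fractions_terms[OF T]
        udim_eq_fractions[OF T] u singular_ideal_skew[OF T] enough_uniform_skew[OF T])
qed

end
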